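(* Let $\tau>0$ and let $(u_h^n,\omega_h^n)_{n}$ be the sequence in $\mathcal{C}^{per}_{N\times N}\times\mathcal{C}^{per}_{N\times N}$ generated from $u_h^0\in\mathcal{C}^{per}_{N\times N}$ by the first-order convex splitting scheme: for all $n\ge 0$, $$\frac{u_h^{n+1}-u_h^n}{\tau}=\Delta_h\omega_h^{n+1},\qquad \omega_h^{n+1}=(u_h^{n+1})^3+2\varepsilon^2[J\circledast\mathbf 1]u_h^{n+1}-u_h^n-\varepsilon^2[J\circledast\mathbf 1]u_h^n-\varepsilon^2[J\circledast u_h^n].$$ Then, as $n\to+\infty$, the sequence $(u_h^n,\omega_h^n)$ converges to a steady state $(u_h^\infty,\omega_h^\infty)$, which is a solution of $$(u_h^\infty\|\mathbf 1)=(u_h^0\|\mathbf 1),\qquad \omega_h^\infty=F'(u_h^\infty)+\varepsilon^2[J\circledast\mathbf 1]u_h^\infty-\varepsilon^2[J\circledast u_h^\infty].$$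
   Context: Setting (two-dimensional case). $\Omega=(0,L)\times(0,L)$, $h=L/N$ with $N\in\mathbb{Z}^+$, and $\varepsilon>0$. The kernel $J$ is integrable, sufficiently smooth, $\Omega$-periodic ($L$-periodic in each variable) and even ($J(\mathbf x)=J(-\mathbf x)$), with $J*1=\int_\Omega J\,d\mathbf x>0$. $\mathcal{C}^{per}_{N\times N}$ is the finite-dimensional space of real periodic cell-centered grid functions $\phi=(\phi_{i,j})$ (values at $((i-\tfrac12)h,(j-\tfrac12)h)$), extended $N$-periodically in both indices $i,j\in\mathbb{Z}$. $\mathbf 1$ is the constant grid function $1$; products, powers and $F'(u_h)$ are taken componentwise. $(\phi\|\psi)=\sum_{i,j=1}^N\phi_{i,j}\psi_{i,j}$. Convergence is in this finite-dimensional space. Discrete Laplacian: $(\Delta_h\phi)_{i,j}=h^{-2}(\phi_{i+1,j}+\phi_{i-1,j}+\phi_{i,j+1}+\phi_{i,j-1}-4\phi_{i,j})$. Discrete convolution: with $J_{k+\frac12,l+\frac12}:=J(kh,lh)$, $[J\circledast\phi]_{i,j}=h^2\sum_{k=1}^N\sum_{l=1}^N J_{k+\frac12,l+\frac12}\,\phi_{i-k,j-l}$. $[J\circledast\mathbf 1]$ is a constant grid function, identified with the number $h^2\sum_{k,l=1}^N J(kh,lh)$. Standing assumption: $\gamma:=\varepsilon^2(J*1)-1>0$ and its discrete analogue $\gamma_0:=\varepsilon^2[J\circledast\mathbf 1]-1>0$. Potential: $F(r)=\frac14(r^2-1)^2$, so $F'(r)=r^3-r$.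
   Formalization: The splitting is assumed to be genuinely convex: the implicitly and explicitly treated parts of the discrete energy are convex (true for J ≥ 0). Without this, sign-changing kernels J with a strongly negative mode admit period-two, non-convergent solutions. *)

theory Defs
  imports "HOL-Analysis.Analysis"
begin

text \<open>
  A periodic cell-centered grid function is represented by its \<open>N\<close>-periodic extension to
  \<open>\<int> \<times> \<int>\<close>.  Limits of grid functions are taken in the product topology of
  \<^typ>\<open>int \<Rightarrow> int \<Rightarrow> real\<close> (convergence at every grid point); on the finite-dimensional
  space \<open>grid_space N\<close> this is convergence in any norm.
\<close>

type_synonym grid = "int \<Rightarrow> int \<Rightarrow> real"

definition grid_space :: "nat \<Rightarrow> grid set" where
  "grid_space N =
     {\<phi>. \<forall>i j. \<phi> (i + int N) j = \<phi> i j \<and> \<phi> i (j + int N) = \<phi> i j}"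

definition grid_inner :: "nat \<Rightarrow> grid \<Rightarrow> grid \<Rightarrow> real" where
  "grid_inner N \<phi> \<psi> = (\<Sum>i = 1..int N. \<Sum>j = 1..int N. \<phi> i j * \<psi> i j)"

definition grid_one :: grid where
  "grid_one = (\<lambda>i j. 1)"

definition lap :: "real \<Rightarrow> grid \<Rightarrow> grid" where
  "lap h \<phi> = (\<lambda>i j.
     (\<phi> (i + 1) j + \<phi> (i - 1) j + \<phi> i (j + 1) + \<phi> i (j - 1) - 4 * \<phi> i j) / h\<^sup>2)"

definition conv :: "real \<Rightarrow> nat \<Rightarrow> (real \<times> real \<Rightarrow> real) \<Rightarrow> grid \<Rightarrow> grid" where
  "conv h N J \<phi> = (\<lambda>i j.
     h\<^sup>2 * (\<Sum>k = 1..int N. \<Sum>l = 1..int N.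
              J (of_int k * h, of_int l * h) * \<phi> (i - k) (j - l)))"

definition conv_one :: "real \<Rightarrow> nat \<Rightarrow> (real \<times> real \<Rightarrow> real) \<Rightarrow> real" where
  "conv_one h N J =
     h\<^sup>2 * (\<Sum>k = 1..int N. \<Sum>l = 1..int N. J (of_int k * h, of_int l * h))"

lemma conv_grid_one: "conv h N J grid_one = (\<lambda>i j. conv_one h N J)"
  by (simp add: conv_def conv_one_def grid_one_def)

text \<open>\<open>\<integral>\<^sub>\<Omega> J\<close> over \<open>\<Omega> = (0,L)\<^sup>2\<close>, the constant value of \<open>J * 1\<close> for periodic \<open>J\<close>.\<close>

definition kernel_mass :: "real \<Rightarrow> (real \<times> real \<Rightarrow> real) \<Rightarrow> real" where
  "kernel_mass L J = (LINT x:{0<..<L} \<times> {0<..<L}|lborel. J x)"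

text \<open>\<open>C_diff m f\<close>: \<open>f\<close> is of class \<open>C\<^sup>m\<close> on the plane.\<close>

primrec C_diff :: "nat \<Rightarrow> (real \<times> real \<Rightarrow> real) \<Rightarrow> bool" where
  "C_diff 0 f \<longleftrightarrow> continuous_on UNIV f"
| "C_diff (Suc m) f \<longleftrightarrow>
     (\<exists>f1 f2.
        (\<forall>x y. ((\<lambda>s. f (s, y)) has_real_derivative f1 (x, y)) (at x)) \<and>
        (\<forall>x y. ((\<lambda>s. f (x, s)) has_real_derivative f2 (x, y)) (at y)) \<and>
        C_diff m f1 \<and> C_diff m f2)"

definition pot :: "real \<Rightarrow> real" where
  "pot r = (r\<^sup>2 - 1)\<^sup>2 / 4"

lemma deriv_pot: "deriv pot r = r ^ 3 - r"
  by (rule DERIV_imp_deriv)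
     (auto simp: pot_def[abs_def] power2_eq_square power3_eq_cube field_simps
       intro!: derivative_eq_intros)

subsection \<open>The splitting of the discrete energy\<close>

text \<open>
  The scheme treats the gradient of \<open>energy_c\<close> implicitly and that of \<open>energy_e\<close> explicitly.
  It is a \<^emph>\<open>convex splitting\<close> scheme when both parts are convex.  Convexity of
  \<open>energy_e\<close> holds in particular for nonnegative kernels.  It does not follow from
  \<open>kernel_mass L J > 0\<close> alone: if \<open>J\<close> changes sign and is strongly negative on some
  oscillating mode, the scheme has nonconstant solutions of period two in \<open>n\<close>.
\<close>

definition energy :: "real \<Rightarrow> nat \<Rightarrow> (real \<times> real \<Rightarrow> real) \<Rightarrow> real \<Rightarrow> grid \<Rightarrow> real" where
  "energy h N J \<epsilon> \<phi> =
     h\<^sup>2 * (grid_inner N (\<lambda>i j. pot (\<phi> i j)) grid_one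
       + \<epsilon>\<^sup>2 / 2 * conv_one h N J * grid_inner N \<phi> \<phi>
       - \<epsilon>\<^sup>2 / 2 * grid_inner N \<phi> (conv h N J \<phi>))"

definition energy_c :: "real \<Rightarrow> nat \<Rightarrow> (real \<times> real \<Rightarrow> real) \<Rightarrow> real \<Rightarrow> grid \<Rightarrow> real" where
  "energy_c h N J \<epsilon> \<phi> =
     h\<^sup>2 * (grid_inner N (\<lambda>i j. ((\<phi> i j) ^ 4 + 1) / 4) grid_one
       + \<epsilon>\<^sup>2 * conv_one h N J * grid_inner N \<phi> \<phi>)"

definition energy_e :: "real \<Rightarrow> nat \<Rightarrow> (real \<times> real \<Rightarrow> real) \<Rightarrow> real \<Rightarrow> grid \<Rightarrow> real" where
  "energy_e h N J \<epsilon> \<phi> =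
     h\<^sup>2 * ((1 + \<epsilon>\<^sup>2 * conv_one h N J) / 2 * grid_inner N \<phi> \<phi>
       + \<epsilon>\<^sup>2 / 2 * grid_inner N \<phi> (conv h N J \<phi>))"

lemma energy_splitting: "energy h N J \<epsilon> \<phi> = energy_c h N J \<epsilon> \<phi> - energy_e h N J \<epsilon> \<phi>"
proof -
  have *: "pot r = (r ^ 4 + 1) / 4 - r * r / 2" for r :: real
    by (simp add: pot_def power2_eq_square power4_eq_xxxx field_simps)
  have "grid_inner N (\<lambda>i j. pot (\<phi> i j)) grid_one =
      grid_inner N (\<lambda>i j. ((\<phi> i j) ^ 4 + 1) / 4) grid_one - grid_inner N \<phi> \<phi> / 2"
    by (simp add: grid_inner_def grid_one_def * sum_subtractf sum_divide_distrib)
  then show ?thesis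
    unfolding energy_def energy_c_def energy_e_def by (simp only:) (simp add: field_simps)
qed

definition grid_convex :: "nat \<Rightarrow> (grid \<Rightarrow> real) \<Rightarrow> bool" where
  "grid_convex N E \<longleftrightarrow>
     (\<forall>\<phi> \<in> grid_space N. \<forall>\<psi> \<in> grid_space N. \<forall>t \<in> {0..1}.
        E (\<lambda>i j. (1 - t) * \<phi> i j + t * \<psi> i j) \<le> (1 - t) * E \<phi> + t * E \<psi>)"

definition convex_splitting :: "real \<Rightarrow> nat \<Rightarrow> (real \<times> real \<Rightarrow> real) \<Rightarrow> real \<Rightarrow> bool" where
  "convex_splitting h N J \<epsilon> \<longleftrightarrow>
     grid_convex N (energy_c h N J \<epsilon>) \<and> grid_convex N (energy_e h N J \<epsilon>)"

text \<open>
  Steady states of \<open>\<partial>\<^sub>t u = \<Delta>\<^sub>h \<omega>\<close>, where \<open>\<omega>\<close> is the chemical potential of \<open>u\<close>.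
\<close>

definition steady_state ::
    "real \<Rightarrow> nat \<Rightarrow> (real \<times> real \<Rightarrow> real) \<Rightarrow> real \<Rightarrow> grid \<Rightarrow> grid \<Rightarrow> bool" where
  "steady_state h N J \<epsilon> u \<omega> \<longleftrightarrow>
     u \<in> grid_space N \<and> \<omega> \<in> grid_space N \<and>
     (\<forall>i j. lap h \<omega> i j = 0) \<and>
     (\<forall>i j. \<omega> i j = deriv pot (u i j) + \<epsilon>\<^sup>2 * conv_one h N J * u i j - \<epsilon>\<^sup>2 * conv h N J u i j)"

end

theory Submission
  imports Defs
begin

text \<open>
  Restricted to the affine subspace of fixed mass, the discrete energy is a coercive polynomial
  \<open>f\<close>.  Convexity of the explicit part and the discrete Poincare inequality make the iterates a
  gradient-like descent: with \<open>\<Delta>\<^sub>n\<close> the norm of the \<open>n\<close>-th increment,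
  \<open>f\<close> decreases by at least \<open>c \<Delta>\<^sub>n\<^sup>2\<close> while its gradient is at most
  \<open>C \<Delta>\<^sub>n\<close> on the segment between the two iterates.  It remains to show that
  \<open>\<Sum> \<Delta>\<^sub>n\<close> is finite; steady states need not be isolated, so a Lojasiewicz type argument is
  needed.

  Fix a level \<open>t\<close> of \<open>f\<close> and minimise \<open>g = |\<nabla>f|\<^sup>2\<close> on it (the talweg of D'Acunto and
  Kurdyka).  The minimiser is obtained as limit of minimisers of
  \<open>g + \<langle>a, x\<rangle> + (f - t)\<^sup>2 / \<sigma>\<close>, where the components of \<open>a\<close> are suitable powers of
  \<open>\<sigma> \<rightarrow> 0\<close>.  There \<open>a = \<mu> \<nabla>f - \<nabla>g\<close>, so \<open>a\<close>, \<open>f\<close> and a coordinate \<open>x\<^sub>i\<close> are \<open>d + 2\<close>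
  polynomials in the \<open>d + 1\<close> variables \<open>x, \<mu>\<close> and hence algebraically dependent; the lowest power
  of \<open>\<sigma>\<close> in the relation yields a nonzero polynomial \<open>q\<^sub>i\<close> with \<open>q\<^sub>i(t, x\<^sub>i) = 0\<close>.  Near the limit
  level, the zeros of \<open>q\<^sub>i\<close> lie on finitely many curves of bounded variation, so the talweg has
  finite length.  A level interval on which \<open>|\<nabla>f| \<le> r\<close> along the talweg has length at most \<open>r\<close>
  times the length of the talweg over it.  Applied to the interval between two consecutive
  energies this bounds \<open>c \<Delta>\<^sub>n\<^sup>2\<close> by \<open>C \<Delta>\<^sub>n\<close> times the length of a piece of the talweg.
\<close>

section \<open>Algebraic dependence of polynomial functions\<close>

text \<open>The geometry behind a Lojasiewicz inequality is reduced to zeros \<open>(t, s)\<close>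
  of one polynomial in two variables per coordinate. Two obstacles shape the argument. At an exact
  minimiser of \<open>g\<close> on a regular level, \<open>\<mu> Df - Dg\<close> vanishes, and an
  algebraic relation between its components, \<open>f\<close> and \<open>x i\<close> may reduce to 0
  = 0. The tilt \<open>a\<close> keeps these components nonzero, and exponents that are powers of a
  large base give distinct monomials in them distinct powers of \<sigma>, so the lowest power leaves
  something nonzero. Moreover, the point found on a level is an arbitrary choice, with no continuity
  in the level. It is therefore used only through a colouring: among k + 1 levels two chosen points
  share one of k colours, and points of one colour are no farther apart than the increment of a
  monotone function \<open>W\<close>. A jump of \<open>W\<close> does no harm, because only
  increments of \<open>W\<close> are ever summed. Since the energies decrease to their limit,
  everything is stated on an interval to the right of one level, and the finitely many exceptional
  levels of a polynomial are avoided by shrinking that interval.\<close>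

lemma homogeneous_system_nontrivial:
  fixes M :: "'a \<Rightarrow> 'b \<Rightarrow> real"
  assumes "finite B" "finite A" "card B < card A"
  shows "\<exists>c. (\<exists>a\<in>A. c a \<noteq> 0) \<and> (\<forall>b\<in>B. (\<Sum>a\<in>A. c a * M a b) = 0)"
  using assms
proof (induction B arbitrary: A M rule: finite_induct)
  case empty
  then have "A \<noteq> {}" by auto
  then show ?case by (intro exI[of _ "\<lambda>_. 1"]) auto
next
  case (insert b B)
  show ?case
  proof (cases "\<forall>a\<in>A. M a b = 0")
    case True
    have "card B < card A" using insert by simp
    from insert.IH[OF \<open>finite A\<close> this, of M] obtain c
      where "\<exists>a\<in>A. c a \<noteq> 0" "\<forall>b\<in>B. (\<Sum>a\<in>A. c a * M a b) = 0" by blast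
    then show ?thesis using True by (intro exI[of _ c]) auto
  next
    case False
    then obtain a0 where a0: "a0 \<in> A" "M a0 b \<noteq> 0" by blast
    let ?A = "A - {a0}"
    \<comment> \<open>Gaussian elimination with pivot \<open>M a0 b\<close>: equation
      \<open>b\<close> is solved for the unknown \<open>a0\<close>, which is then eliminated from
      the other equations.\<close>
    let ?M = "\<lambda>a b'. M a b' - M a b / M a0 b * M a0 b'"
    have "card B < card ?A" using insert a0 by (simp add: card_Diff_singleton)
    from insert.IH[OF _ this, of ?M] insert.prems obtain c
      where c: "\<exists>a\<in>?A. c a \<noteq> 0" "\<And>b'. b' \<in> B \<Longrightarrow> (\<Sum>a\<in>?A. c a * ?M a b') = 0" by blast
    define c' where "c' = c(a0 := - (\<Sum>a\<in>?A. c a * M a b) / M a0 b)"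
    have sum: "(\<Sum>a\<in>A. c' a * M a b') = (\<Sum>a\<in>?A. c a * M a b') - (\<Sum>a\<in>?A. c a * M a b) / M a0 b * M a0 b'" for b'
    proof -
      have "(\<Sum>a\<in>A. c' a * M a b') = c' a0 * M a0 b' + (\<Sum>a\<in>?A. c' a * M a b')"
        using a0 insert.prems by (simp add: sum.remove)
      also have "(\<Sum>a\<in>?A. c' a * M a b') = (\<Sum>a\<in>?A. c a * M a b')"
        by (intro sum.cong) (auto simp: c'_def)
      finally show ?thesis by (simp add: c'_def)
    qed
    have eq: "(\<Sum>a\<in>?A. c a * ?M a b') = (\<Sum>a\<in>?A. c a * M a b') - (\<Sum>a\<in>?A. c a * M a b) / M a0 b * M a0 b'" for b'
      by (simp add: algebra_simps sum_subtractf sum_distrib_left sum_divide_distrib)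
    show ?thesis
    proof (intro exI[of _ c'] conjI ballI)
      show "\<exists>a\<in>A. c' a \<noteq> 0" using c(1) by (auto simp: c'_def)
      fix b' assume "b' \<in> insert b B"
      then show "(\<Sum>a\<in>A. c' a * M a b') = 0"
        using a0(2) c(2) eq unfolding sum by auto
    qed
  qed
qed

section \<open>Polynomial functions and their monomial expansions\<close>

text \<open>Polynomials are kept as functions of assignments; limits, gradients and Lipschitz bounds
  then follow by rule induction, and formal coefficients appear only in the dimension count.\<close>

inductive polyfun :: "'v set \<Rightarrow> (('v \<Rightarrow> real) \<Rightarrow> real) \<Rightarrow> bool" for V where
  const: "polyfun V (\<lambda>x. c)"
| var: "v \<in> V \<Longrightarrow> polyfun V (\<lambda>x. x v)"
| add: "polyfun V p \<Longrightarrow> polyfun V q \<Longrightarrow> polyfun V (\<lambda>x. p x + q x)"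
| mult: "polyfun V p \<Longrightarrow> polyfun V q \<Longrightarrow> polyfun V (\<lambda>x. p x * q x)"

lemma polyfun_sum: "(\<And>a. a \<in> A \<Longrightarrow> polyfun V (p a)) \<Longrightarrow> polyfun V (\<lambda>x. \<Sum>a\<in>A. p a x)"
  by (induction A rule: infinite_finite_induct) (auto intro: polyfun.intros)

lemma polyfun_power: "polyfun V p \<Longrightarrow> polyfun V (\<lambda>x. p x ^ n)"
  by (induction n) (auto intro: polyfun.intros)

lemma polyfun_diff: "polyfun V p \<Longrightarrow> polyfun V q \<Longrightarrow> polyfun V (\<lambda>x. p x - q x)"
  using polyfun.add[OF _ polyfun.mult[OF polyfun.const[of V "-1"]], of p q] by simp

lemmas polyfun_intros = polyfun.intros polyfun_sum polyfun_power polyfun_diff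

text \<open>Bounding each exponent separately instead of the total degree makes the number of
  monomials a plain power, \<open>(D + 1) ^ card V\<close>.\<close>

definition monomials_span :: "'v set \<Rightarrow> nat \<Rightarrow> (('v \<Rightarrow> real) \<Rightarrow> real) set" where
  "monomials_span V D =
     {p. \<exists>c. \<forall>x. p x = (\<Sum>\<alpha>\<in>(V \<rightarrow>\<^sub>E {..D}). c \<alpha> * (\<Prod>v\<in>V. x v ^ \<alpha> v))}"

lemma monomials_span_monomial:
  assumes "finite V" "\<And>v. v \<in> V \<Longrightarrow> \<alpha> v \<le> D"
  shows "(\<lambda>x. c * (\<Prod>v\<in>V. x v ^ \<alpha> v)) \<in> monomials_span V D"
proof -
  let ?a = "restrict \<alpha> V"
  have "(\<Sum>\<beta>\<in>(V \<rightarrow>\<^sub>E {..D}). (if \<beta> = ?a then c else 0) * (\<Prod>v\<in>V. x v ^ \<beta> v))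
      = c * (\<Prod>v\<in>V. x v ^ \<alpha> v)" for x :: "'a \<Rightarrow> real"
  proof -
    have "(\<Sum>\<beta>\<in>(V \<rightarrow>\<^sub>E {..D}). (if \<beta> = ?a then c else 0) * (\<Prod>v\<in>V. x v ^ \<beta> v))
      = (\<Sum>\<beta>\<in>(V \<rightarrow>\<^sub>E {..D}). if \<beta> = ?a then c * (\<Prod>v\<in>V. x v ^ \<beta> v) else 0)"
      by (intro sum.cong) auto
    also have "\<dots> = c * (\<Prod>v\<in>V. x v ^ ?a v)"
      using assms by (subst sum.delta) (auto intro!: finite_PiE)
    also have "\<dots> = c * (\<Prod>v\<in>V. x v ^ \<alpha> v)" by (simp cong: prod.cong)
    finally show ?thesis .
  qed
  then show ?thesis unfolding monomials_span_def
    by (intro CollectI exI[of _ "\<lambda>\<beta>. if \<beta> = ?a then c else 0"] allI) metis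
qed

lemma monomials_span_add:
  assumes "p \<in> monomials_span V D" "q \<in> monomials_span V D"
  shows "(\<lambda>x. p x + q x) \<in> monomials_span V D"
proof -
  from assms obtain c d where
    "\<forall>x. p x = (\<Sum>\<alpha>\<in>(V \<rightarrow>\<^sub>E {..D}). c \<alpha> * (\<Prod>v\<in>V. x v ^ \<alpha> v))"
    "\<forall>x. q x = (\<Sum>\<alpha>\<in>(V \<rightarrow>\<^sub>E {..D}). d \<alpha> * (\<Prod>v\<in>V. x v ^ \<alpha> v))"
    unfolding monomials_span_def by blast
  then show ?thesis unfolding monomials_span_def
    by (intro CollectI exI[of _ "\<lambda>\<alpha>. c \<alpha> + d \<alpha>"] allI) (simp add: algebra_simps sum.distrib)
qed

lemma monomials_span_sum:
  assumes "finite V" "\<And>a. a \<in> A \<Longrightarrow> p a \<in> monomials_span V D"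
  shows "(\<lambda>x. \<Sum>a\<in>A. p a x) \<in> monomials_span V D"
proof -
  have "(\<lambda>x. 0 * (\<Prod>v\<in>V. x v ^ 0)) \<in> monomials_span V D"
    by (rule monomials_span_monomial) (use assms in auto)
  then have "(\<lambda>x. 0) \<in> monomials_span V D" by simp
  then show ?thesis using assms(2)
    by (induction A rule: infinite_finite_induct) (auto intro: monomials_span_add)
qed

lemma monomials_span_mono:
  assumes "finite V" "p \<in> monomials_span V D" "D \<le> D'"
  shows "p \<in> monomials_span V D'"
proof -
  from assms obtain c where
    c: "p = (\<lambda>x. \<Sum>\<alpha>\<in>(V \<rightarrow>\<^sub>E {..D}). c \<alpha> * (\<Prod>v\<in>V. x v ^ \<alpha> v))"
    unfolding monomials_span_def by fastforce
  show ?thesis unfolding c using assms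
    by (intro monomials_span_sum monomials_span_monomial) (auto simp: PiE_iff)
qed

lemma monomials_span_mult:
  assumes V: "finite V" and "p \<in> monomials_span V D" "q \<in> monomials_span V D'"
  shows "(\<lambda>x. p x * q x) \<in> monomials_span V (D + D')"
proof -
  from assms obtain c d where
    c: "p = (\<lambda>x. \<Sum>\<alpha>\<in>(V \<rightarrow>\<^sub>E {..D}). c \<alpha> * (\<Prod>v\<in>V. x v ^ \<alpha> v))" and
    d: "q = (\<lambda>x. \<Sum>\<alpha>\<in>(V \<rightarrow>\<^sub>E {..D'}). d \<alpha> * (\<Prod>v\<in>V. x v ^ \<alpha> v))"
    unfolding monomials_span_def by fastforce
  have eq: "(\<lambda>x. p x * q x) = (\<lambda>x. \<Sum>\<alpha>\<in>(V \<rightarrow>\<^sub>E {..D}). \<Sum>\<beta>\<in>(V \<rightarrow>\<^sub>E {..D'}).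
      (c \<alpha> * d \<beta>) * (\<Prod>v\<in>V. x v ^ (\<alpha> v + \<beta> v)))"
    unfolding c d by (simp add: sum_product power_add prod.distrib mult_ac)
  show ?thesis unfolding eq
    by (intro monomials_span_sum monomials_span_monomial V)
       (auto simp: PiE_iff intro!: add_mono)
qed

lemma monomials_span_power:
  assumes V: "finite V" and "p \<in> monomials_span V D"
  shows "(\<lambda>x. p x ^ n) \<in> monomials_span V (n * D)"
proof (induction n)
  case 0
  show ?case using monomials_span_monomial[OF V, of "\<lambda>_. 0" 0 1] by simp
next
  case (Suc n)
  show ?case using monomials_span_mult[OF V assms(2) Suc] by simp
qed

lemma monomials_span_prod:
  assumes V: "finite V" and "\<And>j. j \<in> J \<Longrightarrow> p j \<in> monomials_span V D"
  shows "(\<lambda>x. \<Prod>j\<in>J. p j x) \<in> monomials_span V (card J * D)"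
  using assms(2)
proof (induction J rule: infinite_finite_induct)
  case (infinite A)
  then show ?case using monomials_span_monomial[OF V, of "\<lambda>_. 0" 0 1] by simp
next
  case empty
  then show ?case using monomials_span_monomial[OF V, of "\<lambda>_. 0" 0 1] by simp
next
  case (insert j J)
  then show ?case using monomials_span_mult[OF V, of "p j" D "\<lambda>x. \<Prod>j\<in>J. p j x" "card J * D"] by simp
qed

lemma polyfun_monomials_span:
  assumes V: "finite V" and "polyfun V p"
  shows "\<exists>D. p \<in> monomials_span V D"
  using assms(2)
proof (induction rule: polyfun.induct)
  case (const c)
  show ?case using monomials_span_monomial[OF V, of "\<lambda>_. 0" 0 c] by auto
next
  case (var w)
  have "(\<lambda>x. 1 * (\<Prod>v\<in>V. x v ^ (if v = w then 1 else 0))) \<in> monomials_span V 1"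
    by (rule monomials_span_monomial[OF V]) auto
  moreover have "(\<Prod>v\<in>V. x v ^ (if v = w then 1 else 0)) = x w" for x :: "'a \<Rightarrow> real"
  proof -
    have "(\<Prod>v\<in>V. x v ^ (if v = w then 1 else 0)) = (\<Prod>v\<in>V. if v = w then x v else 1)"
      by (intro prod.cong) auto
    then show ?thesis using V var by simp
  qed
  ultimately show ?case by auto
next
  case (add p q)
  then obtain D D' where "p \<in> monomials_span V D" "q \<in> monomials_span V D'" by blast
  then have "p \<in> monomials_span V (max D D')" "q \<in> monomials_span V (max D D')"
    by (auto intro: monomials_span_mono[OF V])
  then show ?case using monomials_span_add by blast
next
  case (mult p q)
  then show ?case using monomials_span_mult[OF V] by blast
qed

text \<open>Dimension count: exponents below \<open>n\<close> yield \<open>n ^ card J\<close>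
  products, all lying in a span of dimension O(\<open>n ^ card V\<close>).\<close>

lemma polyfun_algebraic_dependence:
  assumes V: "finite V" and J: "finite J" and card: "card V < card J"
    and P: "\<And>j. j \<in> J \<Longrightarrow> polyfun V (P j)"
  shows "\<exists>n c. (\<exists>\<alpha>\<in>(J \<rightarrow>\<^sub>E {..<n::nat}). c \<alpha> \<noteq> 0) \<and>
           (\<forall>x. (\<Sum>\<alpha>\<in>(J \<rightarrow>\<^sub>E {..<n}). c \<alpha> * (\<Prod>j\<in>J. P j x ^ \<alpha> j)) = 0)"
proof -
  have "\<forall>j\<in>J. \<exists>D. P j \<in> monomials_span V D"
    using P polyfun_monomials_span[OF V] by blast
  then obtain d where d: "\<And>j. j \<in> J \<Longrightarrow> P j \<in> monomials_span V (d j)" by metis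
  define D where "D = (\<Sum>j\<in>J. d j)"
  have D: "P j \<in> monomials_span V D" if "j \<in> J" for j
    by (rule monomials_span_mono[OF V d[OF that]]) (use J that in \<open>auto simp: D_def intro: member_le_sum\<close>)
  \<comment> \<open>The dimension is at most \<open>n ^ card V * (card J * D + 1) ^ card V\<close>;
    taking \<open>n\<close> larger than the second factor makes this less than
    \<open>n ^ Suc (card V)\<close>.\<close>
  define n where "n = Suc ((card J * D + 1) ^ card V)"
  define m where "m = card J * (n * D)"
  let ?A = "J \<rightarrow>\<^sub>E {..<n}" and ?B = "V \<rightarrow>\<^sub>E {..m}"
  have "(\<lambda>x. \<Prod>j\<in>J. P j x ^ \<alpha> j) \<in> monomials_span V m" if "\<alpha> \<in> ?A" for \<alpha>
    unfolding m_def
  proof (rule monomials_span_prod[OF V])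
    fix j assume "j \<in> J"
    with that have "\<alpha> j \<le> n" by (auto simp: PiE_iff less_imp_le)
    then show "(\<lambda>x. P j x ^ \<alpha> j) \<in> monomials_span V (n * D)"
      using monomials_span_mono[OF V monomials_span_power[OF V D[OF \<open>j \<in> J\<close>]]] by simp
  qed
  then have "\<forall>\<alpha>\<in>?A. \<exists>M. \<forall>x. (\<Prod>j\<in>J. P j x ^ \<alpha> j) = (\<Sum>\<beta>\<in>?B. M \<beta> * (\<Prod>v\<in>V. x v ^ \<beta> v))"
    unfolding monomials_span_def by blast
  from bchoice[OF this] obtain M where M: "\<And>\<alpha> x. \<alpha> \<in> ?A \<Longrightarrow>
      (\<Prod>j\<in>J. P j x ^ \<alpha> j) = (\<Sum>\<beta>\<in>?B. M \<alpha> \<beta> * (\<Prod>v\<in>V. x v ^ \<beta> v))" by blast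
  have "card ?B = (m + 1) ^ card V" using V by (simp add: card_PiE)
  also have "\<dots> \<le> (n * (card J * D + 1)) ^ card V"
    by (intro power_mono) (auto simp: m_def n_def algebra_simps)
  also have "\<dots> = n ^ card V * (card J * D + 1) ^ card V" by (rule power_mult_distrib)
  also have "\<dots> < n ^ card V * n" by (simp add: n_def)
  also have "\<dots> = n ^ Suc (card V)" by simp
  also have "\<dots> \<le> n ^ card J" using card by (intro power_increasing) (auto simp: n_def)
  also have "\<dots> = card ?A" using J by (simp add: card_PiE)
  finally obtain c where c: "\<exists>\<alpha>\<in>?A. c \<alpha> \<noteq> 0" "\<forall>\<beta>\<in>?B. (\<Sum>\<alpha>\<in>?A. c \<alpha> * M \<alpha> \<beta>) = 0"
    using homogeneous_system_nontrivial[of ?B ?A M] V J by (auto simp: finite_PiE)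
  have "(\<Sum>\<alpha>\<in>?A. c \<alpha> * (\<Prod>j\<in>J. P j x ^ \<alpha> j)) = 0" for x
  proof -
    have "(\<Sum>\<alpha>\<in>?A. c \<alpha> * (\<Prod>j\<in>J. P j x ^ \<alpha> j))
        = (\<Sum>\<alpha>\<in>?A. \<Sum>\<beta>\<in>?B. c \<alpha> * M \<alpha> \<beta> * (\<Prod>v\<in>V. x v ^ \<beta> v))"
      by (intro sum.cong) (auto simp: M sum_distrib_left mult.assoc)
    also have "\<dots> = (\<Sum>\<beta>\<in>?B. (\<Sum>\<alpha>\<in>?A. c \<alpha> * M \<alpha> \<beta>) * (\<Prod>v\<in>V. x v ^ \<beta> v))"
      by (subst sum.swap) (simp add: sum_distrib_right)
    also have "\<dots> = 0" using c(2) by simp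
    finally show ?thesis .
  qed
  with c(1) show ?thesis by blast
qed

section \<open>Bounded variation of the zeros of bivariate polynomials\<close>

text \<open>
  \<open>Z\<close> over \<open>(a, b)\<close> splits into finitely many graphs of partial functions, and a single bounded
  monotone function \<open>W\<close> controls the variation of all of them.
\<close>

definition bv_coloring ::
    "real \<Rightarrow> real \<Rightarrow> (real \<times> real) set \<Rightarrow> nat \<Rightarrow> (real \<Rightarrow> real \<Rightarrow> nat) \<Rightarrow> (real \<Rightarrow> real) \<Rightarrow> real \<Rightarrow> bool" where
  "bv_coloring a b Z k col W B \<longleftrightarrow>
     (\<forall>t s. a < t \<longrightarrow> t < b \<longrightarrow> (t, s) \<in> Z \<longrightarrow> col t s < k) \<and>
     (\<forall>t t'. a < t \<longrightarrow> t \<le> t' \<longrightarrow> t' < b \<longrightarrow> W t \<le> W t') \<and>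
     (\<forall>t. a < t \<longrightarrow> t < b \<longrightarrow> \<bar>W t\<bar> \<le> B) \<and>
     (\<forall>t t' s s'. a < t \<longrightarrow> t \<le> t' \<longrightarrow> t' < b \<longrightarrow> (t, s) \<in> Z \<longrightarrow> (t', s') \<in> Z \<longrightarrow>
        col t s = col t' s' \<longrightarrow> \<bar>s' - s\<bar> \<le> W t' - W t)"

definition bv_colorable :: "real \<Rightarrow> real \<Rightarrow> (real \<times> real) set \<Rightarrow> bool" where
  "bv_colorable a b Z \<longleftrightarrow> (\<exists>k col W B. bv_coloring a b Z k col W B)"

lemmas bv_coloringD =
  bv_coloring_def[THEN iffD1, THEN conjunct1, rule_format (no_asm)]
  bv_coloring_def[THEN iffD1, THEN conjunct2, THEN conjunct1, rule_format (no_asm)]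
  bv_coloring_def[THEN iffD1, THEN conjunct2, THEN conjunct2, THEN conjunct1, rule_format (no_asm)]
  bv_coloring_def[THEN iffD1, THEN conjunct2, THEN conjunct2, THEN conjunct2, rule_format (no_asm)]

lemma bv_colorable_subset:
  assumes "bv_colorable a b Z" "b' \<le> b" "\<And>t s. a < t \<Longrightarrow> t < b' \<Longrightarrow> (t, s) \<in> Z' \<Longrightarrow> (t, s) \<in> Z"
  shows "bv_colorable a b' Z'"
proof -
  from assms(1) obtain k col W B where "bv_coloring a b Z k col W B" unfolding bv_colorable_def by blast
  note W = bv_coloringD[OF this]
  show ?thesis unfolding bv_colorable_def bv_coloring_def
  proof (intro exI[of _ k] exI[of _ col] exI[of _ W] exI[of _ B] conjI allI impI)
    fix t s assume "a < t" "t < b'" "(t, s) \<in> Z'"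
    then show "col t s < k" using W(1) assms(2,3) by auto
  next
    fix t t' assume "a < t" "t \<le> t'" "t' < b'"
    then show "W t \<le> W t'" using W(2) assms(2) by auto
  next
    fix t assume "a < t" "t < b'"
    then show "\<bar>W t\<bar> \<le> B" using W(3) assms(2) by auto
  next
    fix t t' s s' assume *: "a < t" "t \<le> t'" "t' < b'" "(t, s) \<in> Z'" "(t', s') \<in> Z'" "col t s = col t' s'"
    then have "(t, s) \<in> Z" "(t', s') \<in> Z" "t' < b" using assms(2,3) by auto
    with * show "\<bar>s' - s\<bar> \<le> W t' - W t" by (intro W(4)) auto
  qed
qed

lemma bv_colorable_Un:
  assumes "bv_colorable a b Y" "bv_colorable a b Z"
  shows "bv_colorable a b (Y \<union> Z)"
proof -
  from assms(1) obtain k col W B where "bv_coloring a b Y k col W B" unfolding bv_colorable_def by blast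
  note 1 = bv_coloringD[OF this]
  from assms(2) obtain k' col' W' B' where "bv_coloring a b Z k' col' W' B'" unfolding bv_colorable_def by blast
  note 2 = bv_coloringD[OF this]
  \<comment> \<open>A common point is coloured as in \<open>Y\<close>; the offset \<open>k\<close>
    keeps the two palettes disjoint.\<close>
  let ?col = "\<lambda>t s. if (t, s) \<in> Y then col t s else k + col' t s"
  let ?W = "\<lambda>t. W t + W' t"
  show ?thesis unfolding bv_colorable_def bv_coloring_def
  proof (intro exI[of _ "k + k'"] exI[of _ ?col] exI[of _ ?W] exI[of _ "B + B'"] conjI allI impI)
    fix t s assume *: "a < t" "t < b" "(t, s) \<in> Y \<union> Z"
    show "?col t s < k + k'" using 1(1)[OF *(1,2), of s] 2(1)[OF *(1,2), of s] *(3) by auto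
  next
    fix t t' assume *: "a < t" "t \<le> t'" "t' < b"
    show "?W t \<le> ?W t'" using 1(2)[OF *] 2(2)[OF *] by simp
  next
    fix t assume *: "a < t" "t < b"
    show "\<bar>?W t\<bar> \<le> B + B'" using 1(3)[OF *] 2(3)[OF *] by simp
  next
    fix t t' s s' assume *: "a < t" "t \<le> t'" "t' < b" and
      **: "(t, s) \<in> Y \<union> Z" "(t', s') \<in> Y \<union> Z" "?col t s = ?col t' s'"
    have lt: "a < t'" "t < b" using * by auto
    show "\<bar>s' - s\<bar> \<le> ?W t' - ?W t"
    proof (cases "(t, s) \<in> Y")
      case True
      then have "(t', s') \<in> Y" using ** 1(1)[OF \<open>a < t\<close> lt(2) True] by (auto split: if_splits)
      then show ?thesis using 1(4)[OF * True \<open>(t', s') \<in> Y\<close>] ** True 2(2)[OF *] by auto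
    next
      case False
      then have "(t', s') \<notin> Y" using ** 1(1)[OF lt(1) \<open>t' < b\<close>, of s'] by (auto split: if_splits)
      then show ?thesis using 2(4)[OF *, of s s'] ** False 1(2)[OF *] by auto
    qed
  qed
qed

text \<open>One colour per height: a colour class has no variation, so a constant \<open>W\<close>
  suffices.\<close>

lemma bv_colorable_horizontal:
  assumes "finite C" "\<And>t s. a < t \<Longrightarrow> t < b \<Longrightarrow> (t, s) \<in> Z \<Longrightarrow> s \<in> C"
  shows "bv_colorable a b Z"
proof -
  obtain f and k :: nat where f: "inj_on f C" "f ` C = {..<k}"
    using finite_imp_inj_to_nat_seg[OF assms(1)] by (auto simp: lessThan_def)
  show ?thesis unfolding bv_colorable_def bv_coloring_def
  proof (intro exI[of _ k] exI[of _ "\<lambda>_. f"] exI[of _ "\<lambda>_. 0"] exI[of _ "0"] conjI allI impI)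
    fix t s assume "a < t" "t < b" "(t, s) \<in> Z"
    then show "f s < k" using assms(2) f(2) by blast
  next
    fix t t' s s' assume "a < t" "t \<le> t'" "t' < b" "(t, s) \<in> Z" "(t', s') \<in> Z" "f s = f s'"
    then have "s = s'" using assms(2)[of t s] assms(2)[of t' s'] f(1) by (auto dest: inj_onD)
    then show "\<bar>s' - s\<bar> \<le> 0 - 0" by simp
  qed auto
qed

section \<open>Local continuation of regular zeros\<close>

text \<open>A weak implicit function theorem: strict monotonicity in \<open>s\<close> gives
  uniqueness, the intermediate value theorem existence. Instead of a derivative of the branch only
  the sign of its displacement is recorded. The radius can be kept below any \<eta>, so that
  neighbourhoods of different zeros can be separated.\<close>

lemma regular_zero_continuation_pos:
  fixes P Ps Pt :: "real \<Rightarrow> real \<Rightarrow> real"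
  assumes cont: "continuous_on UNIV (\<lambda>(t, s). P t s)" "continuous_on UNIV (\<lambda>(t, s). Ps t s)"
      "continuous_on UNIV (\<lambda>(t, s). Pt t s)"
    and Ps: "\<And>t s. (P t has_real_derivative Ps t s) (at s)"
    and Pt: "\<And>t s. ((\<lambda>t. P t s) has_real_derivative Pt t s) (at t)"
    and zero: "P t0 s0 = 0" and pos: "Ps t0 s0 > 0" and ne: "Pt t0 s0 \<noteq> 0" and "\<eta> > 0"
  shows "\<exists>r>0. r \<le> \<eta> \<and> (\<exists>\<delta>>0. \<forall>t. \<bar>t - t0\<bar> < \<delta> \<longrightarrow> (\<exists>!s. \<bar>s - s0\<bar> < r \<and> P t s = 0) \<and>
      (\<forall>s. \<bar>s - s0\<bar> < r \<longrightarrow> P t s = 0 \<longrightarrow> Ps t s > 0 \<and> sgn (Pt t s) = sgn (Pt t0 s0) \<and>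
         - sgn (Pt t0 s0) * (t - t0) * (s - s0) \<ge> 0))"
proof -
  \<comment> \<open>A continuous function keeps its sign near a point where it is nonzero.\<close>
  have near: "\<exists>d>0. \<forall>t s. \<bar>t - t0\<bar> < d \<longrightarrow> \<bar>s - s1\<bar> < d \<longrightarrow> sgn (F t s) = sgn (F t0 s1)"
    if F: "continuous_on UNIV (\<lambda>(t, s). F t s)" and ne: "F t0 s1 \<noteq> 0" for F :: "real \<Rightarrow> real \<Rightarrow> real" and s1
  proof -
    have "isCont (\<lambda>(t, s). F t s) (t0, s1)" using F by (simp add: continuous_on_eq_continuous_at)
    then have "((\<lambda>(t, s). F t s) \<longlongrightarrow> F t0 s1) (at (t0, s1))" by (simp add: isCont_def)
    moreover have pos: "0 < \<bar>F t0 s1\<bar>" using ne by simp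
    ultimately have "\<forall>\<^sub>F y in at (t0, s1). dist ((\<lambda>(t, s). F t s) y) (F t0 s1) < \<bar>F t0 s1\<bar>"
      by (rule tendstoD)
    then obtain d where d: "d > 0" "\<And>t s. (t, s) \<noteq> (t0, s1) \<Longrightarrow> dist (t, s) (t0, s1) < d \<Longrightarrow>
        dist (F t s) (F t0 s1) < \<bar>F t0 s1\<bar>"
      unfolding eventually_at by fastforce
    show ?thesis
    proof (intro exI[of _ "d/2"] conjI allI impI)
      fix t s assume *: "\<bar>t - t0\<bar> < d/2" "\<bar>s - s1\<bar> < d/2"
      have "dist (t, s) (t0, s1) \<le> \<bar>t - t0\<bar> + \<bar>s - s1\<bar>"
        using sqrt_sum_squares_le_sum_abs[of "t - t0" "s - s1"] by (simp add: dist_Pair_Pair dist_real_def)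
      then have "dist (t, s) (t0, s1) < d" using * by simp
      with d(2)[of t s] pos have "dist (F t s) (F t0 s1) < \<bar>F t0 s1\<bar>"
        by (cases "(t, s) = (t0, s1)") auto
      then show "sgn (F t s) = sgn (F t0 s1)"
        by (auto simp: dist_real_def sgn_if abs_if split: if_splits)
    qed (use d in auto)
  qed
  obtain d1 where d1: "d1 > 0" "\<And>t s. \<bar>t - t0\<bar> < d1 \<Longrightarrow> \<bar>s - s0\<bar> < d1 \<Longrightarrow> sgn (Ps t s) = sgn (Ps t0 s0)"
    using near[OF cont(2), of s0] pos by auto
  obtain d2 where d2: "d2 > 0" "\<And>t s. \<bar>t - t0\<bar> < d2 \<Longrightarrow> \<bar>s - s0\<bar> < d2 \<Longrightarrow> sgn (Pt t s) = sgn (Pt t0 s0)"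
    using near[OF cont(3) ne] by auto
  define r where "r = min \<eta> (min d1 d2)"
  have r: "r > 0" "r \<le> \<eta>" "r \<le> d1" "r \<le> d2" using d1 d2 \<open>\<eta> > 0\<close> by (auto simp: r_def)
  have Ps_pos: "Ps t s > 0" if "\<bar>t - t0\<bar> < r" "\<bar>s - s0\<bar> < r" for t s
    using d1(2)[of t s] that r pos by (auto simp: sgn_if split: if_splits)
  have mono: "P t s < P t s'" if "\<bar>t - t0\<bar> < r" "\<bar>s - s0\<bar> < r" "\<bar>s' - s0\<bar> < r" "s < s'" for t s s'
  proof (rule DERIV_pos_imp_increasing[OF that(4)])
    fix x assume "s \<le> x" "x \<le> s'"
    then have "\<bar>x - s0\<bar> < r" using that by auto
    then show "\<exists>y. (P t has_real_derivative y) (at x) \<and> 0 < y" using Ps Ps_pos that by blast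
  qed
  have hi: "P t0 (s0 + r/2) > 0" using mono[of t0 s0 "s0 + r/2"] zero r by simp
  have lo: "P t0 (s0 - r/2) < 0" using mono[of t0 "s0 - r/2" s0] zero r by simp
  obtain d3 where d3: "d3 > 0" "\<And>t s. \<bar>t - t0\<bar> < d3 \<Longrightarrow> \<bar>s - (s0 + r/2)\<bar> < d3 \<Longrightarrow> sgn (P t s) = sgn (P t0 (s0 + r/2))"
    using near[OF cont(1), of "s0 + r/2"] hi by auto
  obtain d4 where d4: "d4 > 0" "\<And>t s. \<bar>t - t0\<bar> < d4 \<Longrightarrow> \<bar>s - (s0 - r/2)\<bar> < d4 \<Longrightarrow> sgn (P t s) = sgn (P t0 (s0 - r/2))"
    using near[OF cont(1), of "s0 - r/2"] lo by auto
  define \<delta> where "\<delta> = min r (min d3 d4)"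
  have \<delta>: "\<delta> > 0" "\<delta> \<le> r" "\<delta> \<le> d3" "\<delta> \<le> d4" using r d3 d4 by (auto simp: \<delta>_def)
  have main: "(\<exists>!s. \<bar>s - s0\<bar> < r \<and> P t s = 0) \<and>
      (\<forall>s. \<bar>s - s0\<bar> < r \<longrightarrow> P t s = 0 \<longrightarrow> Ps t s > 0 \<and> sgn (Pt t s) = sgn (Pt t0 s0) \<and>
         - sgn (Pt t0 s0) * (t - t0) * (s - s0) \<ge> 0)" if t: "\<bar>t - t0\<bar> < \<delta>" for t
  proof (intro conjI allI impI)
    have tr: "\<bar>t - t0\<bar> < r" using t \<delta> by simp
    have "sgn (P t (s0 + r/2)) = sgn (P t0 (s0 + r/2))" using t \<delta> r by (intro d3(2)) auto
    then have hi': "P t (s0 + r/2) > 0" using hi by (auto simp: sgn_if split: if_splits)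
    have "sgn (P t (s0 - r/2)) = sgn (P t0 (s0 - r/2))" using t \<delta> r by (intro d4(2)) auto
    then have lo': "P t (s0 - r/2) < 0" using lo by (auto simp: sgn_if split: if_splits)
    have "\<exists>s\<ge>s0 - r/2. s \<le> s0 + r/2 \<and> P t s = 0"
    proof (rule IVT')
      show "continuous_on {s0 - r/2..s0 + r/2} (P t)"
        using Ps by (intro continuous_at_imp_continuous_on) (auto intro: DERIV_isCont)
    qed (use hi' lo' r in auto)
    then obtain s where "s \<ge> s0 - r/2" "s \<le> s0 + r/2" and s: "P t s = 0" by blast
    then have "\<bar>s - s0\<bar> < r" using r(1) unfolding abs_less_iff by linarith
    note s = this s
    show "\<exists>!s. \<bar>s - s0\<bar> < r \<and> P t s = 0"
    proof (rule ex1I[of _ s])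
      fix s' assume "\<bar>s' - s0\<bar> < r \<and> P t s' = 0"
      then show "s' = s" using mono[OF tr, of s s'] mono[OF tr, of s' s] s
        by (metis less_irrefl linorder_neqE)
    qed (use s in auto)
    fix s assume s: "\<bar>s - s0\<bar> < r" "P t s = 0"
    show "Ps t s > 0" using Ps_pos tr s by simp
    show "sgn (Pt t s) = sgn (Pt t0 s0)" using tr s r by (intro d2(2)) auto
    \<comment> \<open>The mean value theorem in \<open>t\<close> at fixed height \<open>s0\<close>
      gives the sign of \<open>P t s0\<close>; monotonicity in \<open>s\<close> then tells on which
      side of \<open>s0\<close> the zero lies.\<close>
    obtain \<xi> where \<xi>: "\<bar>\<xi> - t0\<bar> < r" "P t s0 = (t - t0) * Pt \<xi> s0"
    proof (cases t t0 rule: linorder_cases)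
      case less
      from MVT2[OF less, of "\<lambda>t. P t s0" "\<lambda>t. Pt t s0"] Pt
      obtain z where "t < z" "z < t0" "P t0 s0 - P t s0 = (t0 - t) * Pt z s0" by blast
      then show ?thesis using that[of z] tr zero by (simp add: algebra_simps)
    next
      case equal
      then show ?thesis using that[of t0] zero r by simp
    next
      case greater
      from MVT2[OF greater, of "\<lambda>t. P t s0" "\<lambda>t. Pt t s0"] Pt
      obtain z where "t0 < z" "z < t" "P t s0 - P t0 s0 = (t - t0) * Pt z s0" by blast
      then show ?thesis using that[of z] tr zero by simp
    qed
    have "sgn (Pt \<xi> s0) = sgn (Pt t0 s0)" using \<xi>(1) r by (intro d2(2)) auto
    then have "sgn (P t s0) = sgn (t - t0) * sgn (Pt t0 s0)" by (simp add: \<xi>(2) sgn_mult)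
    moreover have "sgn (s - s0) = - sgn (P t s0)"
      using mono[OF tr, of s s0] mono[OF tr, of s0 s] s r by (cases s s0 rule: linorder_cases) auto
    ultimately have e: "sgn (s - s0) = - (sgn (t - t0) * sgn (Pt t0 s0))" by simp
    have "- sgn (Pt t0 s0) * (t - t0) * (s - s0)
        = - sgn (Pt t0 s0) * (sgn (t - t0) * \<bar>t - t0\<bar>) * (sgn (s - s0) * \<bar>s - s0\<bar>)"
      by (simp only: sgn_mult_abs)
    also have "\<dots> = (sgn (Pt t0 s0) * sgn (t - t0))\<^sup>2 * (\<bar>t - t0\<bar> * \<bar>s - s0\<bar>)"
      unfolding e by (simp add: power2_eq_square)
    finally show "- sgn (Pt t0 s0) * (t - t0) * (s - s0) \<ge> 0" by simp
  qed
  show ?thesis using r \<delta> main by blast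
qed

text \<open>The case of negative \<open>Ps\<close> follows by passing to \<open>- P\<close>, which
  leaves the zeros and \<open>dir\<close> unchanged.\<close>

lemma regular_zero_continuation:
  fixes P Ps Pt :: "real \<Rightarrow> real \<Rightarrow> real"
  assumes cont: "continuous_on UNIV (\<lambda>(t, s). P t s)" "continuous_on UNIV (\<lambda>(t, s). Ps t s)"
      "continuous_on UNIV (\<lambda>(t, s). Pt t s)"
    and Ps: "\<And>t s. (P t has_real_derivative Ps t s) (at s)"
    and Pt: "\<And>t s. ((\<lambda>t. P t s) has_real_derivative Pt t s) (at t)"
    and zero: "P t0 s0 = 0" and ne: "Ps t0 s0 \<noteq> 0" "Pt t0 s0 \<noteq> 0" and "\<eta> > 0"
  defines "dir \<equiv> \<lambda>t s. - sgn (Ps t s) * sgn (Pt t s)"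
  shows "\<exists>r \<delta>. r > 0 \<and> r \<le> \<eta> \<and> \<delta> > 0 \<and> (\<forall>t. \<bar>t - t0\<bar> < \<delta> \<longrightarrow> (\<exists>!s. \<bar>s - s0\<bar> < r \<and> P t s = 0) \<and>
      (\<forall>s. \<bar>s - s0\<bar> < r \<longrightarrow> P t s = 0 \<longrightarrow> dir t s = dir t0 s0 \<and> dir t0 s0 * (t - t0) * (s - s0) \<ge> 0))"
proof (cases "Ps t0 s0 > 0")
  case True
  from regular_zero_continuation_pos[OF cont Ps Pt zero True ne(2) \<open>\<eta> > 0\<close>]
  obtain r \<delta> where "r > 0" "r \<le> \<eta>" "\<delta> > 0" and
    "\<forall>t. \<bar>t - t0\<bar> < \<delta> \<longrightarrow> (\<exists>!s. \<bar>s - s0\<bar> < r \<and> P t s = 0) \<and>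
      (\<forall>s. \<bar>s - s0\<bar> < r \<longrightarrow> P t s = 0 \<longrightarrow> Ps t s > 0 \<and> sgn (Pt t s) = sgn (Pt t0 s0) \<and>
         - sgn (Pt t0 s0) * (t - t0) * (s - s0) \<ge> 0)" by blast
  then show ?thesis using True unfolding dir_def by (intro exI[of _ r] exI[of _ \<delta>]) auto
next
  case False
  have cont': "continuous_on UNIV (\<lambda>(t, s). - P t s)" "continuous_on UNIV (\<lambda>(t, s). - Ps t s)"
      "continuous_on UNIV (\<lambda>(t, s). - Pt t s)"
    using cont[THEN continuous_on_minus] by (simp_all add: case_prod_beta')
  have D: "((\<lambda>s. - P t s) has_real_derivative - Ps t s) (at s)"
    "((\<lambda>t. - P t s) has_real_derivative - Pt t s) (at t)" for t s
    by (intro DERIV_minus Ps Pt)+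
  have "- P t0 s0 = 0" "- Ps t0 s0 > 0" "- Pt t0 s0 \<noteq> 0" using zero False ne by auto
  from regular_zero_continuation_pos[OF cont' D this \<open>\<eta> > 0\<close>]
  obtain r \<delta> where r: "r > 0" "r \<le> \<eta>" "\<delta> > 0" and
    "\<forall>t. \<bar>t - t0\<bar> < \<delta> \<longrightarrow> (\<exists>!s. \<bar>s - s0\<bar> < r \<and> - P t s = 0) \<and>
      (\<forall>s. \<bar>s - s0\<bar> < r \<longrightarrow> - P t s = 0 \<longrightarrow> - Ps t s > 0 \<and> sgn (- Pt t s) = sgn (- Pt t0 s0) \<and>
         - sgn (- Pt t0 s0) * (t - t0) * (s - s0) \<ge> 0)" by blast
  then have *: "\<bar>t - t0\<bar> < \<delta> \<Longrightarrow> (\<exists>!s. \<bar>s - s0\<bar> < r \<and> P t s = 0) \<and>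
      (\<forall>s. \<bar>s - s0\<bar> < r \<longrightarrow> P t s = 0 \<longrightarrow> Ps t s < 0 \<and> sgn (Pt t s) = sgn (Pt t0 s0) \<and>
         sgn (Pt t0 s0) * (t - t0) * (s - s0) \<ge> 0)" for t
    by (simp add: sgn_minus)
  have "Ps t0 s0 < 0" using False ne by simp
  then show ?thesis using r * unfolding dir_def by (intro exI[of _ r] exI[of _ \<delta>]) auto
qed

section \<open>Total variation of a family of regular zeros\<close>

text \<open>\<open>boundary\<close> prevents zeros from crossing the heights \<open>R\<close> and
  \<open>- R\<close>, and \<open>regular\<close> excludes both branching and turning points; every
  branch is therefore monotone over the whole interval.\<close>

locale regular_zeros =
  fixes P Ps Pt :: "real \<Rightarrow> real \<Rightarrow> real" and a b R :: real
  assumes cont: "continuous_on UNIV (\<lambda>(t, s). P t s)" "continuous_on UNIV (\<lambda>(t, s). Ps t s)"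
      "continuous_on UNIV (\<lambda>(t, s). Pt t s)"
    and Ps: "\<And>t s. (P t has_real_derivative Ps t s) (at s)"
    and Pt: "\<And>t s. ((\<lambda>t. P t s) has_real_derivative Pt t s) (at t)"
    and finite_zeros: "\<And>t. a < t \<Longrightarrow> t < b \<Longrightarrow> finite {s. P t s = 0}"
    and boundary: "\<And>t s. a < t \<Longrightarrow> t < b \<Longrightarrow> \<bar>s\<bar> = R \<Longrightarrow> P t s \<noteq> 0"
    and regular: "\<And>t s. a < t \<Longrightarrow> t < b \<Longrightarrow> P t s = 0 \<Longrightarrow> Ps t s \<noteq> 0 \<and> Pt t s \<noteq> 0"
begin

definition roots where "roots t = {s. \<bar>s\<bar> < R \<and> P t s = 0}"

text \<open>The sign of the slope \<open>- Pt / Ps\<close> of the branch through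
  \<open>(t, s)\<close>.\<close>

definition dir where "dir t s = - sgn (Ps t s) * sgn (Pt t s)"

text \<open>Rising branches count positively and falling ones negatively, so every movement of a
  root increases the sum. This is the function \<open>W\<close> of the colouring.\<close>

definition signed_sum where "signed_sum t = (\<Sum>s\<in>roots t. dir t s * s)"

lemma finite_roots: "a < t \<Longrightarrow> t < b \<Longrightarrow> finite (roots t)"
  using finite_zeros by (rule finite_subset[rotated]) (auto simp: roots_def)

lemma abs_dir: "a < t \<Longrightarrow> t < b \<Longrightarrow> s \<in> roots t \<Longrightarrow> \<bar>dir t s\<bar> = 1"
  using regular[of t s] by (auto simp: roots_def dir_def sgn_if abs_mult)

text \<open>Each root is followed along its branch; compactness of the heights not covered by the
  tracked intervals excludes new roots.\<close>

lemma roots_iso_local: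
  assumes t0: "a < t0" "t0 < b"
  shows "\<exists>\<delta>>0. \<forall>t. \<bar>t - t0\<bar> < \<delta> \<longrightarrow> (\<exists>h. bij_betw h (roots t0) (roots t) \<and> strict_mono_on (roots t0) h \<and>
      (\<forall>s\<in>roots t0. dir t (h s) = dir t0 s \<and> dir t0 s * (t - t0) * (h s - s) \<ge> 0))"
proof -
  let ?F = "roots t0"
  have F: "finite ?F" using finite_roots t0 by blast
  \<comment> \<open>All gaps between roots and all distances to the heights \<open>R\<close> and
    \<open>- R\<close>. Half the least of them is a radius for which the tracked intervals are
    disjoint and stay inside; the inserted 1 covers the case without roots.\<close>
  define D where "D = insert 1 ((\<lambda>(s, s'). s' - s) ` {(s, s') \<in> ?F \<times> ?F. s < s'} \<union> (\<lambda>s. R - \<bar>s\<bar>) ` ?F)"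
  define \<eta> where "\<eta> = Min D / 2"
  have "finite {(s, s') \<in> ?F \<times> ?F. s < s'}" by (rule finite_subset[of _ "?F \<times> ?F"]) (use F in auto)
  then have D: "finite D" "D \<noteq> {}" using F by (auto simp: D_def)
  have "\<forall>x\<in>D. x > 0" unfolding D_def by (auto simp: roots_def)
  then have "\<eta> > 0" using D by (auto simp: \<eta>_def)
  have sep: "s + 2 * \<eta> \<le> s'" if "s \<in> ?F" "s' \<in> ?F" "s < s'" for s s'
  proof -
    have "s' - s \<in> D" using that by (auto simp: D_def intro!: image_eqI[of _ _ "(s, s')"])
    then have "Min D \<le> s' - s" using D by simp
    then show ?thesis by (simp add: \<eta>_def)
  qed
  have sepR: "\<bar>s\<bar> + \<eta> \<le> R" if "s \<in> ?F" for s
  proof -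
    have "R - \<bar>s\<bar> \<in> D" using that by (auto simp: D_def)
    then show ?thesis using D Min_le[of D "R - \<bar>s\<bar>"] \<open>\<eta> > 0\<close> unfolding \<eta>_def by linarith
  qed
  define track where "track s r \<delta> \<longleftrightarrow> r > 0 \<and> r \<le> \<eta> \<and> \<delta> > 0 \<and> (\<forall>t. \<bar>t - t0\<bar> < \<delta> \<longrightarrow> (\<exists>!s'. \<bar>s' - s\<bar> < r \<and> P t s' = 0) \<and>
      (\<forall>s'. \<bar>s' - s\<bar> < r \<longrightarrow> P t s' = 0 \<longrightarrow> dir t s' = dir t0 s \<and> dir t0 s * (t - t0) * (s' - s) \<ge> 0))" for s r \<delta>
  have "\<forall>s\<in>?F. \<exists>r. \<exists>\<delta>. track s r \<delta>"
  proof
    fix s assume "s \<in> ?F"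
    then have "P t0 s = 0" "Ps t0 s \<noteq> 0" "Pt t0 s \<noteq> 0" using regular t0 by (auto simp: roots_def)
    from regular_zero_continuation[OF cont Ps Pt this \<open>\<eta> > 0\<close>]
    show "\<exists>r. \<exists>\<delta>. track s r \<delta>" unfolding track_def dir_def .
  qed
  from bchoice[OF this] obtain r where "\<forall>s\<in>?F. \<exists>\<delta>. track s (r s) \<delta>" ..
  from bchoice[OF this] obtain d where "\<forall>s\<in>?F. track s (r s) (d s)" ..
  note rd = this[unfolded track_def]
  define K where "K = {-R..R} - (\<Union>s\<in>?F. ball s (r s))"
  have K: "compact K" unfolding K_def by (intro compact_diff) auto
  have noK: "P t0 s \<noteq> 0" if "s \<in> K" for s
  proof
    assume "P t0 s = 0"
    moreover have "\<bar>s\<bar> \<le> R" using that by (auto simp: K_def)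
    ultimately have "s \<in> ?F" using boundary[OF t0, of s] by (auto simp: roots_def le_less)
    then show False using that rd by (force simp: K_def)
  qed
  \<comment> \<open>The times near \<open>t0\<close> at which some zero lies outside the tracked
    intervals. As the projection of a compact set it is closed, so it misses a neighbourhood of
    \<open>t0\<close>.\<close>
  define C where "C = fst ` ((cball t0 1 \<times> K) \<inter> (\<lambda>(t, s). P t s) -` {0})"
  have "closed ((\<lambda>(t, s). P t s) -` {0})" using cont(1) by (intro closed_vimage) auto
  then have "compact C" unfolding C_def using K
    by (intro compact_continuous_image compact_Int_closed compact_Times) (auto intro: continuous_intros)
  then have "open (- C)" by (simp add: compact_imp_closed open_Compl)
  moreover have "t0 \<in> - C" using noK by (auto simp: C_def)
  ultimately obtain e where e: "e > 0" "ball t0 e \<subseteq> - C" by (meson open_contains_ball)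
  define \<delta> where "\<delta> = Min (insert (min 1 e) (d ` ?F))"
  have "\<delta> \<le> min 1 e" unfolding \<delta>_def using F by (intro Min_le) auto
  moreover have "\<delta> > 0" using F rd e by (auto simp: \<delta>_def)
  ultimately have \<delta>: "\<delta> > 0" "\<delta> \<le> 1" "\<delta> \<le> e" by auto
  have \<delta>d: "\<delta> \<le> d s" if "s \<in> ?F" for s using F that by (auto simp: \<delta>_def)
  show ?thesis
  proof (intro exI[of _ \<delta>] conjI allI impI)
    fix t assume t: "\<bar>t - t0\<bar> < \<delta>"
    have uniq: "\<exists>!s'. \<bar>s' - s\<bar> < r s \<and> P t s' = 0" if "s \<in> ?F" for s
      using rd that t \<delta>d[OF that] by auto
    have props: "dir t s' = dir t0 s \<and> dir t0 s * (t - t0) * (s' - s) \<ge> 0"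
      if "s \<in> ?F" "\<bar>s' - s\<bar> < r s" "P t s' = 0" for s s'
      using rd that t \<delta>d[OF that(1)] by auto
    define h where "h s = (THE s'. \<bar>s' - s\<bar> < r s \<and> P t s' = 0)" for s
    have h: "\<bar>h s - s\<bar> < r s" "P t (h s) = 0" if "s \<in> ?F" for s
      using theI'[OF uniq[OF that]] unfolding h_def by auto
    have heq: "h s = s'" if "s \<in> ?F" "\<bar>s' - s\<bar> < r s" "P t s' = 0" for s s'
      using uniq[OF that(1)] h[OF that(1)] that by blast
    have r: "r s \<le> \<eta>" if "s \<in> ?F" for s using rd that by blast
    have hmono: "h s < h s'" if "s \<in> ?F" "s' \<in> ?F" "s < s'" for s s'
      using h(1)[OF that(1)] h(1)[OF that(2)] r[OF that(1)] r[OF that(2)] sep[OF that] by linarith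
    have h_in: "h s \<in> roots t" if "s \<in> ?F" for s
      using h[OF that] r[OF that] sepR[OF that] unfolding roots_def by auto
    have "s' \<in> h ` ?F" if "s' \<in> roots t" for s'
    proof -
      have "s' \<notin> K"
      proof
        assume "s' \<in> K"
        then have "(t, s') \<in> (cball t0 1 \<times> K) \<inter> (\<lambda>(t, s). P t s) -` {0}"
          using t \<delta> that by (auto simp: roots_def dist_real_def)
        then have "t \<in> C" unfolding C_def by (metis fst_conv image_eqI)
        then show False using e(2) t \<delta> by (auto simp: dist_real_def subset_eq abs_minus_commute)
      qed
      moreover have "s' \<in> {-R..R}" using that by (auto simp: roots_def)
      ultimately obtain s where "s \<in> ?F" "s' \<in> ball s (r s)" unfolding K_def by blast
      then have "s \<in> ?F" "\<bar>s' - s\<bar> < r s" by (auto simp: dist_real_def abs_minus_commute)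
      then show ?thesis using heq that by (force simp: roots_def)
    qed
    then have "h ` ?F = roots t" using h_in by blast
    moreover have "strict_mono_on ?F h" by (rule strict_mono_onI) (rule hmono)
    moreover from this have "inj_on h ?F" by (rule strict_mono_on_imp_inj_on)
    ultimately show "\<exists>h. bij_betw h ?F (roots t) \<and> strict_mono_on ?F h \<and>
      (\<forall>s\<in>?F. dir t (h s) = dir t0 s \<and> dir t0 s * (t - t0) * (h s - s) \<ge> 0)"
      using props h by (intro exI[of _ h]) (simp add: bij_betw_def)
  qed (use \<delta> in auto)
qed

text \<open>A transitive relation, so that the local statement can be extended to the whole interval
  by bisection.\<close>

definition linked where
  "linked t t' \<longleftrightarrow> signed_sum t \<le> signed_sum t' \<and> (\<exists>h. bij_betw h (roots t) (roots t') \<and>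
     strict_mono_on (roots t) h \<and> (\<forall>s\<in>roots t. \<bar>h s - s\<bar> \<le> signed_sum t' - signed_sum t))"

lemma linked_trans:
  assumes "linked t t'" "linked t' t''"
  shows "linked t t''"
proof -
  from assms obtain g h where
    g: "signed_sum t \<le> signed_sum t'" "bij_betw g (roots t) (roots t')" "strict_mono_on (roots t) g"
      "\<forall>s\<in>roots t. \<bar>g s - s\<bar> \<le> signed_sum t' - signed_sum t" and
    h: "signed_sum t' \<le> signed_sum t''" "bij_betw h (roots t') (roots t'')" "strict_mono_on (roots t') h"
      "\<forall>s\<in>roots t'. \<bar>h s - s\<bar> \<le> signed_sum t'' - signed_sum t'"
    unfolding linked_def by blast
  have g_in: "g s \<in> roots t'" if "s \<in> roots t" for s using g(2) that by (auto simp: bij_betw_def)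
  show ?thesis unfolding linked_def
  proof (intro conjI exI[of _ "h \<circ> g"] ballI)
    show "bij_betw (h \<circ> g) (roots t) (roots t'')" using g h bij_betw_trans by blast
    show "strict_mono_on (roots t) (h \<circ> g)"
      by (rule strict_mono_onI) (use g_in g(3) h(3) in \<open>auto dest: strict_mono_onD\<close>)
    fix s assume s: "s \<in> roots t"
    show "\<bar>(h \<circ> g) s - s\<bar> \<le> signed_sum t'' - signed_sum t"
      using bspec[OF g(4) s] bspec[OF h(4) g_in[OF s]] by (simp add: abs_if split: if_splits)
  qed (use g h in auto)
qed

text \<open>All terms \<open>dir t0 s * (h s - s)\<close> have the sign of \<open>t - t0\<close>.
  Nothing cancels in their sum, which therefore bounds each displacement.\<close>

lemma linked_local:
  assumes t0: "a < t0" "t0 < b"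
  shows "\<exists>\<delta>>0. \<forall>t. a < t \<longrightarrow> t < b \<longrightarrow> \<bar>t - t0\<bar> < \<delta> \<longrightarrow> (t0 \<le> t \<longrightarrow> linked t0 t) \<and> (t \<le> t0 \<longrightarrow> linked t t0)"
proof -
  from roots_iso_local[OF t0] obtain \<delta> where "\<delta> > 0" and \<delta>: "\<And>t. \<bar>t - t0\<bar> < \<delta> \<Longrightarrow>
      \<exists>h. bij_betw h (roots t0) (roots t) \<and> strict_mono_on (roots t0) h \<and>
      (\<forall>s\<in>roots t0. dir t (h s) = dir t0 s \<and> dir t0 s * (t - t0) * (h s - s) \<ge> 0)" by blast
  have "(t0 \<le> t \<longrightarrow> linked t0 t) \<and> (t \<le> t0 \<longrightarrow> linked t t0)" if t: "\<bar>t - t0\<bar> < \<delta>" "a < t" "t < b" for t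
  proof -
    from \<delta>[OF t(1)] obtain h where h: "bij_betw h (roots t0) (roots t)" "strict_mono_on (roots t0) h"
      "\<And>s. s \<in> roots t0 \<Longrightarrow> dir t (h s) = dir t0 s"
      "\<And>s. s \<in> roots t0 \<Longrightarrow> dir t0 s * (t - t0) * (h s - s) \<ge> 0" by blast
    have F: "finite (roots t0)" by (rule finite_roots[OF t0])
    have "signed_sum t = (\<Sum>s\<in>roots t0. dir t (h s) * h s)"
      unfolding signed_sum_def by (rule sum.reindex_bij_betw[OF h(1), symmetric])
    then have diff: "signed_sum t - signed_sum t0 = (\<Sum>s\<in>roots t0. dir t0 s * (h s - s))"
      by (simp add: signed_sum_def h(3) right_diff_distrib sum_subtractf)
    have sgn: "\<bar>h s - s\<bar> = sgn (t - t0) * (dir t0 s * (h s - s))" if "s \<in> roots t0" "t \<noteq> t0" for s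
    proof -
      have "\<bar>sgn (t - t0) * dir t0 s * (h s - s)\<bar> = \<bar>h s - s\<bar>"
        using abs_dir[OF t0 that(1)] that(2) by (simp add: abs_mult)
      moreover have "sgn (t - t0) * dir t0 s * (h s - s) \<ge> 0"
      proof -
        have "dir t0 s * (t - t0) * (h s - s) = \<bar>t - t0\<bar> * (sgn (t - t0) * dir t0 s * (h s - s))"
          by (simp add: sgn_if abs_if)
        then show ?thesis using h(4)[OF that(1)] that(2) by (metis right_minus_eq zero_le_mult_iff zero_less_abs_iff not_less)
      qed
      ultimately show ?thesis by simp
    qed
    have le: "\<bar>h s - s\<bar> \<le> sgn (t - t0) * (signed_sum t - signed_sum t0)" if "s \<in> roots t0" "t \<noteq> t0" for s
    proof -
      have "\<bar>h s - s\<bar> \<le> (\<Sum>s\<in>roots t0. \<bar>h s - s\<bar>)"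
        using F that by (intro member_le_sum) auto
      also have "\<dots> = (\<Sum>s\<in>roots t0. sgn (t - t0) * (dir t0 s * (h s - s)))"
        using that(2) by (intro sum.cong) (auto simp: sgn)
      finally show ?thesis by (simp add: diff sum_distrib_left)
    qed
    have nonneg: "sgn (t - t0) * (signed_sum t - signed_sum t0) \<ge> 0" if "t \<noteq> t0"
    proof -
      have "(\<Sum>s\<in>roots t0. sgn (t - t0) * (dir t0 s * (h s - s))) = (\<Sum>s\<in>roots t0. \<bar>h s - s\<bar>)"
        using that by (intro sum.cong) (auto simp: sgn)
      moreover have "(\<Sum>s\<in>roots t0. \<bar>h s - s\<bar>) \<ge> 0" by (intro sum_nonneg) auto
      ultimately show ?thesis by (simp add: diff sum_distrib_left)
    qed
    consider "t = t0" | "t > t0" | "t < t0" by linarith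
    then show ?thesis
    proof cases
      case 1
      have "linked t0 t0" unfolding linked_def
        by (intro conjI exI[of _ id]) (auto simp: strict_mono_on_def)
      then show ?thesis using 1 by simp
    next
      case 2
      have "linked t0 t" unfolding linked_def
        using h(1,2) le nonneg 2 by (intro conjI exI[of _ h]) auto
      then show ?thesis using 2 by simp
    next
      case 3
      \<comment> \<open>The tracking map starts at \<open>roots t0\<close>; for an earlier
        \<open>t\<close> the required map is its inverse.\<close>
      let ?g = "inv_into (roots t0) h"
      have inj: "inj_on h (roots t0)" and img: "h ` roots t0 = roots t" using h(1) by (auto simp: bij_betw_def)
      have "linked t t0" unfolding linked_def
      proof (intro conjI exI[of _ ?g] ballI)
        show "bij_betw ?g (roots t) (roots t0)" by (rule bij_betw_inv_into[OF h(1)])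
        show "signed_sum t \<le> signed_sum t0" using nonneg 3 by simp
        show "strict_mono_on (roots t) ?g"
        proof (rule strict_mono_onI)
          fix s s' assume s: "s \<in> roots t" "s' \<in> roots t" "s < s'"
          then obtain x x' where x: "x \<in> roots t0" "x' \<in> roots t0" "s = h x" "s' = h x'" using img by blast
          then have "x < x'" using s strict_mono_onD[OF h(2), of x' x]
            by (cases x x' rule: linorder_cases) auto
          then show "?g s < ?g s'" using x inj by simp
        qed
        fix s assume "s \<in> roots t"
        then obtain x where "x \<in> roots t0" "s = h x" using img by blast
        then show "\<bar>?g s - s\<bar> \<le> signed_sum t0 - signed_sum t"
          using le[of x] inj 3 by (simp add: abs_minus_commute)
      qed
      then show ?thesis using 3 by simp
    qed
  qed
  with \<open>\<delta> > 0\<close> show ?thesis by blast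
qed

lemma linked_all:
  assumes t: "a < t" "t \<le> t'" "t' < b"
  shows "linked t t'"
  using t(2)
proof (induction rule: Bolzano)
  case (trans t t' t'')
  then show ?case using linked_trans by blast
next
  case (local x)
  then have x: "a < x" "x < b" using t by auto
  from linked_local[OF x] obtain \<delta> where \<delta>: "\<delta> > 0"
    "\<And>t. a < t \<Longrightarrow> t < b \<Longrightarrow> \<bar>t - x\<bar> < \<delta> \<Longrightarrow> (x \<le> t \<longrightarrow> linked x t) \<and> (t \<le> x \<longrightarrow> linked t x)" by blast
  \<comment> \<open>The two extra bounds keep \<open>u\<close> and \<open>v\<close> inside the
    interval from \<open>a\<close> to \<open>b\<close>.\<close>
  show ?case
  proof (intro exI[of _ "min \<delta> (min (x - a) (b - x))"] conjI allI impI)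
    fix u v assume uv: "u \<le> x \<and> x \<le> v \<and> v - u < min \<delta> (min (x - a) (b - x))"
    then have "linked u x" using \<delta>(2)[of u] by auto
    moreover have "linked x v" using uv \<delta>(2)[of v] by auto
    ultimately show "linked u v" by (rule linked_trans)
  qed (use \<delta> x in auto)
qed

text \<open>The colour of a root is its rank among the roots. Order isomorphisms preserve rank, so
  equal colours mean the same branch.\<close>

theorem bv_colorable_zeros: "bv_colorable a b {(t, s). \<bar>s\<bar> < R \<and> P t s = 0}"
proof (cases "a < b")
  case False
  then show ?thesis by (intro bv_colorable_horizontal[of "{}"]) auto
next
  case True
  define m where "m = (a + b) / 2"
  have m: "a < m" "m < b" using True by (auto simp: m_def)
  define k where "k = card (roots m)"
  have card: "card (roots t) = k" if "a < t" "t < b" for t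
  proof -
    have "linked t m \<or> linked m t" using linked_all[of t m] linked_all[of m t] that m by linarith
    then show ?thesis unfolding linked_def k_def by (metis bij_betw_same_card)
  qed
  let ?col = "\<lambda>t s. card {x \<in> roots t. x < s}"
  show ?thesis unfolding bv_colorable_def bv_coloring_def
  proof (intro exI[of _ "Suc k"] exI[of _ ?col] exI[of _ signed_sum] exI[of _ "k * R"] conjI allI impI)
    fix t s assume t: "a < t" "t < b"
    have "?col t s \<le> card (roots t)" using finite_roots[OF t] by (intro card_mono) auto
    then show "?col t s < Suc k" using card[OF t] by simp
  next
    fix t t' assume "a < t" "t \<le> t'" "t' < b"
    then show "signed_sum t \<le> signed_sum t'" using linked_all unfolding linked_def by blast
  next
    fix t assume t: "a < t" "t < b"
    have "\<bar>signed_sum t\<bar> \<le> (\<Sum>s\<in>roots t. \<bar>dir t s * s\<bar>)" unfolding signed_sum_def by (rule sum_abs)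
    also have "\<dots> \<le> (\<Sum>s\<in>roots t. R)"
      by (intro sum_mono) (use abs_dir[OF t] in \<open>auto simp: abs_mult roots_def\<close>)
    finally show "\<bar>signed_sum t\<bar> \<le> k * R" using card[OF t] by simp
  next
    fix t t' s s' assume t: "a < t" "t \<le> t'" "t' < b"
      and "(t, s) \<in> {(t, s). \<bar>s\<bar> < R \<and> P t s = 0}" "(t', s') \<in> {(t, s). \<bar>s\<bar> < R \<and> P t s = 0}"
      and col: "?col t s = ?col t' s'"
    then have s: "s \<in> roots t" "s' \<in> roots t'" by (auto simp: roots_def)
    have fin: "finite (roots t')" using finite_roots t by auto
    from linked_all[OF t] obtain h where h: "bij_betw h (roots t) (roots t')"
      "strict_mono_on (roots t) h" "\<forall>s\<in>roots t. \<bar>h s - s\<bar> \<le> signed_sum t' - signed_sum t"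
      unfolding linked_def by blast
    have img: "h ` roots t = roots t'" using h(1) by (auto simp: bij_betw_def)
    have less_iff: "h x < h y \<longleftrightarrow> x < y" if "x \<in> roots t" "y \<in> roots t" for x y
      using that h(2) strict_mono_onD[OF h(2), of x y] strict_mono_onD[OF h(2), of y x]
      by (cases x y rule: linorder_cases) auto
    have img_less: "h ` {x \<in> roots t. x < s} = {x \<in> roots t'. x < h s}"
      unfolding img[symmetric] using less_iff s(1) by auto
    have "inj_on h {x \<in> roots t. x < s}"
      using h(1) by (auto simp: bij_betw_def inj_on_def)
    from card_image[OF this] have "?col t s = ?col t' (h s)" unfolding img_less by (rule sym)
    with col have eq: "?col t' s' = ?col t' (h s)" by simp
    have hs: "h s \<in> roots t'" using s img by blast
    have lt: "?col t' x < ?col t' y" if "x \<in> roots t'" "x < y" for x y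
    proof (rule psubset_card_mono)
      have "x \<in> {z \<in> roots t'. z < y}" "x \<notin> {z \<in> roots t'. z < x}" using that by auto
      then show "{z \<in> roots t'. z < x} \<subset> {z \<in> roots t'. z < y}" using that(2) by fastforce
    qed (use fin in auto)
    have "\<not> h s < s'" using lt[OF hs] eq by fastforce
    moreover have "\<not> s' < h s" using lt[OF s(2)] eq by fastforce
    ultimately have "h s = s'" by simp
    then show "\<bar>s' - s\<bar> \<le> signed_sum t' - signed_sum t" using h(3) s by blast
  qed
qed

end

section \<open>Polynomials in two variables\<close>

text \<open>The outer variable is \<open>s\<close> and the coefficients are polynomials in
  \<open>t\<close>; thus \<open>degree\<close> and \<open>lead_coeff\<close> refer to
  \<open>s\<close>, \<open>pderiv\<close> differentiates in \<open>s\<close> and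
  \<open>map_poly pderiv\<close> in \<open>t\<close>.\<close>

definition ev :: "real poly poly \<Rightarrow> real \<Rightarrow> real \<Rightarrow> real" where
  "ev q t s = poly (poly q [:s:]) t"

lemma ev_0 [simp]: "ev 0 t s = 0"
  and ev_add [simp]: "ev (p + q) t s = ev p t s + ev q t s"
  and ev_mult [simp]: "ev (p * q) t s = ev p t s * ev q t s"
  and ev_smult [simp]: "ev (smult c q) t s = poly c t * ev q t s"
  and ev_pCons [simp]: "ev (pCons c q) t s = poly c t + s * ev q t s"
  by (simp_all add: ev_def)

lemma ev_eq_poly_map: "ev q t s = poly (map_poly (\<lambda>c. poly c t) q) s"
  by (induction q) (auto simp: map_poly_pCons)

lemma continuous_on_ev: "continuous_on UNIV (\<lambda>(t, s). ev q t s)"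
proof (induction q)
  case (pCons c q)
  have "continuous_on UNIV (\<lambda>x. poly c (fst x) + snd x * (case x of (t, s) \<Rightarrow> ev q t s))"
    by (intro continuous_intros pCons)
  then show ?case by (simp add: case_prod_beta')
qed (simp add: case_prod_beta')

lemma DERIV_ev_snd: "(ev q t has_real_derivative ev (pderiv q) t s) (at s)"
proof -
  have "ev (pderiv q) t s = poly (pderiv (map_poly (\<lambda>c. poly c t) q)) s"
  proof (induction q)
    case (pCons c q)
    then show ?case by (simp add: pderiv_pCons map_poly_pCons ev_eq_poly_map[symmetric])
  qed simp
  then show ?thesis using poly_DERIV[of "map_poly (\<lambda>c. poly c t) q" s]
    by (simp add: ev_eq_poly_map[abs_def])
qed

lemma DERIV_ev_fst: "((\<lambda>t. ev q t s) has_real_derivative ev (map_poly pderiv q) t s) (at t)"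
proof (induction q)
  case (pCons c q)
  have "((\<lambda>t. poly c t + s * ev q t s) has_real_derivative poly (pderiv c) t + s * ev (map_poly pderiv q) t s) (at t)"
    by (intro DERIV_add poly_DERIV DERIV_cmult pCons)
  then show ?case using pCons by (simp add: map_poly_pCons)
qed simp

text \<open>The point \<open>a\<close> may itself be a root; the finitely many other roots stay away
  from it.\<close>

lemma poly_nonzero_right:
  assumes "p \<noteq> (0 :: real poly)"
  shows "\<exists>b>a. \<forall>t. a < t \<longrightarrow> t < b \<longrightarrow> poly p t \<noteq> 0"
proof -
  have "finite {t. poly p t = 0}" using assms by (rule poly_roots_finite)
  then obtain d where d: "d > 0" "\<forall>x\<in>{t. poly p t = 0}. x \<noteq> a \<longrightarrow> d \<le> dist a x"
    using finite_set_avoid by blast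
  show ?thesis
  proof (intro exI[of _ "a + d"] conjI allI impI)
    fix t assume t: "a < t" "t < a + d"
    then show "poly p t \<noteq> 0" using d(2) by (auto simp: dist_real_def abs_if)
  qed (use d in auto)
qed

lemma finite_zeros_ev:
  assumes "poly (lead_coeff q) t \<noteq> 0"
  shows "finite {s. ev q t s = 0}"
proof -
  have "coeff (map_poly (\<lambda>c. poly c t) q) (degree q) \<noteq> 0"
    using assms by (simp add: coeff_map_poly)
  then have "map_poly (\<lambda>c. poly c t) q \<noteq> 0" by auto
  then show ?thesis by (simp add: ev_eq_poly_map poly_roots_finite)
qed

section \<open>Common factors with the partial derivatives\<close>

lemma minimal_combination:
  fixes q w :: "'a::idom poly"
  assumes "q \<noteq> 0"
  shows "\<exists>g. g \<noteq> 0 \<and> (\<exists>x y. g = x * q + y * w) \<and>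
    (\<forall>x y. x * q + y * w \<noteq> 0 \<longrightarrow> degree g \<le> degree (x * q + y * w))"
proof -
  let ?I = "{g. g \<noteq> 0 \<and> (\<exists>x y. g = x * q + y * w)}"
  have "q = 1 * q + 0 * w" by simp
  then have "q \<in> ?I" using assms by blast
  then obtain g where g: "g \<in> ?I" "\<And>f. f \<in> ?I \<Longrightarrow> degree g \<le> degree f"
    using ex_has_least_nat[of "\<lambda>g. g \<in> ?I" q degree] by blast
  then show ?thesis by blast
qed

text \<open>Pseudo-division leaves a remainder that lies in the ideal and has smaller degree than
  \<open>g\<close>, hence is zero.\<close>

lemma minimal_combination_divides:
  fixes q w :: "'a::idom poly"
  assumes g: "g \<noteq> 0" "g = x * q + y * w"
    and min: "\<And>x y. x * q + y * w \<noteq> 0 \<Longrightarrow> degree g \<le> degree (x * q + y * w)"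
    and f: "f = x' * q + y' * w"
  shows "\<exists>k A. smult (lead_coeff g ^ k) f = g * A"
proof -
  obtain A r where Ar: "pseudo_divmod f g = (A, r)" by fastforce
  define k where "k = Suc (degree f) - degree g"
  from pseudo_divmod[OF g(1) Ar] have
    eq: "smult (lead_coeff g ^ k) f = g * A + r" and r: "r = 0 \<or> degree r < degree g"
    by (auto simp: k_def)
  have "r = (smult (lead_coeff g ^ k) x' - x * A) * q + (smult (lead_coeff g ^ k) y' - y * A) * w"
  proof -
    have "r = smult (lead_coeff g ^ k) f - g * A" using eq by simp
    also have "\<dots> = (smult (lead_coeff g ^ k) x' - x * A) * q + (smult (lead_coeff g ^ k) y' - y * A) * w"
      unfolding f by (subst (2) g(2)) (simp add: algebra_simps smult_add_right)
    finally show ?thesis .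
  qed
  with min r have "r = 0" by fastforce
  with eq show ?thesis by auto
qed

text \<open>At a zero of \<open>q\<close> the product \<open>g * A\<close> vanishes too, so the
  zeros of \<open>q\<close> are covered by those of two polynomials of smaller degree.\<close>

lemma ev_common_zero_split:
  assumes "q \<noteq> 0" "g \<noteq> 0" "smult (lead_coeff g ^ k) q = g * A" "0 < degree g" "degree g < degree q"
    and IH: "\<And>p. degree p < degree q \<Longrightarrow> p \<noteq> 0 \<Longrightarrow> \<exists>b>a. bv_colorable a b {(t, s). \<bar>s\<bar> < R \<and> ev p t s = 0}"
  shows "\<exists>b>a. bv_colorable a b {(t, s). \<bar>s\<bar> < R \<and> ev q t s = 0}"
proof -
  have "A \<noteq> 0" using assms by auto
  then have "degree g + degree A = degree q"
    using degree_mult_eq[of g A] degree_smult_eq[of "lead_coeff g ^ k" q] assms(2,3) by simp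
  then have "degree A < degree q" using assms by simp
  with IH \<open>A \<noteq> 0\<close> obtain b where b: "b > a" "bv_colorable a b {(t, s). \<bar>s\<bar> < R \<and> ev A t s = 0}" by blast
  obtain b' where b': "b' > a" "bv_colorable a b' {(t, s). \<bar>s\<bar> < R \<and> ev g t s = 0}" using IH assms by blast
  let ?b = "min b b'"
  have "bv_colorable a ?b ({(t, s). \<bar>s\<bar> < R \<and> ev A t s = 0} \<union> {(t, s). \<bar>s\<bar> < R \<and> ev g t s = 0})"
    by (intro bv_colorable_Un bv_colorable_subset[OF b(2)] bv_colorable_subset[OF b'(2)]) auto
  moreover have "ev A t s = 0 \<or> ev g t s = 0" if "ev q t s = 0" for t s
    using arg_cong[OF assms(3), of "\<lambda>p. ev p t s"] that by auto
  ultimately have "bv_colorable a ?b {(t, s). \<bar>s\<bar> < R \<and> ev q t s = 0}"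
    by (elim bv_colorable_subset) auto
  then show ?thesis using b b' by (intro exI[of _ ?b]) auto
qed

text \<open>Here the derivative of \<open>q\<close> in \<open>t\<close> is \<open>q\<close> times a
  rational function of \<open>t\<close>. Then \<open>q\<close> is a function of \<open>t\<close>
  times a fixed polynomial in \<open>s\<close>, and its zeros do not move.\<close>

lemma bv_colorable_proportional:
  fixes q :: "real poly poly"
  assumes q: "q \<noteq> 0" and dep: "smult (lead_coeff q ^ k) (map_poly pderiv q) = q * [:e:]"
  shows "\<exists>b>a. bv_colorable a b {(t, s). \<bar>s\<bar> < R \<and> ev q t s = 0}"
proof -
  let ?c = "lead_coeff q"
  obtain b where b: "b > a" "\<And>t. a < t \<Longrightarrow> t < b \<Longrightarrow> poly ?c t \<noteq> 0"
    using poly_nonzero_right[of ?c a] q by auto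
  have c: "?c ^ k * pderiv (coeff q i) = coeff q i * e" for i
    using arg_cong[OF dep, of "\<lambda>p. coeff p i"] by (simp add: coeff_map_poly mult.commute)
  \<comment> \<open>The Wronskian of each coefficient with the leading one vanishes, so their
    quotient has derivative 0.\<close>
  have wr: "pderiv (coeff q i) * ?c = coeff q i * pderiv ?c" for i
  proof -
    have "?c ^ k * (pderiv (coeff q i) * ?c) = ?c ^ k * (coeff q i * pderiv ?c)"
    proof -
      have "?c ^ k * (pderiv (coeff q i) * ?c) = (?c ^ k * pderiv (coeff q i)) * ?c" by (simp only: mult.assoc)
      also have "\<dots> = coeff q i * e * ?c" by (simp only: c)
      also have "\<dots> = coeff q i * (?c * e)" by (simp only: mult_ac)
      also have "?c * e = ?c ^ k * pderiv ?c" by (rule c[symmetric])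
      also have "coeff q i * (?c ^ k * pderiv ?c) = ?c ^ k * (coeff q i * pderiv ?c)" by (simp only: mult_ac)
      finally show ?thesis .
    qed
    then show ?thesis using q by simp
  qed
  define m where "m = (a + b) / 2"
  have m: "a < m" "m < b" using b by (auto simp: m_def)
  have ratio: "poly (coeff q i) t / poly ?c t = poly (coeff q i) m / poly ?c m" if t: "a < t" "t < b" for i t
  proof -
    have "\<exists>k. \<forall>t\<in>{a<..<b}. poly (coeff q i) t / poly ?c t = k"
    proof (rule has_field_derivative_zero_constant)
      fix x assume x: "x \<in> {a<..<b}"
      have "((\<lambda>t. poly (coeff q i) t / poly ?c t) has_real_derivative
        (poly (pderiv (coeff q i)) x * poly ?c x - poly (coeff q i) x * poly (pderiv ?c) x) / (poly ?c x * poly ?c x)) (at x)"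
        using b(2) x by (intro DERIV_divide poly_DERIV) auto
      moreover have "poly (pderiv (coeff q i)) x * poly ?c x - poly (coeff q i) x * poly (pderiv ?c) x = 0"
        using arg_cong[OF wr[of i], of "\<lambda>p. poly p x"] by simp
      ultimately show "((\<lambda>t. poly (coeff q i) t / poly ?c t) has_field_derivative 0) (at x within {a<..<b})"
        by (auto intro: has_field_derivative_at_within)
    qed auto
    then show ?thesis using t m by auto
  qed
  have zeros: "ev q m s = 0" if t: "a < t" "t < b" and "ev q t s = 0" for t s
  proof -
    have "map_poly (\<lambda>c. poly c m) q = smult (poly ?c m / poly ?c t) (map_poly (\<lambda>c. poly c t) q)"
      using ratio[OF t] b(2)[OF t] b(2)[OF m]
      by (intro poly_eqI) (simp add: coeff_map_poly field_simps)
    then show ?thesis using that by (simp add: ev_eq_poly_map)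
  qed
  have "finite {s. ev q m s = 0}" using b(2)[OF m] by (rule finite_zeros_ev)
  then have "bv_colorable a b {(t, s). \<bar>s\<bar> < R \<and> ev q t s = 0}"
    by (rule bv_colorable_horizontal) (use zeros in auto)
  then show ?thesis using b by blast
qed

text \<open>Induction on the degree in \<open>s\<close>. A proper common factor with a partial
  derivative splits \<open>q\<close>; a common factor of full degree with the derivative in
  \<open>t\<close> makes the zeros stationary. Otherwise both ideals contain a nonzero polynomial in
  \<open>t\<close> alone, and where these do not vanish every zero is regular.\<close>

theorem bv_colorable_algebraic:
  assumes "q \<noteq> 0"
  shows "\<exists>b>a. bv_colorable a b {(t, s). \<bar>s\<bar> < R \<and> ev q t s = 0}"
  using assms
proof (induction "degree q" arbitrary: q R rule: less_induct)
  case less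
  note q = \<open>q \<noteq> 0\<close>
  have IH: "\<exists>b>a. bv_colorable a b {(t, s). \<bar>s\<bar> < R' \<and> ev p t s = 0}" if "degree p < degree q" "p \<noteq> 0" for p R'
    using less that by blast
  obtain b0 where b0: "b0 > a" "\<And>t. a < t \<Longrightarrow> t < b0 \<Longrightarrow> poly (lead_coeff q) t \<noteq> 0"
    using poly_nonzero_right[of "lead_coeff q" a] q by auto
  show ?case
  proof (cases "degree q = 0")
    case True
    then obtain c where c: "q = [:c:]" by (rule degree_eq_zeroE)
    then have "bv_colorable a b0 {(t, s). \<bar>s\<bar> < R \<and> ev q t s = 0}"
      using b0(2) by (intro bv_colorable_horizontal[of "{}"]) auto
    then show ?thesis using b0 by blast
  next
    case False
    let ?qs = "pderiv q" and ?qt = "map_poly pderiv q"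
    have qs: "?qs \<noteq> 0" "degree ?qs < degree q"
      using False pderiv_eq_0_iff[of q] degree_pderiv[of q] by auto
    obtain g x y where g: "g \<noteq> 0" "g = x * q + y * ?qs"
      "\<And>x y. x * q + y * ?qs \<noteq> 0 \<Longrightarrow> degree g \<le> degree (x * q + y * ?qs)"
      using minimal_combination[OF q, of ?qs] by blast
    \<comment> \<open>The derivative in \<open>s\<close> has smaller degree than \<open>q\<close>,
      so \<open>g\<close>, unlike \<open>f\<close>, cannot have full degree.\<close>
    have "degree g \<le> degree ?qs" using g(3)[of 0 1] qs by simp
    then have deg_g: "degree g < degree q" using qs by simp
    obtain k A where kA: "smult (lead_coeff g ^ k) q = g * A"
      using minimal_combination_divides[OF g, of q 1 0] by auto
    obtain f u v where f: "f \<noteq> 0" "f = u * q + v * ?qt"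
      "\<And>x y. x * q + y * ?qt \<noteq> 0 \<Longrightarrow> degree f \<le> degree (x * q + y * ?qt)"
      using minimal_combination[OF q, of ?qt] by blast
    have deg_f: "degree f \<le> degree q" using f(3)[of 1 0] q by simp
    obtain l B where lB: "smult (lead_coeff f ^ l) q = f * B"
      using minimal_combination_divides[OF f, of q 1 0] by auto
    consider "degree g > 0" | "0 < degree f" "degree f < degree q" | "degree f = degree q"
      | "degree g = 0" "degree f = 0" using deg_f by linarith
    then show ?thesis
    proof cases
      case 1
      then show ?thesis using ev_common_zero_split[OF q g(1) kA _ deg_g] IH by blast
    next
      case 2
      then show ?thesis using ev_common_zero_split[OF q f(1) lB] IH by blast
    next
      case 3
      \<comment> \<open>Since \<open>f\<close> has the degree of \<open>q\<close>, \<open>q\<close>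
        itself has least degree in the ideal and can replace \<open>f\<close> as divisor.\<close>
      have "\<exists>k C. smult (lead_coeff q ^ k) ?qt = q * C"
        by (rule minimal_combination_divides[of q 1 q 0 ?qt ?qt 0 1]) (use q f(3) 3 in auto)
      then obtain n C where C: "smult (lead_coeff q ^ n) ?qt = q * C" by blast
      \<comment> \<open>Differentiating the coefficients in \<open>t\<close> does not raise the
        degree in \<open>s\<close>.\<close>
      have "degree C = 0"
      proof (cases "C = 0")
        case False
        then have "degree q + degree C = degree (smult (lead_coeff q ^ n) ?qt)"
          using C q by (simp add: degree_mult_eq)
        also have "\<dots> \<le> degree q"
          by (intro degree_le) (simp add: coeff_map_poly coeff_eq_0)
        finally show ?thesis by simp
      qed simp
      then obtain e where "C = [:e:]" by (rule degree_eq_zeroE)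
      then show ?thesis using bv_colorable_proportional[OF q] C by blast
    next
      case 4
      obtain g0 where g0: "g = [:g0:]" using 4 by (auto elim: degree_eq_zeroE)
      obtain f0 where f0: "f = [:f0:]" using 4 by (auto elim: degree_eq_zeroE)
      have fin: "finite ((\<lambda>s. [:s:]) -` {p. poly q p = 0} \<union> (\<lambda>s. [:-s:]) -` {p. poly q p = 0})"
        using poly_roots_finite[OF q] by (intro finite_UnI finite_vimageI) (auto intro: injI)
      \<comment> \<open>If \<open>poly q [:s:]\<close> is the zero polynomial, then \<open>s\<close>
        is a zero at every \<open>t\<close>. There are finitely many such heights, and both
        \<open>R'\<close> and \<open>- R'\<close> avoid them.\<close>
      obtain R' where R': "R' > R" "R' > 0" "poly q [:R':] \<noteq> 0" "poly q [:-R':] \<noteq> 0"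
      proof -
        have "infinite {max R 0<..}" by (rule infinite_Ioi)
        then have "\<not> {max R 0<..} \<subseteq> (\<lambda>s. [:s:]) -` {p. poly q p = 0} \<union> (\<lambda>s. [:-s:]) -` {p. poly q p = 0}"
          using fin finite_subset by blast
        then obtain x where "x \<in> {max R 0<..}"
          "x \<notin> (\<lambda>s. [:s:]) -` {p. poly q p = 0} \<union> (\<lambda>s. [:-s:]) -` {p. poly q p = 0}" by blast
        then show ?thesis using that[of x] by simp
      qed
      \<comment> \<open>Nonvanishing of the factors yields, in order, finitely many zeros,
        regularity in \<open>s\<close> and in \<open>t\<close>, and no zeros at the two boundary
        heights.\<close>
      define p where "p = lead_coeff q * g0 * f0 * poly q [:R':] * poly q [:-R':]"
      have "p \<noteq> 0" using q g f R' g0 f0 by (auto simp: p_def)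
      then obtain b where b: "b > a" "\<And>t. a < t \<Longrightarrow> t < b \<Longrightarrow> poly p t \<noteq> 0"
        using poly_nonzero_right by blast
      interpret regular_zeros "ev q" "ev ?qs" "ev ?qt" a b R'
      proof
        fix t assume "a < t" "t < b"
        then have p: "poly p t \<noteq> 0" using b by blast
        show "finite {s. ev q t s = 0}" using p by (intro finite_zeros_ev) (simp add: p_def)
        show "ev q t s \<noteq> 0" if "\<bar>s\<bar> = R'" for s
          using p that by (auto simp: p_def ev_def abs_if split: if_splits)
        show "ev ?qs t s \<noteq> 0 \<and> ev ?qt t s \<noteq> 0" if "ev q t s = 0" for s
          using p that arg_cong[OF g(2), of "\<lambda>p. ev p t s"] arg_cong[OF f(2), of "\<lambda>p. ev p t s"]
          by (auto simp: p_def g0 f0)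
      qed (rule continuous_on_ev DERIV_ev_fst DERIV_ev_snd)+
      have "bv_colorable a b {(t, s). \<bar>s\<bar> < R \<and> ev q t s = 0}"
        by (rule bv_colorable_subset[OF bv_colorable_zeros]) (use R' in auto)
      then show ?thesis using b by blast
    qed
  qed
qed

section \<open>Points of least gradient on a level set\<close>

lemma polyfun_compose:
  assumes "polyfun I p" "\<And>i. i \<in> I \<Longrightarrow> polyfun V (h i)"
  shows "polyfun V (\<lambda>y. p (\<lambda>i. h i y))"
  using assms(1) by induction (auto intro: polyfun.intros assms(2))

lemma polyfun_tendsto:
  assumes "polyfun I p" "\<And>i. i \<in> I \<Longrightarrow> ((\<lambda>k. x k i) \<longlongrightarrow> l i) F"
  shows "((\<lambda>k. p (x k)) \<longlongrightarrow> p l) F"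
  using assms(1) by induction (auto intro!: tendsto_intros assms(2))

section \<open>Gradients and minima of coercive polynomials\<close>

text \<open>Differentiation along every line and at every parameter supplies partial derivatives,
  the mean value theorem and continuity on segments at once.\<close>

definition has_gradient :: "'v set \<Rightarrow> (('v \<Rightarrow> real) \<Rightarrow> real) \<Rightarrow> ('v \<Rightarrow> ('v \<Rightarrow> real) \<Rightarrow> real) \<Rightarrow> bool" where
  "has_gradient I p D \<longleftrightarrow> (\<forall>x v s. ((\<lambda>s. p (\<lambda>i. x i + s * v i)) has_real_derivative
     (\<Sum>i\<in>I. D i (\<lambda>i. x i + s * v i) * v i)) (at s))"

lemma polyfun_gradient_exists:
  assumes "finite I" "polyfun I p"
  shows "\<exists>D. (\<forall>i. polyfun I (D i)) \<and> has_gradient I p D"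
  using assms(2)
proof induction
  case (const c)
  then show ?case unfolding has_gradient_def
    by (intro exI[of _ "\<lambda>i x. 0"]) (auto intro: polyfun.const)
next
  case (var w)
  show ?case unfolding has_gradient_def
  proof (intro exI[of _ "\<lambda>i x. if i = w then 1 else 0"] conjI allI)
    fix i show "polyfun I (\<lambda>x. if i = w then 1 else 0)" by (cases "i = w") (auto intro: polyfun.const)
    fix x v :: "'a \<Rightarrow> real" and s
    have "(\<Sum>i\<in>I. (if i = w then 1 else 0) * v i) = v w"
      using assms(1) var by (simp add: if_distrib[of "\<lambda>c. c * _"] cong: if_cong)
    then show "((\<lambda>s. x w + s * v w) has_real_derivative (\<Sum>i\<in>I. (if i = w then 1 else 0) * v i)) (at s)"
      by (auto intro!: derivative_eq_intros)
  qed
next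
  case (add p q)
  then obtain D E where D: "\<forall>i. polyfun I (D i)" "has_gradient I p D" and
    E: "\<forall>i. polyfun I (E i)" "has_gradient I q E" by blast
  show ?case
  proof (intro exI[of _ "\<lambda>i x. D i x + E i x"] conjI allI)
    show "has_gradient I (\<lambda>x. p x + q x) (\<lambda>i x. D i x + E i x)"
      using D(2) E(2) unfolding has_gradient_def
      by (auto simp: distrib_right sum.distrib intro: DERIV_add)
  qed (use D E in \<open>auto intro: polyfun.add\<close>)
next
  case (mult p q)
  then obtain D E where D: "\<forall>i. polyfun I (D i)" "has_gradient I p D" and
    E: "\<forall>i. polyfun I (E i)" "has_gradient I q E" by blast
  show ?case
  proof (intro exI[of _ "\<lambda>i x. D i x * q x + E i x * p x"] conjI allI)
    show "has_gradient I (\<lambda>x. p x * q x) (\<lambda>i x. D i x * q x + E i x * p x)"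
      unfolding has_gradient_def
    proof (intro allI)
      fix x v :: "'a \<Rightarrow> real" and s
      let ?x = "\<lambda>i. x i + s * v i"
      have "((\<lambda>s. p (\<lambda>i. x i + s * v i) * q (\<lambda>i. x i + s * v i)) has_real_derivative
        (\<Sum>i\<in>I. D i ?x * v i) * q ?x + (\<Sum>i\<in>I. E i ?x * v i) * p ?x) (at s)"
        using D(2) E(2) unfolding has_gradient_def by (intro DERIV_mult) auto
      moreover have "(\<Sum>i\<in>I. D i ?x * v i) * q ?x + (\<Sum>i\<in>I. E i ?x * v i) * p ?x
        = (\<Sum>i\<in>I. (D i ?x * q ?x + E i ?x * p ?x) * v i)"
        by (simp add: sum_distrib_left sum.distrib algebra_simps)
      ultimately show "((\<lambda>s. p (\<lambda>i. x i + s * v i) * q (\<lambda>i. x i + s * v i)) has_real_derivative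
        (\<Sum>i\<in>I. (D i ?x * q ?x + E i ?x * p ?x) * v i)) (at s)" by simp
    qed
    fix i
    have "polyfun I (D i)" "polyfun I (E i)" using D(1) E(1) by blast+
    then show "polyfun I (\<lambda>x. D i x * q x + E i x * p x)"
      using mult.hyps by (intro polyfun.add polyfun.mult)
  qed
qed

lemma has_gradient_partial:
  assumes "finite I" "has_gradient I p D" "j \<in> I"
  shows "((\<lambda>s. p (\<lambda>i. x i + s * (if i = j then 1 else 0))) has_real_derivative D j x) (at 0)"
proof -
  have "(\<Sum>i\<in>I. D i x * (if i = j then 1 else 0)) = D j x"
    using assms by (simp add: if_distrib[of "\<lambda>c. _ * c"] cong: if_cong)
  then show ?thesis using assms(2)[unfolded has_gradient_def, rule_format, of x "\<lambda>i. if i = j then 1 else 0" 0]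
    by simp
qed

text \<open>Bolzano-Weierstrass, one coordinate after the other; the index type may be infinite and
  only the coordinates in \<open>I\<close> are controlled.\<close>

lemma bounded_coordinates_convergent_subseq:
  fixes x :: "nat \<Rightarrow> 'v \<Rightarrow> real"
  assumes "finite I" "\<And>k i. i \<in> I \<Longrightarrow> \<bar>x k i\<bar> \<le> B"
  shows "\<exists>r l. strict_mono (r :: nat \<Rightarrow> nat) \<and> (\<forall>i\<in>I. (\<lambda>k. x (r k) i) \<longlonglongrightarrow> l i)"
  using assms
proof (induction I)
  case empty
  then show ?case by (auto intro: exI[of _ id] strict_mono_id)
next
  case (insert j I)
  then obtain r l where r: "strict_mono r" "\<forall>i\<in>I. (\<lambda>k. x (r k) i) \<longlonglongrightarrow> l i" by auto
  have "\<forall>k. x (r k) j \<in> {-B..B}" using insert.prems[of j] by (simp add: abs_le_iff minus_le_iff)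
  then obtain m r' where r': "strict_mono r'" "((\<lambda>k. x (r k) j) \<circ> r') \<longlonglongrightarrow> m"
    using compact_Icc[of "-B" B, unfolded compact_def, rule_format, of "\<lambda>k. x (r k) j"] by blast
  show ?case
  proof (intro exI[of _ "r \<circ> r'"] exI[of _ "l(j := m)"] conjI ballI)
    fix i assume i: "i \<in> insert j I"
    show "(\<lambda>k. x ((r \<circ> r') k) i) \<longlonglongrightarrow> (l(j := m)) i"
    proof (cases "i = j")
      case True
      then show ?thesis using r'(2) by (simp add: o_def)
    next
      case False
      then have "(\<lambda>k. x (r k) i) \<longlonglongrightarrow> l i" using i r(2) by auto
      from LIMSEQ_subseq_LIMSEQ[OF this r'(1)] show ?thesis using False by (simp add: o_def)
    qed
  next
    show "strict_mono (r \<circ> r')" using r(1) r'(1) by (rule strict_mono_o)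
  qed
qed

text \<open>Uses |r| \<le> 1 + r * r in place of a square root.\<close>

lemma coercive_bound:
  fixes x :: "'v \<Rightarrow> real"
  assumes "finite I" "c > 0" "c * (\<Sum>i\<in>I. (x i)\<^sup>2) \<le> M" "i \<in> I"
  shows "\<bar>x i\<bar> \<le> 1 + M / c"
proof -
  have "(x i)\<^sup>2 \<le> (\<Sum>i\<in>I. (x i)\<^sup>2)" using assms by (intro member_le_sum) auto
  also have "\<dots> \<le> M / c" using assms by (simp add: field_simps)
  finally have "\<bar>x i\<bar>\<^sup>2 \<le> M / c" by simp
  moreover have "\<bar>x i\<bar> \<le> 1 + \<bar>x i\<bar>\<^sup>2"
    using sum_squares_bound[of "\<bar>x i\<bar>" 1] by (simp add: power2_eq_square)
  ultimately show ?thesis by simp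
qed

lemma coercive_polyfun_attains_min:
  assumes I: "finite I" and p: "polyfun I p" and "c > 0"
    and coercive: "\<And>x. c * (\<Sum>i\<in>I. (x i)\<^sup>2) - C \<le> p x"
  shows "\<exists>x. \<forall>y. p x \<le> p y"
proof -
  have "- C \<le> p x" for x
  proof -
    have "0 \<le> c * (\<Sum>i\<in>I. (x i)\<^sup>2)" using \<open>c > 0\<close> by (intro mult_nonneg_nonneg sum_nonneg) auto
    then show ?thesis using coercive[of x] by simp
  qed
  then have bdd: "bdd_below (range p)" by (auto intro: bdd_belowI[of _ "- C"])
  define m where "m = Inf (range p)"
  have m: "m \<le> p x" for x unfolding m_def using bdd by (intro cInf_lower) auto
  have "\<exists>x. p x < m + 1 / Suc k" for k :: nat
    using cInf_lessD[of "range p" "m + 1 / Suc k"] unfolding m_def by auto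
  then obtain x where x: "\<And>k. p (x k) < m + 1 / Suc k" by metis
  have bound: "\<bar>x k i\<bar> \<le> 1 + (m + 1 + C) / c" if "i \<in> I" for k i
  proof (rule coercive_bound[OF I \<open>c > 0\<close> _ that])
    have "1 / real (Suc k) \<le> 1" by simp
    then show "c * (\<Sum>i\<in>I. (x k i)\<^sup>2) \<le> m + 1 + C" using coercive[of "x k"] x[of k] by linarith
  qed
  from bounded_coordinates_convergent_subseq[OF I, of x, OF bound] obtain r l where
    r: "strict_mono r" "\<forall>i\<in>I. (\<lambda>k. x (r k) i) \<longlonglongrightarrow> l i" by blast
  have "(\<lambda>k. p (x (r k))) \<longlonglongrightarrow> p l" by (rule polyfun_tendsto[OF p]) (use r in auto)
  moreover have "(\<lambda>k. m + 1 / Suc (r k)) \<longlonglongrightarrow> m + 0"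
    using LIMSEQ_subseq_LIMSEQ[OF LIMSEQ_inverse_real_of_nat r(1)]
    by (intro tendsto_intros) (simp add: o_def inverse_eq_divide)
  ultimately have "p l \<le> m + 0"
    by (rule LIMSEQ_le) (use x less_imp_le in blast)
  then show ?thesis using m by (intro exI[of _ l]) (auto intro: order_trans)
qed

section \<open>The algebraic relation satisfied by perturbed critical points\<close>

text \<open>Uniqueness of digits in base \<open>E\<close>; it ensures that different exponent
  vectors in the tilt receive different powers of \<sigma>.\<close>

lemma radix_injective:
  assumes "\<And>j. j < d \<Longrightarrow> \<alpha> j < E" "\<And>j. j < d \<Longrightarrow> \<beta> j < (E::nat)"
    and "(\<Sum>j<d. E ^ j * \<alpha> j) = (\<Sum>j<d. E ^ j * \<beta> j)" "j < d"
  shows "\<alpha> j = \<beta> j"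
  using assms
proof (induction d arbitrary: \<alpha> \<beta> j)
  case (Suc d)
  have split: "(\<Sum>j<Suc d. E ^ j * \<gamma> j) = \<gamma> 0 + E * (\<Sum>j<d. E ^ j * \<gamma> (Suc j))" for \<gamma> :: "nat \<Rightarrow> nat"
    by (subst sum.lessThan_Suc_shift) (simp add: sum_distrib_left mult.assoc)
  have eq: "\<alpha> 0 + E * (\<Sum>j<d. E ^ j * \<alpha> (Suc j)) = \<beta> 0 + E * (\<Sum>j<d. E ^ j * \<beta> (Suc j))"
    using Suc.prems(3) unfolding split .
  have lt: "\<alpha> 0 < E" "\<beta> 0 < E" using Suc.prems(1,2) by auto
  have "\<alpha> 0 = (\<alpha> 0 + E * (\<Sum>j<d. E ^ j * \<alpha> (Suc j))) mod E" using lt by simp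
  also have "\<dots> = \<beta> 0" unfolding eq using lt by simp
  finally have 0: "\<alpha> 0 = \<beta> 0" .
  with eq lt have "(\<Sum>j<d. E ^ j * \<alpha> (Suc j)) = (\<Sum>j<d. E ^ j * \<beta> (Suc j))" by simp
  then have "\<alpha> (Suc j) = \<beta> (Suc j)" if "j < d" for j
    using Suc.IH[of "\<lambda>j. \<alpha> (Suc j)" "\<lambda>j. \<beta> (Suc j)" j] Suc.prems(1,2) that by simp
  then show ?case using 0 Suc.prems(4) by (cases j) auto
qed simp

lemma ev_monom: "ev (monom (monom c k) l) t s = c * t ^ k * s ^ l"
  by (simp add: ev_def poly_monom)

lemma ev_sum: "ev (\<Sum>a\<in>A. f a) t s = (\<Sum>a\<in>A. ev (f a) t s)"
  by (induction A rule: infinite_finite_induct) auto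

text \<open>Dividing by the least occurring power of \<sigma> and letting \<sigma> tend to 0 leaves
  the terms of minimal weight. By \<open>inj\<close> no two of them share a monomial, so they cannot
  cancel as a polynomial.\<close>

lemma lowest_order_relation:
  fixes c :: "'a \<Rightarrow> real" and w k l :: "'a \<Rightarrow> nat"
  assumes A: "finite A" "\<exists>\<alpha>\<in>A. c \<alpha> \<noteq> 0"
    and inj: "\<And>\<alpha> \<beta>. \<alpha> \<in> A \<Longrightarrow> \<beta> \<in> A \<Longrightarrow> w \<alpha> = w \<beta> \<Longrightarrow> k \<alpha> = k \<beta> \<Longrightarrow> l \<alpha> = l \<beta> \<Longrightarrow> \<alpha> = \<beta>"
  shows "\<exists>q. q \<noteq> 0 \<and> (\<forall>\<sigma> T X t x. (\<forall>n::nat. \<sigma> n \<noteq> 0 \<and> (\<Sum>\<alpha>\<in>A. c \<alpha> * \<sigma> n ^ w \<alpha> * T n ^ k \<alpha> * X n ^ l \<alpha>) = 0) \<longrightarrow>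
      \<sigma> \<longlonglongrightarrow> 0 \<longrightarrow> T \<longlonglongrightarrow> t \<longrightarrow> X \<longlonglongrightarrow> x \<longrightarrow> ev q t x = 0)"
proof -
  define A' where "A' = {\<alpha> \<in> A. c \<alpha> \<noteq> 0}"
  have A': "finite A'" "A' \<noteq> {}" using A by (auto simp: A'_def)
  define m where "m = Min (w ` A')"
  have m: "m \<le> w \<alpha>" if "\<alpha> \<in> A'" for \<alpha> using A' that by (auto simp: m_def)
  define M where "M = {\<alpha> \<in> A'. w \<alpha> = m}"
  have "m \<in> w ` A'" unfolding m_def using A' by (intro Min_in) auto
  then obtain \<alpha> where \<alpha>: "\<alpha> \<in> M" by (auto simp: M_def)
  have M: "finite M" using A' by (auto simp: M_def)
  define q where "q = (\<Sum>\<alpha>\<in>M. monom (monom (c \<alpha>) (k \<alpha>)) (l \<alpha>))"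
  have "coeff (coeff q (l \<alpha>)) (k \<alpha>) = (\<Sum>\<beta>\<in>M. if \<beta> = \<alpha> then c \<alpha> else 0)"
    unfolding q_def coeff_sum
  proof (intro sum.cong refl)
    fix \<beta> assume "\<beta> \<in> M"
    then show "coeff (coeff (monom (monom (c \<beta>) (k \<beta>)) (l \<beta>)) (l \<alpha>)) (k \<alpha>) = (if \<beta> = \<alpha> then c \<alpha> else 0)"
      using inj[of \<beta> \<alpha>] \<alpha> by (auto simp: M_def A'_def)
  qed
  also have "\<dots> = c \<alpha>" using M \<alpha> by simp
  finally have "q \<noteq> 0" using \<alpha> by (auto simp: M_def A'_def)
  moreover have "ev q t x = 0" if rel: "\<And>n::nat. \<sigma> n \<noteq> 0" "\<And>n. (\<Sum>\<alpha>\<in>A. c \<alpha> * \<sigma> n ^ w \<alpha> * T n ^ k \<alpha> * X n ^ l \<alpha>) = 0"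
    and lim: "\<sigma> \<longlonglongrightarrow> 0" "T \<longlonglongrightarrow> t" "X \<longlonglongrightarrow> x" for \<sigma> T X :: "nat \<Rightarrow> real" and t x
  proof -
    have "(\<Sum>\<alpha>\<in>A'. c \<alpha> * \<sigma> n ^ (w \<alpha> - m) * T n ^ k \<alpha> * X n ^ l \<alpha>) = 0" for n
    proof -
      have "\<sigma> n ^ m * (\<Sum>\<alpha>\<in>A'. c \<alpha> * \<sigma> n ^ (w \<alpha> - m) * T n ^ k \<alpha> * X n ^ l \<alpha>)
        = (\<Sum>\<alpha>\<in>A'. c \<alpha> * (\<sigma> n ^ m * \<sigma> n ^ (w \<alpha> - m)) * T n ^ k \<alpha> * X n ^ l \<alpha>)"
        by (simp add: sum_distrib_left mult_ac)
      also have "\<dots> = (\<Sum>\<alpha>\<in>A'. c \<alpha> * \<sigma> n ^ w \<alpha> * T n ^ k \<alpha> * X n ^ l \<alpha>)"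
        using m by (intro sum.cong) (auto simp: power_add[symmetric])
      also have "\<dots> = (\<Sum>\<alpha>\<in>A. c \<alpha> * \<sigma> n ^ w \<alpha> * T n ^ k \<alpha> * X n ^ l \<alpha>)"
        using A(1) by (intro sum.mono_neutral_left) (auto simp: A'_def)
      finally show ?thesis using rel(2)[of n] rel(1)[of n] by simp
    qed
    moreover have "(\<lambda>n. \<Sum>\<alpha>\<in>A'. c \<alpha> * \<sigma> n ^ (w \<alpha> - m) * T n ^ k \<alpha> * X n ^ l \<alpha>) \<longlonglongrightarrow>
      (\<Sum>\<alpha>\<in>A'. c \<alpha> * 0 ^ (w \<alpha> - m) * t ^ k \<alpha> * x ^ l \<alpha>)"
      by (intro tendsto_intros lim)
    ultimately have "(\<Sum>\<alpha>\<in>A'. c \<alpha> * 0 ^ (w \<alpha> - m) * t ^ k \<alpha> * x ^ l \<alpha>) = 0"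
      by (simp add: LIMSEQ_const_iff)
    \<comment> \<open>As \<open>0 ^ 0 = 1\<close>, the factor \<open>0 ^ (w \<alpha> - m)\<close>
      selects exactly the terms of weight \<open>m\<close>.\<close>
    also have "(\<Sum>\<alpha>\<in>A'. c \<alpha> * 0 ^ (w \<alpha> - m) * t ^ k \<alpha> * x ^ l \<alpha>) = (\<Sum>\<alpha>\<in>M. c \<alpha> * t ^ k \<alpha> * x ^ l \<alpha>)"
      using m A' by (intro sum.mono_neutral_cong_right) (auto simp: M_def power_0_left le_antisym)
    finally show ?thesis by (simp add: q_def ev_sum ev_monom)
  qed
  ultimately show ?thesis by (intro exI[of _ q]) blast
qed

lemma algebraic_talweg_relation:
  fixes I :: "'v set"
  assumes I: "finite I" and f: "polyfun I f" and Df: "\<And>i. polyfun I (Df i)" and Dg: "\<And>i. polyfun I (Dg i)"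
    and i: "i \<in> I"
  shows "\<exists>n c. (\<exists>\<alpha>\<in>(Inl ` I \<union> range Inr) \<rightarrow>\<^sub>E {..<n::nat}. c \<alpha> \<noteq> 0) \<and>
     (\<forall>\<mu> x. (\<Sum>\<alpha>\<in>(Inl ` I \<union> range Inr) \<rightarrow>\<^sub>E {..<n}. c \<alpha> *
        (\<Prod>j\<in>I. (\<mu> * Df j x - Dg j x) ^ \<alpha> (Inl j)) * f x ^ \<alpha> (Inr True) * x i ^ \<alpha> (Inr False)) = 0)"
proof -
  let ?V = "insert None (Some ` I)" and ?J = "Inl ` I \<union> range Inr :: ('v + bool) set"
  \<comment> \<open>Variables: \<open>None\<close> stands for the multiplier \<mu>,
    \<open>Some i\<close> for a coordinate. Polynomials: \<open>Inl j\<close> is a component of the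
    tilt, \<open>Inr True\<close> is \<open>f\<close>, \<open>Inr False\<close> the chosen
    coordinate.\<close>
  define P where "P j y = (case j of
      Inl j \<Rightarrow> y None * Df j (\<lambda>i. y (Some i)) - Dg j (\<lambda>i. y (Some i))
    | Inr b \<Rightarrow> if b then f (\<lambda>i. y (Some i)) else y (Some i))" for j :: "'v + bool" and y :: "'v option \<Rightarrow> real"
  have comp: "polyfun ?V (\<lambda>y. p (\<lambda>i. y (Some i)))" if "polyfun I p" for p
    by (rule polyfun_compose[OF that]) (auto intro: polyfun.var)
  have P: "polyfun ?V (P j)" if "j \<in> ?J" for j
  proof (cases j)
    case (Inl j)
    then show ?thesis unfolding P_def by (auto intro!: polyfun_intros comp Df Dg)
  next
    case (Inr b)
    then show ?thesis using i unfolding P_def by (cases b) (auto intro!: polyfun_intros comp f)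
  qed
  have J: "?J = Inl ` I \<union> {Inr True, Inr False}" by (auto simp: UNIV_bool)
  have "card ?V = Suc (card I)" using I by (simp add: card_image)
  moreover have "card ?J = card I + 2"
    unfolding J using I by (subst card_Un_disjoint) (auto simp: card_image)
  ultimately have "card ?V < card ?J" by simp
  from polyfun_algebraic_dependence[of ?V ?J P, OF _ _ this P] I obtain n c where
    nc: "\<exists>\<alpha>\<in>?J \<rightarrow>\<^sub>E {..<n::nat}. c \<alpha> \<noteq> 0"
      "\<And>y. (\<Sum>\<alpha>\<in>?J \<rightarrow>\<^sub>E {..<n}. c \<alpha> * (\<Prod>j\<in>?J. P j y ^ \<alpha> j)) = 0" by auto
  have prod: "(\<Prod>j\<in>?J. P j y ^ \<alpha> j) = (\<Prod>j\<in>I. P (Inl j) y ^ \<alpha> (Inl j)) * P (Inr True) y ^ \<alpha> (Inr True) * P (Inr False) y ^ \<alpha> (Inr False)" for y \<alpha>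
  proof -
    have "(\<Prod>j\<in>?J. P j y ^ \<alpha> j) = (\<Prod>j\<in>Inl ` I. P j y ^ \<alpha> j) * (\<Prod>j\<in>{Inr True, Inr False}. P j y ^ \<alpha> j)"
      unfolding J using I by (intro prod.union_disjoint) auto
    then show ?thesis by (simp add: prod.reindex mult.assoc)
  qed
  show ?thesis
  proof (intro exI[of _ n] exI[of _ c] conjI nc(1) allI)
    fix \<mu> :: real and x :: "'v \<Rightarrow> real"
    show "(\<Sum>\<alpha>\<in>?J \<rightarrow>\<^sub>E {..<n}. c \<alpha> * (\<Prod>j\<in>I. (\<mu> * Df j x - Dg j x) ^ \<alpha> (Inl j)) *
        f x ^ \<alpha> (Inr True) * x i ^ \<alpha> (Inr False)) = 0"
      using nc(2)[of "case_option \<mu> x"] unfolding prod by (simp add: P_def mult.assoc)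
  qed
qed

text \<open>The penalty weight \<kappa> will be 1 / \<sigma>. The last bound involves neither
  \<kappa> nor \<open>a\<close>, which gives compactness as \<sigma> tends to 0.\<close>

lemma penalty_minimizer:
  fixes I :: "'v set"
  assumes I: "finite I" and f: "polyfun I f" and g: "polyfun I g"
    and g_nonneg: "\<And>x. 0 \<le> g x" and "c > 0"
    and coercive: "\<And>x. c * (\<Sum>i\<in>I. (x i)\<^sup>2) - C \<le> f x"
    and Df: "has_gradient I f Df" and Dg: "has_gradient I g Dg"
    and \<kappa>: "1 \<le> \<kappa>" and a: "\<And>j. j \<in> I \<Longrightarrow> \<bar>a j\<bar> \<le> 1"
  shows "\<exists>x \<mu>. (\<forall>j\<in>I. \<mu> * Df j x - Dg j x = a j) \<and>
     g x + (\<Sum>j\<in>I. a j * x j) + \<kappa> * (f x - f z)\<^sup>2 \<le> g z + (\<Sum>j\<in>I. a j * z j) \<and>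
     c / 2 * (\<Sum>i\<in>I. (x i)\<^sup>2) \<le> g z + (\<Sum>j\<in>I. \<bar>z j\<bar>) + C + f z + 1 + card I / (2 * c)"
proof -
  let ?t = "f z"
  define \<Phi> where "\<Phi> x = g x + (\<Sum>j\<in>I. a j * x j) + \<kappa> * (f x - ?t)\<^sup>2" for x
  have poly: "polyfun I \<Phi>" unfolding \<Phi>_def[abs_def]
    by (intro polyfun_intros f g) auto
  \<comment> \<open>Since \<kappa> \<ge> 1 and r * r \<ge> r - 1, the penalty inherits the
    coercivity of \<open>f\<close>; half of it absorbs the linear term by Young's
    inequality.\<close>
  have low: "c / 2 * (\<Sum>i\<in>I. (x i)\<^sup>2) - (C + ?t + 1 + card I / (2 * c)) \<le> \<Phi> x" for x
  proof -
    have "(f x - ?t)\<^sup>2 \<ge> f x - ?t - 1"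
    proof -
      have "0 \<le> (f x - ?t - 1/2)\<^sup>2" by simp
      then show ?thesis by (simp add: power2_eq_square algebra_simps)
    qed
    moreover have "\<kappa> * (f x - ?t)\<^sup>2 \<ge> 1 * (f x - ?t)\<^sup>2" using \<kappa> by (intro mult_right_mono) auto
    moreover have "(\<Sum>j\<in>I. a j * x j) \<ge> (\<Sum>j\<in>I. - (c / 2 * (x j)\<^sup>2) - 1 / (2 * c))"
    proof (rule sum_mono)
      fix j assume j: "j \<in> I"
      have "- (a j * x j) \<le> \<bar>x j\<bar>"
      proof -
        have "\<bar>a j * x j\<bar> \<le> 1 * \<bar>x j\<bar>" unfolding abs_mult using a[OF j] by (intro mult_right_mono) auto
        then show ?thesis by linarith
      qed
      also have "\<dots> \<le> c / 2 * (x j)\<^sup>2 + 1 / (2 * c)"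
      proof -
        have "0 \<le> (c * \<bar>x j\<bar> - 1)\<^sup>2" by simp
        then have "2 * c * \<bar>x j\<bar> \<le> c\<^sup>2 * (x j)\<^sup>2 + 1" by (simp add: power2_diff power_mult_distrib)
        then have "2 * c * \<bar>x j\<bar> / (2 * c) \<le> (c\<^sup>2 * (x j)\<^sup>2 + 1) / (2 * c)"
          using \<open>c > 0\<close> by (intro divide_right_mono) auto
        then show ?thesis using \<open>c > 0\<close> by (simp add: field_simps power2_eq_square)
      qed
      finally show "- (c / 2 * (x j)\<^sup>2) - 1 / (2 * c) \<le> a j * x j" by linarith
    qed
    moreover have "(\<Sum>j\<in>I. - (c / 2 * (x j)\<^sup>2) - 1 / (2 * c)) = - (c / 2 * (\<Sum>i\<in>I. (x i)\<^sup>2)) - card I / (2 * c)"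
      by (simp add: sum_subtractf sum_negf sum_distrib_left)
    ultimately show ?thesis
      using coercive[of x] g_nonneg[of x] unfolding \<Phi>_def by linarith
  qed
  have "c / 2 > 0" using \<open>c > 0\<close> by simp
  from coercive_polyfun_attains_min[OF I poly this low] obtain x where x: "\<And>y. \<Phi> x \<le> \<Phi> y" by blast
  \<comment> \<open>The multiplier comes from differentiating the penalty.\<close>
  let ?\<mu> = "- 2 * \<kappa> * (f x - ?t)"
  have \<Phi>z: "\<Phi> z = g z + (\<Sum>j\<in>I. a j * z j)" by (simp add: \<Phi>_def)
  have eq: "?\<mu> * Df j x - Dg j x = a j" if j: "j \<in> I" for j
  proof -
    let ?x = "\<lambda>s i. x i + s * (if i = j then 1 else 0)"
    have "((\<lambda>s. \<Sum>k\<in>I. a k * ?x s k) has_real_derivative (\<Sum>k\<in>I. a k * (if k = j then 1 else 0))) (at 0)"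
      by (auto intro!: derivative_eq_intros sum.cong)
    moreover have "(\<Sum>k\<in>I. a k * (if k = j then 1 else 0)) = a j"
      using I j by (simp add: if_distrib[of "\<lambda>c. _ * c"] cong: if_cong)
    ultimately have lin: "((\<lambda>s. \<Sum>k\<in>I. a k * ?x s k) has_real_derivative a j) (at 0)" by simp
    have "((\<lambda>s. \<Phi> (?x s)) has_real_derivative Dg j x + a j + \<kappa> * (2 * (f x - ?t) * Df j x)) (at 0)"
      unfolding \<Phi>_def
      by (rule derivative_eq_intros lin has_gradient_partial[OF I Df j] has_gradient_partial[OF I Dg j] refl | simp)+
    then have "Dg j x + a j + \<kappa> * (2 * (f x - ?t) * Df j x) = 0"
      by (rule DERIV_local_min[of _ _ _ 1]) (use x in auto)
    then show ?thesis by (simp add: algebra_simps)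
  qed
  have "(\<Sum>j\<in>I. a j * z j) \<le> (\<Sum>j\<in>I. \<bar>z j\<bar>)"
  proof (rule sum_mono)
    fix j assume j: "j \<in> I"
    have "\<bar>a j * z j\<bar> \<le> 1 * \<bar>z j\<bar>" unfolding abs_mult using a[OF j] by (intro mult_right_mono) auto
    then show "a j * z j \<le> \<bar>z j\<bar>" by linarith
  qed
  then have "c / 2 * (\<Sum>i\<in>I. (x i)\<^sup>2) \<le> g z + (\<Sum>j\<in>I. \<bar>z j\<bar>) + C + f z + 1 + card I / (2 * c)"
    using low[of x] x[of z] \<Phi>z by linarith
  then show ?thesis using eq x[of z] \<Phi>z
    by (intro exI[of _ x] exI[of _ "?\<mu>"]) (auto simp: \<Phi>_def)
qed

text \<open>The polynomials \<open>q i\<close> are fixed before \<open>z\<close>, so a single curve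
  per coordinate serves all levels.\<close>

theorem algebraic_talweg:
  fixes I :: "'v set"
  assumes I: "finite I" and f: "polyfun I f" and g: "polyfun I g"
    and g_nonneg: "\<And>x. 0 \<le> g x" and "c > 0"
    and coercive: "\<And>x. c * (\<Sum>i\<in>I. (x i)\<^sup>2) - C \<le> f x"
  shows "\<exists>q. (\<forall>i\<in>I. q i \<noteq> 0) \<and> (\<forall>z. \<exists>x. f x = f z \<and> g x \<le> g z \<and> (\<forall>i\<in>I. ev (q i) (f z) (x i) = 0))"
proof -
  from polyfun_gradient_exists[OF I f] obtain Df where Df: "\<And>i. polyfun I (Df i)" "has_gradient I f Df" by blast
  from polyfun_gradient_exists[OF I g] obtain Dg where Dg: "\<And>i. polyfun I (Dg i)" "has_gradient I g Dg" by blast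
  let ?J = "Inl ` I \<union> range Inr :: ('v + bool) set"
  define rel where "rel i n b \<longleftrightarrow> (\<exists>\<alpha>\<in>?J \<rightarrow>\<^sub>E {..<n::nat}. b \<alpha> \<noteq> 0) \<and>
     (\<forall>\<mu> x. (\<Sum>\<alpha>\<in>?J \<rightarrow>\<^sub>E {..<n}. b \<alpha> *
        (\<Prod>j\<in>I. (\<mu> * Df j x - Dg j x) ^ \<alpha> (Inl j)) * f x ^ \<alpha> (Inr True) * x i ^ \<alpha> (Inr False)) = 0)" for i n b
  have "\<forall>i\<in>I. \<exists>n. \<exists>b. rel i n b"
    unfolding rel_def using algebraic_talweg_relation[OF I f Df(1) Dg(1)] by (rule ballI)
  from bchoice[OF this] obtain N where "\<forall>i\<in>I. \<exists>b. rel i (N i) b" ..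
  from bchoice[OF this] obtain b where "\<forall>i\<in>I. rel i (N i) (b i)" ..
  then have b: "\<And>i. i \<in> I \<Longrightarrow> \<exists>\<alpha>\<in>?J \<rightarrow>\<^sub>E {..<N i}. b i \<alpha> \<noteq> 0"
    "\<And>i \<mu> x. i \<in> I \<Longrightarrow> (\<Sum>\<alpha>\<in>?J \<rightarrow>\<^sub>E {..<N i}. b i \<alpha> *
        (\<Prod>j\<in>I. (\<mu> * Df j x - Dg j x) ^ \<alpha> (Inl j)) * f x ^ \<alpha> (Inr True) * x i ^ \<alpha> (Inr False)) = 0"
    unfolding rel_def by simp_all
  \<comment> \<open>One base exceeding all exponents of all relations; \<open>Suc\<close> makes it
    positive, so that every component of the tilt is at most \<sigma>.\<close>
  define E where "E = Suc (\<Sum>i\<in>I. N i)"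
  have E: "N i \<le> E" if "i \<in> I" for i
    using I that member_le_sum[of i I N] by (simp add: E_def)
  obtain e where e: "bij_betw e I {..<card I}" using ex_bij_betw_finite_nat[OF I] by (auto simp: lessThan_atLeast0)
  \<comment> \<open>The power of \<sigma> in the product of the tilt components raised to
    \<alpha>.\<close>
  define w where "w \<alpha> = (\<Sum>j\<in>I. E ^ e j * \<alpha> (Inl j))" for \<alpha> :: "'v + bool \<Rightarrow> nat"
  have inj: "\<alpha> = \<beta>" if i: "i \<in> I" and \<alpha>: "\<alpha> \<in> ?J \<rightarrow>\<^sub>E {..<N i}" and \<beta>: "\<beta> \<in> ?J \<rightarrow>\<^sub>E {..<N i}" and
    w: "w \<alpha> = w \<beta>" and Inr: "\<alpha> (Inr True) = \<beta> (Inr True)" "\<alpha> (Inr False) = \<beta> (Inr False)" for i \<alpha> \<beta>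
  proof (rule PiE_ext[OF \<alpha> \<beta>])
    let ?e' = "inv_into I e"
    have e': "e (?e' k) = k" "?e' k \<in> I" if "k < card I" for k
      using that e by (auto simp: bij_betw_def f_inv_into_f inv_into_into)
    have conv: "w \<gamma> = (\<Sum>k<card I. E ^ k * \<gamma> (Inl (?e' k)))" for \<gamma>
    proof -
      have "(\<Sum>k<card I. E ^ k * \<gamma> (Inl (?e' k))) = (\<Sum>j\<in>I. E ^ e j * \<gamma> (Inl (?e' (e j))))"
        by (rule sum.reindex_bij_betw[OF e, symmetric])
      also have "\<dots> = w \<gamma>" unfolding w_def
        using e by (intro sum.cong) (auto simp: bij_betw_def)
      finally show ?thesis by simp
    qed
    have lt: "\<gamma> (Inl j) < E" if "\<gamma> \<in> ?J \<rightarrow>\<^sub>E {..<N i}" "j \<in> I" for \<gamma> j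
    proof -
      have "\<gamma> (Inl j) \<in> {..<N i}" using that by (intro PiE_mem[OF that(1)]) auto
      then show ?thesis using E[OF i] by simp
    qed
    have Inl: "\<alpha> (Inl j) = \<beta> (Inl j)" if "j \<in> I" for j
    proof -
      have "e j < card I" using e that by (auto simp: bij_betw_def)
      then have "\<alpha> (Inl (?e' (e j))) = \<beta> (Inl (?e' (e j)))"
        using radix_injective[of "card I" "\<lambda>k. \<alpha> (Inl (?e' k))" E "\<lambda>k. \<beta> (Inl (?e' k))" "e j"]
          w[unfolded conv] lt[OF \<alpha>] lt[OF \<beta>] e' by auto
      then show ?thesis using e that by (simp add: bij_betw_def)
    qed
    fix k assume "k \<in> ?J"
    then show "\<alpha> k = \<beta> k" using Inl Inr by (cases k) (auto, metis (full_types))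
  qed
  define lowest where "lowest i q \<longleftrightarrow> q \<noteq> 0 \<and> (\<forall>\<sigma> T X t x. (\<forall>n::nat. \<sigma> n \<noteq> 0 \<and>
      (\<Sum>\<alpha>\<in>?J \<rightarrow>\<^sub>E {..<N i}. b i \<alpha> * \<sigma> n ^ w \<alpha> * T n ^ \<alpha> (Inr True) * X n ^ \<alpha> (Inr False)) = 0) \<longrightarrow>
      \<sigma> \<longlonglongrightarrow> 0 \<longrightarrow> T \<longlonglongrightarrow> t \<longrightarrow> X \<longlonglongrightarrow> x \<longrightarrow> ev q t x = 0)" for i q
  have "\<forall>i\<in>I. \<exists>q. lowest i q"
  proof
    fix i assume i: "i \<in> I"
    have fin: "finite (?J \<rightarrow>\<^sub>E {..<N i})" using I by (intro finite_PiE) auto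
    show "\<exists>q. lowest i q" unfolding lowest_def
      by (rule lowest_order_relation[OF fin b(1)[OF i]]) (rule inj[OF i])
  qed
  from bchoice[OF this] obtain q where lowest: "\<forall>i\<in>I. lowest i (q i)" ..
  then have q1: "\<forall>i\<in>I. q i \<noteq> 0" by (simp add: lowest_def)
  have q2: "ev (q i) t x = 0" if "i \<in> I" "\<And>n::nat. \<sigma> n \<noteq> 0"
      "\<And>n. (\<Sum>\<alpha>\<in>?J \<rightarrow>\<^sub>E {..<N i}. b i \<alpha> * \<sigma> n ^ w \<alpha> * T n ^ \<alpha> (Inr True) * X n ^ \<alpha> (Inr False)) = 0"
      "\<sigma> \<longlonglongrightarrow> 0" "T \<longlonglongrightarrow> t" "X \<longlonglongrightarrow> x" for i \<sigma> T X t x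
    using bspec[OF lowest that(1), unfolded lowest_def, THEN conjunct2, rule_format, of \<sigma> T X t x] that by simp
  have "\<exists>x. f x = f z \<and> g x \<le> g z \<and> (\<forall>i\<in>I. ev (q i) (f z) (x i) = 0)" for z
  proof -
    define \<sigma> where "\<sigma> n = 1 / real (Suc n)" for n
    define a where "a n j = \<sigma> n ^ (E ^ e j)" for n j
    have \<sigma>: "0 < \<sigma> n" "\<sigma> n \<le> 1" for n by (auto simp: \<sigma>_def)
    have \<sigma>0: "\<sigma> \<longlonglongrightarrow> 0" unfolding \<sigma>_def using LIMSEQ_inverse_real_of_nat by (simp add: inverse_eq_divide)
    have a: "0 \<le> a n j" "a n j \<le> \<sigma> n" for n j
    proof -
      have "\<sigma> n ^ (E ^ e j) \<le> \<sigma> n ^ 1" using \<sigma>[of n] by (intro power_decreasing) (auto simp: E_def)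
      then show "a n j \<le> \<sigma> n" by (simp add: a_def)
      show "0 \<le> a n j" using \<sigma>[of n] by (simp add: a_def)
    qed
    have a1: "\<bar>a n j\<bar> \<le> 1" for n j using a[of n j] \<sigma>[of n] by simp
    have inv: "1 \<le> 1 / \<sigma> n" for n by (simp add: \<sigma>_def)
    \<comment> \<open>The bound does not depend on \<open>n\<close>.\<close>
    define M where "M = g z + (\<Sum>j\<in>I. \<bar>z j\<bar>) + C + f z + 1 + card I / (2 * c)"
    define pm where "pm n x \<mu> \<longleftrightarrow> (\<forall>j\<in>I. \<mu> * Df j x - Dg j x = a n j) \<and>
     g x + (\<Sum>j\<in>I. a n j * x j) + 1 / \<sigma> n * (f x - f z)\<^sup>2 \<le> g z + (\<Sum>j\<in>I. a n j * z j) \<and>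
     c / 2 * (\<Sum>i\<in>I. (x i)\<^sup>2) \<le> M" for n x \<mu>
    have "\<forall>n. \<exists>x. \<exists>\<mu>. pm n x \<mu>"
      unfolding pm_def M_def using penalty_minimizer[OF I f g g_nonneg \<open>c > 0\<close> coercive Df(2) Dg(2) inv a1] by (rule allI)
    from choice[OF this] obtain x where "\<forall>n. \<exists>\<mu>. pm n (x n) \<mu>" ..
    from choice[OF this] obtain \<mu> where "\<forall>n. pm n (x n) (\<mu> n)" ..
    then have x: "\<And>n j. j \<in> I \<Longrightarrow> \<mu> n * Df j (x n) - Dg j (x n) = a n j"
      "\<And>n. g (x n) + (\<Sum>j\<in>I. a n j * x n j) + 1 / \<sigma> n * (f (x n) - f z)\<^sup>2 \<le> g z + (\<Sum>j\<in>I. a n j * z j)"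
      "\<And>n. c / 2 * (\<Sum>i\<in>I. (x n i)\<^sup>2) \<le> M"
      unfolding pm_def by blast+
    define B where "B = 1 + M / (c / 2)"
    have B: "\<bar>x n i\<bar> \<le> B" if "i \<in> I" for n i
      unfolding B_def using \<open>c > 0\<close> by (intro coercive_bound[OF I _ x(3) that]) auto
    from bounded_coordinates_convergent_subseq[OF I, of x, OF B] obtain r l where
      r: "strict_mono (r :: nat \<Rightarrow> nat)" "\<And>i. i \<in> I \<Longrightarrow> (\<lambda>n. x (r n) i) \<longlonglongrightarrow> l i" by blast
    have \<sigma>r: "(\<lambda>n. \<sigma> (r n)) \<longlonglongrightarrow> 0" using LIMSEQ_subseq_LIMSEQ[OF \<sigma>0 r(1)] by (simp add: o_def)
    have lim: "(\<lambda>n. f (x (r n))) \<longlonglongrightarrow> f l" "(\<lambda>n. g (x (r n))) \<longlonglongrightarrow> g l"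
      using polyfun_tendsto[OF f, where x="\<lambda>n. x (r n)"] polyfun_tendsto[OF g, where x="\<lambda>n. x (r n)"] r(2) by auto
    define K where "K = (\<Sum>j\<in>I. \<bar>z j\<bar> + B)"
    \<comment> \<open>The tilt changes the objective by O(\<sigma>) only, so it disappears from the
      inequality for \<open>g\<close> in the limit.\<close>
    have K: "\<bar>(\<Sum>j\<in>I. a n j * z j) - (\<Sum>j\<in>I. a n j * x n j)\<bar> \<le> \<sigma> n * K" for n
    proof -
      have "\<bar>(\<Sum>j\<in>I. a n j * z j) - (\<Sum>j\<in>I. a n j * x n j)\<bar> = \<bar>\<Sum>j\<in>I. a n j * (z j - x n j)\<bar>"
        by (simp add: sum_subtractf right_diff_distrib)
      also have "\<dots> \<le> (\<Sum>j\<in>I. \<sigma> n * (\<bar>z j\<bar> + B))"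
      proof (rule order_trans[OF sum_abs], rule sum_mono)
        fix j assume j: "j \<in> I"
        have "\<bar>z j - x n j\<bar> \<le> \<bar>z j\<bar> + B" using B[OF j, of n] by linarith
        then show "\<bar>a n j * (z j - x n j)\<bar> \<le> \<sigma> n * (\<bar>z j\<bar> + B)"
          unfolding abs_mult using a[of n j] \<sigma>[of n] by (intro mult_mono) auto
      qed
      finally show ?thesis by (simp add: K_def sum_distrib_left)
    qed
    have g_le: "g (x n) \<le> g z + \<sigma> n * K" for n
    proof -
      have "0 \<le> 1 / \<sigma> n * (f (x n) - f z)\<^sup>2" using \<sigma>[of n] by simp
      then show ?thesis using x(2)[of n] K[of n] by linarith
    qed
    \<comment> \<open>The penalty forces \<open>f (x n)\<close> to the prescribed level at rate
      \<sigma>.\<close>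
    have "(f (x n) - f z)\<^sup>2 \<le> \<sigma> n * (g z + \<sigma> n * K)" for n
    proof -
      have "1 / \<sigma> n * (f (x n) - f z)\<^sup>2 \<le> g z + \<sigma> n * K"
        using x(2)[of n] K[of n] g_nonneg[of "x n"] by linarith
      then have "\<sigma> n * (1 / \<sigma> n * (f (x n) - f z)\<^sup>2) \<le> \<sigma> n * (g z + \<sigma> n * K)"
        using \<sigma>[of n] by (intro mult_left_mono) auto
      then show ?thesis using \<sigma>[of n] by simp
    qed
    moreover have "(\<lambda>n. \<sigma> (r n) * (g z + \<sigma> (r n) * K)) \<longlonglongrightarrow> 0 * (g z + 0 * K)"
      by (intro tendsto_intros \<sigma>r)
    moreover have "(\<lambda>n. (f (x (r n)) - f z)\<^sup>2) \<longlonglongrightarrow> (f l - f z)\<^sup>2" by (intro tendsto_intros lim)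
    ultimately have "(f l - f z)\<^sup>2 \<le> 0 * (g z + 0 * K)" using LIMSEQ_le by blast
    then have fl: "f l = f z" by simp
    have "(\<lambda>n. g z + \<sigma> (r n) * K) \<longlonglongrightarrow> g z + 0 * K" by (intro tendsto_intros \<sigma>r)
    then have gl: "g l \<le> g z" using LIMSEQ_le[OF lim(2)] g_le by fastforce
    have "ev (q i) (f l) (l i) = 0" if i: "i \<in> I" for i
    proof (rule q2[OF i])
      fix n
      show "\<sigma> (r n) \<noteq> 0" using \<sigma>[of "r n"] by simp
      have pw: "(\<Prod>j\<in>I. a (r n) j ^ \<alpha> (Inl j)) = \<sigma> (r n) ^ w \<alpha>" for \<alpha> :: "'v + bool \<Rightarrow> nat"
        unfolding a_def w_def by (simp add: power_sum power_mult)
      show "(\<Sum>\<alpha>\<in>?J \<rightarrow>\<^sub>E {..<N i}. b i \<alpha> * \<sigma> (r n) ^ w \<alpha> * f (x (r n)) ^ \<alpha> (Inr True) * x (r n) i ^ \<alpha> (Inr False)) = 0"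
        using b(2)[OF i, of "\<mu> (r n)" "x (r n)"] x(1)[of _ "r n"] by (simp add: pw cong: prod.cong sum.cong)
    qed (use \<sigma>r lim r(2) i in auto)
    with fl gl show ?thesis by auto
  qed
  with q1 show ?thesis by blast
qed

section \<open>Gradient-like descent of a coercive polynomial\<close>

text \<open>The bound \<open>M\<close> on the values is carried along because the Lipschitz constant
  of a product needs it.\<close>

lemma polyfun_lipschitz:
  assumes I: "finite I" and p: "polyfun I p"
  shows "\<exists>L M. 0 \<le> L \<and> 0 \<le> M \<and> (\<forall>x y. (\<forall>i\<in>I. \<bar>x i\<bar> \<le> R \<and> \<bar>y i\<bar> \<le> R) \<longrightarrow>
     \<bar>p x\<bar> \<le> M \<and> \<bar>p x - p y\<bar> \<le> L * (\<Sum>i\<in>I. \<bar>x i - y i\<bar>))"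
  using p
proof induction
  case (const c)
  show ?case by (intro exI[of _ 0] exI[of _ "\<bar>c\<bar>"]) auto
next
  case (var v)
  have "\<bar>x v\<bar> \<le> \<bar>R\<bar> \<and> \<bar>x v - y v\<bar> \<le> 1 * (\<Sum>i\<in>I. \<bar>x i - y i\<bar>)"
    if box: "\<forall>i\<in>I. \<bar>x i\<bar> \<le> R \<and> \<bar>y i\<bar> \<le> R" for x y :: "'a \<Rightarrow> real"
  proof -
    have "\<bar>x v\<bar> \<le> R" using box var by blast
    moreover have "\<bar>x v - y v\<bar> \<le> (\<Sum>i\<in>I. \<bar>x i - y i\<bar>)"
      using I var by (intro member_le_sum) auto
    ultimately show ?thesis by simp
  qed
  then show ?case using zero_le_one[where 'a=real] abs_ge_zero[of R] by blast
next
  case (add p q)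
  from add.IH obtain L M L' M' where *: "0 \<le> L" "0 \<le> M" "0 \<le> L'" "0 \<le> M'" and
    p: "\<forall>x y. (\<forall>i\<in>I. \<bar>x i\<bar> \<le> R \<and> \<bar>y i\<bar> \<le> R) \<longrightarrow>
     \<bar>p x\<bar> \<le> M \<and> \<bar>p x - p y\<bar> \<le> L * (\<Sum>i\<in>I. \<bar>x i - y i\<bar>)" and
    q: "\<forall>x y. (\<forall>i\<in>I. \<bar>x i\<bar> \<le> R \<and> \<bar>y i\<bar> \<le> R) \<longrightarrow>
     \<bar>q x\<bar> \<le> M' \<and> \<bar>q x - q y\<bar> \<le> L' * (\<Sum>i\<in>I. \<bar>x i - y i\<bar>)" by (elim exE conjE)
  note p = p[THEN spec, THEN spec, THEN mp] and q = q[THEN spec, THEN spec, THEN mp]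
  show ?case
  proof (rule exI[of _ "L + L'"], rule exI[of _ "M + M'"], intro conjI allI impI)
    fix x y :: "'a \<Rightarrow> real" assume box: "\<forall>i\<in>I. \<bar>x i\<bar> \<le> R \<and> \<bar>y i\<bar> \<le> R"
    show "\<bar>p x + q x\<bar> \<le> M + M'" using p[OF box] q[OF box] by linarith
    show "\<bar>p x + q x - (p y + q y)\<bar> \<le> (L + L') * (\<Sum>i\<in>I. \<bar>x i - y i\<bar>)"
      using p[OF box] q[OF box] unfolding distrib_right by linarith
  qed (use * in auto)
next
  case (mult p q)
  from mult.IH obtain L M L' M' where *: "0 \<le> L" "0 \<le> M" "0 \<le> L'" "0 \<le> M'" and
    p: "\<forall>x y. (\<forall>i\<in>I. \<bar>x i\<bar> \<le> R \<and> \<bar>y i\<bar> \<le> R) \<longrightarrow>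
     \<bar>p x\<bar> \<le> M \<and> \<bar>p x - p y\<bar> \<le> L * (\<Sum>i\<in>I. \<bar>x i - y i\<bar>)" and
    q: "\<forall>x y. (\<forall>i\<in>I. \<bar>x i\<bar> \<le> R \<and> \<bar>y i\<bar> \<le> R) \<longrightarrow>
     \<bar>q x\<bar> \<le> M' \<and> \<bar>q x - q y\<bar> \<le> L' * (\<Sum>i\<in>I. \<bar>x i - y i\<bar>)" by (elim exE conjE)
  note p = p[THEN spec, THEN spec, THEN mp] and q = q[THEN spec, THEN spec, THEN mp]
  show ?case
  proof (rule exI[of _ "L * M' + M * L'"], rule exI[of _ "M * M'"], intro conjI allI impI)
    fix x y :: "'a \<Rightarrow> real" assume box: "\<forall>i\<in>I. \<bar>x i\<bar> \<le> R \<and> \<bar>y i\<bar> \<le> R"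
    then have box': "\<forall>i\<in>I. \<bar>y i\<bar> \<le> R \<and> \<bar>x i\<bar> \<le> R" by auto
    show "\<bar>p x * q x\<bar> \<le> M * M'" unfolding abs_mult using p[OF box] q[OF box] * by (intro mult_mono) auto
    let ?N = "\<Sum>i\<in>I. \<bar>x i - y i\<bar>"
    have "p x * q x - p y * q y = (p x - p y) * q x + p y * (q x - q y)" by (simp add: algebra_simps)
    also have "\<bar>\<dots>\<bar> \<le> \<bar>p x - p y\<bar> * \<bar>q x\<bar> + \<bar>p y\<bar> * \<bar>q x - q y\<bar>"
      by (rule order_trans[OF abs_triangle_ineq]) (simp add: abs_mult)
    also have "\<dots> \<le> (L * ?N) * M' + M * (L' * ?N)"
      using p[OF box] q[OF box] p[OF box'] * by (intro add_mono mult_mono) (auto intro!: sum_nonneg mult_nonneg_nonneg)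
    finally show "\<bar>p x * q x - p y * q y\<bar> \<le> (L * M' + M * L') * ?N" by (simp add: algebra_simps)
  qed (use * in auto)
qed

lemma polyfun_common_lipschitz:
  assumes I: "finite I" and p: "\<And>j. polyfun I (p j)"
  shows "\<exists>L\<ge>0. \<forall>j\<in>I. \<forall>x y. (\<forall>i\<in>I. \<bar>x i\<bar> \<le> R \<and> \<bar>y i\<bar> \<le> R) \<longrightarrow> \<bar>p j x - p j y\<bar> \<le> L * (\<Sum>i\<in>I. \<bar>x i - y i\<bar>)"
proof -
  have "\<forall>j. \<exists>L\<ge>0. \<forall>x y. (\<forall>i\<in>I. \<bar>x i\<bar> \<le> R \<and> \<bar>y i\<bar> \<le> R) \<longrightarrow> \<bar>p j x - p j y\<bar> \<le> L * (\<Sum>i\<in>I. \<bar>x i - y i\<bar>)"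
  proof
    fix j
    from polyfun_lipschitz[OF I p[of j], of R] obtain L M where "0 \<le> L" and
      L: "\<forall>x y. (\<forall>i\<in>I. \<bar>x i\<bar> \<le> R \<and> \<bar>y i\<bar> \<le> R) \<longrightarrow>
        \<bar>p j x\<bar> \<le> M \<and> \<bar>p j x - p j y\<bar> \<le> L * (\<Sum>i\<in>I. \<bar>x i - y i\<bar>)" by (elim exE conjE)
    show "\<exists>L\<ge>0. \<forall>x y. (\<forall>i\<in>I. \<bar>x i\<bar> \<le> R \<and> \<bar>y i\<bar> \<le> R) \<longrightarrow> \<bar>p j x - p j y\<bar> \<le> L * (\<Sum>i\<in>I. \<bar>x i - y i\<bar>)"
      by (intro exI[of _ L] conjI[OF \<open>0 \<le> L\<close>] allI impI) (rule L[THEN spec, THEN spec, THEN mp, THEN conjunct2])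
  qed
  from choice[OF this] obtain L where L': "\<forall>j. 0 \<le> L j \<and> (\<forall>x y. (\<forall>i\<in>I. \<bar>x i\<bar> \<le> R \<and> \<bar>y i\<bar> \<le> R) \<longrightarrow>
      \<bar>p j x - p j y\<bar> \<le> L j * (\<Sum>i\<in>I. \<bar>x i - y i\<bar>))" ..
  note L = L'[THEN spec, THEN conjunct1] L'[THEN spec, THEN conjunct2, THEN spec, THEN spec, THEN mp]
  show ?thesis
  proof (intro exI[of _ "\<Sum>j\<in>I. L j"] conjI ballI allI impI)
    fix j x y assume j: "j \<in> I" and box: "\<forall>i\<in>I. \<bar>x i\<bar> \<le> R \<and> \<bar>y i\<bar> \<le> R"
    have "L j \<le> (\<Sum>j\<in>I. L j)" using I j L(1) by (intro member_le_sum) auto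
    then have "L j * (\<Sum>i\<in>I. \<bar>x i - y i\<bar>) \<le> (\<Sum>j\<in>I. L j) * (\<Sum>i\<in>I. \<bar>x i - y i\<bar>)"
      by (intro mult_right_mono sum_nonneg) auto
    then show "\<bar>p j x - p j y\<bar> \<le> (\<Sum>j\<in>I. L j) * (\<Sum>i\<in>I. \<bar>x i - y i\<bar>)" using L(2)[OF box, of j] by linarith
  qed (use L in \<open>auto intro: sum_nonneg\<close>)
qed

text \<open>The gradient is known at \<open>x\<close> only; its Lipschitz constant carries the bound
  to the whole segment, at the price of a quadratic term.\<close>

lemma gradient_increment_bound:
  assumes I: "finite I" and D: "has_gradient I f D"
    and L: "0 \<le> L" "\<And>i x y. i \<in> I \<Longrightarrow> (\<forall>i\<in>I. \<bar>x i\<bar> \<le> R \<and> \<bar>y i\<bar> \<le> R) \<Longrightarrow>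
        \<bar>D i x - D i y\<bar> \<le> L * (\<Sum>i\<in>I. \<bar>x i - y i\<bar>)"
    and box: "\<And>i. i \<in> I \<Longrightarrow> \<bar>x i\<bar> \<le> R" "\<And>i. i \<in> I \<Longrightarrow> \<bar>y i\<bar> \<le> R"
    and r: "\<And>i. i \<in> I \<Longrightarrow> \<bar>D i x\<bar> \<le> r"
  shows "\<bar>f y - f x\<bar> \<le> (r + L * (\<Sum>i\<in>I. \<bar>y i - x i\<bar>)) * (\<Sum>i\<in>I. \<bar>y i - x i\<bar>)"
proof -
  let ?v = "\<lambda>i. y i - x i" and ?N = "\<Sum>i\<in>I. \<bar>y i - x i\<bar>"
  let ?z = "\<lambda>s i. x i + s * ?v i"
  have "\<exists>s::real. 0 < s \<and> s < 1 \<and> f (?z 1) - f (?z 0) = (1 - 0) * (\<Sum>i\<in>I. D i (?z s) * ?v i)"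
    by (rule MVT2) (use D in \<open>auto simp: has_gradient_def\<close>)
  then obtain s where s: "0 < s" "s < 1" "f y - f x = (\<Sum>i\<in>I. D i (?z s) * ?v i)" by auto
  have zbox: "\<bar>?z s i\<bar> \<le> R" if i: "i \<in> I" for i
  proof -
    have "?z s i = (1 - s) * x i + s * y i" by (simp add: algebra_simps)
    also have "\<bar>\<dots>\<bar> \<le> (1 - s) * \<bar>x i\<bar> + s * \<bar>y i\<bar>"
      by (rule order_trans[OF abs_triangle_ineq]) (use s in \<open>simp add: abs_mult\<close>)
    also have "\<dots> \<le> (1 - s) * R + s * R"
      using s box[OF i] by (intro add_mono mult_left_mono) auto
    also have "\<dots> = R" by (simp add: left_diff_distrib)
    finally show ?thesis .
  qed
  have Dz: "\<bar>D i (?z s)\<bar> \<le> r + L * ?N" if i: "i \<in> I" for i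
  proof -
    have "\<bar>D i (?z s) - D i x\<bar> \<le> L * (\<Sum>i\<in>I. \<bar>?z s i - x i\<bar>)"
      by (rule L(2)[OF i]) (use zbox box in blast)
    also have "\<dots> \<le> L * ?N"
      using s L(1) by (intro mult_left_mono sum_mono) (auto simp: abs_mult intro: mult_left_le_one_le)
    finally have "\<bar>D i (?z s) - D i x\<bar> \<le> L * ?N" .
    then show ?thesis using r[OF i] by linarith
  qed
  have "\<bar>f y - f x\<bar> \<le> (\<Sum>i\<in>I. \<bar>D i (?z s)\<bar> * \<bar>?v i\<bar>)"
    unfolding s(3) by (rule order_trans[OF sum_abs]) (simp add: abs_mult)
  also have "\<dots> \<le> (\<Sum>i\<in>I. (r + L * ?N) * \<bar>?v i\<bar>)"
    by (intro sum_mono mult_right_mono Dz) auto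
  finally show ?thesis by (simp add: sum_distrib_left)
qed

section \<open>From the variation of coordinates to the length of a level interval\<close>

definition bv_coloring_family :: "real \<Rightarrow> real \<Rightarrow> 'v set \<Rightarrow> ('v \<Rightarrow> (real \<times> real) set) \<Rightarrow>
    nat \<Rightarrow> (real \<Rightarrow> ('v \<Rightarrow> real) \<Rightarrow> nat) \<Rightarrow> (real \<Rightarrow> real) \<Rightarrow> real \<Rightarrow> bool" where
  "bv_coloring_family a b I Z k col W B \<longleftrightarrow>
     (\<forall>t x. a < t \<longrightarrow> t < b \<longrightarrow> (\<forall>i\<in>I. (t, x i) \<in> Z i) \<longrightarrow> col t x < k) \<and>
     (\<forall>t t'. a < t \<longrightarrow> t \<le> t' \<longrightarrow> t' < b \<longrightarrow> W t \<le> W t') \<and>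
     (\<forall>t. a < t \<longrightarrow> t < b \<longrightarrow> \<bar>W t\<bar> \<le> B) \<and>
     (\<forall>t t' x x'. a < t \<longrightarrow> t \<le> t' \<longrightarrow> t' < b \<longrightarrow> (\<forall>i\<in>I. (t, x i) \<in> Z i) \<longrightarrow> (\<forall>i\<in>I. (t', x' i) \<in> Z i) \<longrightarrow>
        col t x = col t' x' \<longrightarrow> (\<Sum>i\<in>I. \<bar>x' i - x i\<bar>) \<le> W t' - W t)"

lemmas bv_coloring_familyD =
  bv_coloring_family_def[THEN iffD1, THEN conjunct1, rule_format (no_asm)]
  bv_coloring_family_def[THEN iffD1, THEN conjunct2, THEN conjunct1, rule_format (no_asm)]
  bv_coloring_family_def[THEN iffD1, THEN conjunct2, THEN conjunct2, THEN conjunct1, rule_format (no_asm)]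
  bv_coloring_family_def[THEN iffD1, THEN conjunct2, THEN conjunct2, THEN conjunct2, rule_format (no_asm)]

lemma bv_coloring_family_exists:
  assumes "finite I" "\<And>i. i \<in> I \<Longrightarrow> \<exists>b>a. bv_colorable a b (Z i)"
  shows "\<exists>b>a. \<exists>k col W B. bv_coloring_family a b I Z k col W B"
  using assms
proof (induction I)
  case empty
  have "bv_coloring_family a (a + 1) {} Z 1 (\<lambda>_ _. 0) (\<lambda>_. 0) 0" by (simp add: bv_coloring_family_def)
  moreover have "a < a + 1" by simp
  ultimately show ?case by blast
next
  case (insert j I)
  obtain b1 k1 col1 W1 B1 where "b1 > a" and "bv_coloring_family a b1 I Z k1 col1 W1 B1"
    using insert.IH insert.prems by auto
  note 1 = bv_coloring_familyD[OF this(2)]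
  obtain b2 k2 col2 W2 B2 where "b2 > a" and "bv_coloring a b2 (Z j) k2 col2 W2 B2"
    using insert.prems[of j] by (auto simp: bv_colorable_def)
  note 2 = bv_coloringD[OF this(2)]
  \<comment> \<open>The pair of colours is encoded in mixed radix and recovered modulo
    \<open>k1\<close>.\<close>
  let ?b = "min b1 b2" and ?col = "\<lambda>t x. col1 t x + k1 * col2 t (x j)"
  have "bv_coloring_family a ?b (insert j I) Z (k1 * k2) ?col (\<lambda>t. W1 t + W2 t) (B1 + B2)"
    unfolding bv_coloring_family_def
  proof (intro conjI allI impI)
    fix t x assume t: "a < t" "t < ?b" "\<forall>i\<in>insert j I. (t, x i) \<in> Z i"
    then have "col1 t x < k1" by (intro 1(1)) auto
    have "Suc (col2 t (x j)) \<le> k2" using t by (intro Suc_leI 2(1)) auto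
    from \<open>col1 t x < k1\<close>
    have "?col t x < k1 * Suc (col2 t (x j))" by simp
    also have "\<dots> \<le> k1 * k2" using \<open>Suc (col2 t (x j)) \<le> k2\<close> by (rule mult_le_mono2)
    finally show "?col t x < k1 * k2" .
  next
    fix t t' assume "a < t" "t \<le> t'" "t' < ?b"
    then show "W1 t + W2 t \<le> W1 t' + W2 t'" using 1(2)[of t t'] 2(2)[of t t'] by simp
  next
    fix t assume "a < t" "t < ?b"
    then show "\<bar>W1 t + W2 t\<bar> \<le> B1 + B2" using 1(3)[of t] 2(3)[of t] by simp
  next
    fix t t' x x' assume t: "a < t" "t \<le> t'" "t' < ?b" and
      Z: "\<forall>i\<in>insert j I. (t, x i) \<in> Z i" "\<forall>i\<in>insert j I. (t', x' i) \<in> Z i" and col: "?col t x = ?col t' x'"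
    have "col1 t x < k1" by (rule 1(1)) (use t Z in auto)
    moreover have "col1 t' x' < k1" by (rule 1(1)) (use t Z in auto)
    ultimately have lt: "col1 t x < k1" "col1 t' x' < k1" .
    have "?col t x mod k1 = ?col t' x' mod k1" using col by simp
    then have c1: "col1 t x = col1 t' x'" using lt by simp
    then have c2: "col2 t (x j) = col2 t' (x' j)" using col lt by auto
    have "(\<Sum>i\<in>I. \<bar>x' i - x i\<bar>) \<le> W1 t' - W1 t" using t Z c1 by (intro 1(4)) auto
    moreover have "\<bar>x' j - x j\<bar> \<le> W2 t' - W2 t" using t Z c2 by (intro 2(4)) auto
    ultimately show "(\<Sum>i\<in>insert j I. \<bar>x' i - x i\<bar>) \<le> W1 t' + W2 t' - (W1 t + W2 t)"
      using insert.hyps by simp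
  qed
  moreover have "a < ?b" using \<open>b1 > a\<close> \<open>b2 > a\<close> by simp
  ultimately show ?case by blast
qed

text \<open>Two of \<open>k + 1\<close> equally spaced points share a colour, and distinct points
  are at least one step apart.\<close>

lemma pigeonhole_interval:
  fixes u v :: real and col :: "real \<Rightarrow> nat"
  assumes "u < v" and col: "\<And>t. u \<le> t \<Longrightarrow> t \<le> v \<Longrightarrow> col t < k"
  shows "\<exists>p p'. u \<le> p \<and> p < p' \<and> p' \<le> v \<and> col p = col p' \<and> (v - u) / k \<le> p' - p"
proof -
  have k: "k > 0" using col[of u] \<open>u < v\<close> by simp
  define h where "h = (v - u) / k"
  define P where "P j = u + real j * h" for j
  have P: "u \<le> P j" "P j \<le> v" if "j \<le> k" for j
  proof -
    show "u \<le> P j" using \<open>u < v\<close> k by (simp add: P_def h_def)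
    have "real j * h \<le> real k * h" using that \<open>u < v\<close> unfolding h_def by (intro mult_right_mono) auto
    then show "P j \<le> v" using k by (simp add: P_def h_def)
  qed
  have "(\<lambda>j. col (P j)) ` {..k} \<subseteq> {..<k}" using P col by auto
  then have "card ((\<lambda>j. col (P j)) ` {..k}) \<le> k" using card_mono[of "{..<k}"] by fastforce
  then have "\<not> inj_on (\<lambda>j. col (P j)) {..k}" by (intro pigeonhole) simp
  then obtain i j where ij: "i \<le> k" "j \<le> k" "i < j" "col (P i) = col (P j)"
    unfolding inj_on_def by (metis atMost_iff linorder_neqE_nat)
  have "P j - P i = (real j - real i) * h" by (simp add: P_def algebra_simps)
  moreover have "1 * h \<le> (real j - real i) * h"
    using ij \<open>u < v\<close> unfolding h_def by (intro mult_right_mono) auto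
  ultimately have "(v - u) / k \<le> P j - P i" by (simp add: h_def)
  moreover have "(v - u) / k > 0" using k \<open>u < v\<close> by simp
  ultimately show ?thesis using P ij by (intro exI[of _ "P i"] exI[of _ "P j"]) auto
qed

text \<open>The quadratic term cannot be removed by refining alone, since \<open>W\<close> may jump.
  On each piece of a fine partition either it is dominated by the linear term, or the increment of
  \<open>W\<close> is already large enough.\<close>

lemma length_le_variation:
  fixes W :: "real \<Rightarrow> real"
  assumes "p < q" "r > 0" "L \<ge> 0" "m > 0"
    and mono: "\<And>u v. p \<le> u \<Longrightarrow> u \<le> v \<Longrightarrow> v \<le> q \<Longrightarrow> W u \<le> W v"
    and local: "\<And>u v. p \<le> u \<Longrightarrow> u < v \<Longrightarrow> v \<le> q \<Longrightarrow> (v - u) / m \<le> (r + L * (W v - W u)) * (W v - W u)"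
  shows "q - p \<le> 4 * m * r * (W q - W p)"
proof -
  \<comment> \<open>Chosen so that \<open>d * L / r \<le> 1\<close> for the \<open>d\<close>
    below.\<close>
  define n where "n = nat \<lceil>(q - p) * L / (2 * r\<^sup>2 * m)\<rceil> + 1"
  have n: "n > 0" "(q - p) * L / (2 * r\<^sup>2 * m) \<le> n" unfolding n_def by linarith+
  define h where "h = (q - p) / n"
  define u where "u j = p + real j * h" for j
  have u0: "u 0 = p" and un: "u n = q" using n by (auto simp: u_def h_def)
  have "u (Suc j) - u j = h" for j by (simp add: u_def algebra_simps)
  then have step: "u (Suc j) - u j = (q - p) / n" for j by (simp add: h_def)
  have pos: "(q - p) / n > 0" using n \<open>p < q\<close> by simp
  have u: "p \<le> u j" "u j \<le> q" if "j \<le> n" for j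
  proof -
    show "p \<le> u j" using \<open>p < q\<close> by (simp add: u_def h_def)
    have "real j * h \<le> real n * h" using that pos by (intro mult_right_mono) (auto simp: h_def)
    then show "u j \<le> q" using n by (simp add: u_def h_def)
  qed
  \<comment> \<open>The increment of \<open>W\<close> that the linear term alone, with doubled slope
    \<open>2 * r\<close>, forces on one piece.\<close>
  define d where "d = (q - p) / (2 * r * n * m)"
  have d: "d > 0" using assms n by (simp add: d_def)
  have dL: "d * L / r \<le> 1"
  proof -
    have "d * L / r = ((q - p) * L / (2 * r\<^sup>2 * m)) / n" by (simp add: d_def power2_eq_square)
    also have "\<dots> \<le> 1" using n by (simp only: divide_le_eq_1_pos of_nat_0_less_iff)
    finally show ?thesis .
  qed
  have "d \<le> 2 * (W (u (Suc j)) - W (u j))" if j: "j < n" for j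
  proof -
    let ?w = "W (u (Suc j)) - W (u j)"
    have ule: "u j < u (Suc j)" using step[of j] pos by linarith
    have w: "?w \<ge> 0" using mono[of "u j" "u (Suc j)"] u[of j] u[of "Suc j"] j ule by simp
    have loc: "(q - p) / n / m \<le> (r + L * ?w) * ?w"
      using local[of "u j" "u (Suc j)"] u[of j] u[of "Suc j"] j ule step[of j] by simp
    show ?thesis
    proof (cases "L * ?w \<le> r")
      case True
      have "2 * r * d = (q - p) / n / m" using assms n by (simp add: d_def field_simps)
      also have "\<dots> \<le> (r + L * ?w) * ?w" by (rule loc)
      also have "(r + L * ?w) * ?w \<le> (2 * r) * ?w" using True w by (intro mult_right_mono) auto
      finally have "2 * r * d \<le> 2 * r * ?w" .
      then have "d \<le> ?w" using \<open>r > 0\<close> by simp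
      then show ?thesis using w by simp
    next
      case False
      \<comment> \<open>Here the increment exceeds \<open>r / L\<close>, which is at least
        \<open>d\<close> by the choice of \<open>n\<close>.\<close>
      then have "1 \<le> L * ?w / r" using \<open>r > 0\<close> by simp
      then have "d * 1 \<le> d * (L * ?w / r)" using d by (intro mult_left_mono) auto
      also have "\<dots> = (d * L / r) * ?w" by simp
      also have "\<dots> \<le> 1 * ?w" using dL w by (intro mult_right_mono)
      finally show ?thesis using w by simp
    qed
  qed
  then have "(\<Sum>j<n. d) \<le> (\<Sum>j<n. 2 * (W (u (Suc j)) - W (u j)))" by (intro sum_mono) auto
  also have "\<dots> = 2 * (W q - W p)"
    using sum_lessThan_telescope[of "\<lambda>j. W (u j)" n] by (simp only: sum_distrib_left[symmetric] u0 un)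
  finally have "real n * d \<le> 2 * (W q - W p)" by simp
  then have "2 * r * m * (real n * d) \<le> 2 * r * m * (2 * (W q - W p))" using assms by (intro mult_left_mono) auto
  moreover have "2 * r * m * (real n * d) = q - p" using assms n by (simp add: d_def)
  ultimately show ?thesis by (simp add: algebra_simps)
qed

text \<open>Descent alone makes only the squares of the steps summable. The gradient bound removes
  one factor of the step from the energy estimate.\<close>

theorem gradient_like_descent_summable:
  fixes I :: "'v set" and x :: "nat \<Rightarrow> 'v \<Rightarrow> real"
  assumes I: "finite I" and f: "polyfun I f" and "c > 0"
    and coercive: "\<And>y. c * (\<Sum>i\<in>I. (y i)\<^sup>2) - C \<le> f y"
    and Df: "\<And>i. polyfun I (Df i)" "has_gradient I f Df"
    and "a > 0" and "b \<ge> 0"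
    and descent: "\<And>n. a * (\<Sum>i\<in>I. \<bar>x (Suc n) i - x n i\<bar>)\<^sup>2 \<le> f (x n) - f (x (Suc n))"
    and gradient: "\<And>n i. i \<in> I \<Longrightarrow> \<bar>Df i (x (Suc n))\<bar> \<le> b * (\<Sum>i\<in>I. \<bar>x (Suc n) i - x n i\<bar>)"
  shows "summable (\<lambda>n. \<Sum>i\<in>I. \<bar>x (Suc n) i - x n i\<bar>)"
proof -
  define \<Delta> where "\<Delta> n = (\<Sum>i\<in>I. \<bar>x (Suc n) i - x n i\<bar>)" for n
  have \<Delta>: "\<Delta> n \<ge> 0" for n unfolding \<Delta>_def by (intro sum_nonneg) auto
  define t where "t n = f (x n)" for n
  have desc: "a * (\<Delta> n)\<^sup>2 \<le> t n - t (Suc n)" for n using descent[of n] by (simp add: \<Delta>_def t_def)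
  have "t (Suc n) \<le> t n" for n
  proof -
    have "0 \<le> a * (\<Delta> n)\<^sup>2" using \<open>a > 0\<close> by simp
    then show ?thesis using desc[of n] by linarith
  qed
  then have dec: "decseq t" by (rule decseq_SucI)
  have low: "- C \<le> f y" for y
  proof -
    have "0 \<le> c * (\<Sum>i\<in>I. (y i)\<^sup>2)" using \<open>c > 0\<close> by (intro mult_nonneg_nonneg sum_nonneg) auto
    then show ?thesis using coercive[of y] by linarith
  qed
  obtain t' where t': "t \<longlonglongrightarrow> t'" "\<And>n. t' \<le> t n"
    using decseq_convergent[OF dec, of "- C"] low by (auto simp: t_def)
  \<comment> \<open>A box containing all points whose level is at most the initial one.\<close>
  define R where "R = 1 + (t 0 + C) / c"
  have box: "\<bar>y i\<bar> \<le> R" if "f y \<le> t 0" "i \<in> I" for y i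
    unfolding R_def by (rule coercive_bound[OF I \<open>c > 0\<close> _ that(2)]) (use coercive[of y] that in linarith)
  have t0: "t n \<le> t 0" for n using dec by (simp add: decseq_def)
  have xbox: "\<bar>x n i\<bar> \<le> R" if "i \<in> I" for n i using box[of "x n" i] t0[of n] that by (simp add: t_def)
  from polyfun_common_lipschitz[of I Df R, OF I Df(1)] obtain L where L0: "L \<ge> 0" and
    "\<forall>i\<in>I. \<forall>y z. (\<forall>i\<in>I. \<bar>y i\<bar> \<le> R \<and> \<bar>z i\<bar> \<le> R) \<longrightarrow> \<bar>Df i y - Df i z\<bar> \<le> L * (\<Sum>i\<in>I. \<bar>y i - z i\<bar>)"
    by (elim exE conjE)
  note L = L0 this(2)[THEN bspec, THEN spec, THEN spec, THEN mp]
  define g where "g y = (\<Sum>i\<in>I. (Df i y)\<^sup>2)" for y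
  have g: "polyfun I g" unfolding g_def[abs_def] by (intro polyfun_intros Df)
  have g_nonneg: "0 \<le> g y" for y unfolding g_def by (intro sum_nonneg) auto
  from algebraic_talweg[OF I f g g_nonneg \<open>c > 0\<close> coercive]
  obtain q where q: "\<forall>i\<in>I. q i \<noteq> 0"
    "\<forall>z. \<exists>y. f y = f z \<and> g y \<le> g z \<and> (\<forall>i\<in>I. ev (q i) (f z) (y i) = 0)" by (elim exE conjE)
  \<comment> \<open>The margin 1 turns the bound by \<open>R\<close> into the strict inequality
    required of zeros.\<close>
  define Z where "Z i = {(t, s). \<bar>s\<bar> < R + 1 \<and> ev (q i) t s = 0}" for i
  have "\<exists>b>t'. \<exists>k col W B. bv_coloring_family t' b I Z k col W B"
    by (rule bv_coloring_family_exists[OF I]) (use q(1) bv_colorable_algebraic in \<open>auto simp: Z_def\<close>)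
  then obtain \<beta> k col W B where "\<beta> > t'" and "bv_coloring_family t' \<beta> I Z k col W B" by blast
  note bv = bv_coloring_familyD[OF this(2)]
  \<comment> \<open>\<open>card I + 1\<close> pays for passing from the sum of squares
    \<open>g\<close> back to single components, and the last summand 1 keeps \<open>K\<close>
    positive.\<close>
  define K where "K = (card I + 1) * (b + L + 1)"
  have K: "K > 0" unfolding K_def using \<open>b \<ge> 0\<close> L(1) by (intro mult_pos_pos) auto
  \<comment> \<open>Each level between two consecutive energies is attained on the segment between
    the iterates, where the gradient is O(\<open>\<Delta> n\<close>); the talweg point of that level
    has no larger \<open>g\<close>.\<close>
  have low_point: "\<exists>y. f y = s \<and> (\<forall>i\<in>I. \<bar>Df i y\<bar> \<le> K * \<Delta> n) \<and> (\<forall>i\<in>I. (s, y i) \<in> Z i) \<and> (\<forall>i\<in>I. \<bar>y i\<bar> \<le> R)"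
    if s: "t (Suc n) \<le> s" "s \<le> t n" for n s
  proof -
    let ?z = "\<lambda>\<theta> i. x (Suc n) i + \<theta> * (x n i - x (Suc n) i)"
    have "\<exists>\<theta>\<ge>0. \<theta> \<le> 1 \<and> f (?z \<theta>) = s"
    proof (rule IVT')
      show "continuous_on {0..1} (\<lambda>\<theta>. f (?z \<theta>))"
        by (intro continuous_at_imp_continuous_on ballI)
           (rule DERIV_isCont[OF Df(2)[unfolded has_gradient_def, rule_format]])
    qed (use s in \<open>auto simp: t_def\<close>)
    then obtain \<theta> where \<theta>: "0 \<le> \<theta>" "\<theta> \<le> 1" "f (?z \<theta>) = s" by blast
    have zbox: "\<bar>?z \<theta> i\<bar> \<le> R" if i: "i \<in> I" for i
    proof -
      have "?z \<theta> i = (1 - \<theta>) * x (Suc n) i + \<theta> * x n i" by (simp add: algebra_simps)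
      also have "\<bar>\<dots>\<bar> \<le> (1 - \<theta>) * \<bar>x (Suc n) i\<bar> + \<theta> * \<bar>x n i\<bar>"
        by (rule order_trans[OF abs_triangle_ineq]) (use \<theta> in \<open>simp add: abs_mult\<close>)
      also have "\<dots> \<le> (1 - \<theta>) * R + \<theta> * R"
        using \<theta> xbox[OF i] by (intro add_mono mult_left_mono) auto
      also have "\<dots> = R" by (simp add: left_diff_distrib)
      finally show ?thesis .
    qed
    have Dz: "\<bar>Df i (?z \<theta>)\<bar> \<le> (b + L + 1) * \<Delta> n" if i: "i \<in> I" for i
    proof -
      have "\<forall>i\<in>I. \<bar>?z \<theta> i\<bar> \<le> R \<and> \<bar>x (Suc n) i\<bar> \<le> R" using zbox xbox by blast
      from L(2)[OF i this]
      have "\<bar>Df i (?z \<theta>) - Df i (x (Suc n))\<bar> \<le> L * (\<Sum>i\<in>I. \<bar>?z \<theta> i - x (Suc n) i\<bar>)" .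
      also have "\<dots> \<le> L * \<Delta> n" unfolding \<Delta>_def
        using \<theta> L(1) by (intro mult_left_mono sum_mono) (auto simp: abs_mult abs_minus_commute intro: mult_left_le_one_le)
      finally have "\<bar>Df i (?z \<theta>) - Df i (x (Suc n))\<bar> \<le> L * \<Delta> n" .
      moreover have "\<bar>Df i (x (Suc n))\<bar> \<le> b * \<Delta> n" using gradient[OF i] by (simp add: \<Delta>_def)
      ultimately show ?thesis using \<Delta>[of n] unfolding distrib_right by linarith
    qed
    from q(2)[THEN spec, of "?z \<theta>", unfolded \<theta>(3)]
    obtain y where y: "f y = s" "g y \<le> g (?z \<theta>)" "\<forall>i\<in>I. ev (q i) s (y i) = 0" by (elim exE conjE)
    have X: "0 \<le> (b + L + 1) * \<Delta> n" using \<open>b \<ge> 0\<close> L(1) \<Delta>[of n] by simp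
    have "g (?z \<theta>) \<le> (\<Sum>i\<in>I. ((b + L + 1) * \<Delta> n)\<^sup>2)" unfolding g_def
    proof (rule sum_mono)
      fix i assume "i \<in> I"
      then show "(Df i (?z \<theta>))\<^sup>2 \<le> ((b + L + 1) * \<Delta> n)\<^sup>2"
        using Dz[of i] X abs_le_square_iff[of "Df i (?z \<theta>)" "(b + L + 1) * \<Delta> n"] by simp
    qed
    also have "\<dots> = card I * ((b + L + 1) * \<Delta> n)\<^sup>2" by simp
    also have "\<dots> \<le> (real (card I) + 1)\<^sup>2 * ((b + L + 1) * \<Delta> n)\<^sup>2"
      by (rule mult_right_mono[OF _ zero_le_power2]) (simp add: power2_eq_square algebra_simps)
    also have "\<dots> = (K * \<Delta> n)\<^sup>2" by (simp add: K_def power_mult_distrib mult.assoc add.commute)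
    finally have gz: "g (?z \<theta>) \<le> (K * \<Delta> n)\<^sup>2" .
    have "\<bar>Df i y\<bar> \<le> K * \<Delta> n" if i: "i \<in> I" for i
    proof -
      have "(Df i y)\<^sup>2 \<le> g y" unfolding g_def using I i by (intro member_le_sum) auto
      then have "(Df i y)\<^sup>2 \<le> (K * \<Delta> n)\<^sup>2" using y(2) gz by linarith
      moreover have "0 \<le> K * \<Delta> n" using K \<Delta>[of n] by simp
      ultimately show ?thesis using abs_le_square_iff[of "Df i y" "K * \<Delta> n"] by simp
    qed
    moreover have ybox: "\<bar>y i\<bar> \<le> R" if "i \<in> I" for i using box[of y i] y(1) s(2) t0[of n] that by simp
    moreover have "(s, y i) \<in> Z i" if "i \<in> I" for i using y(3) ybox[OF that] that by (auto simp: Z_def)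
    ultimately show ?thesis using y(1) by blast
  qed
  have step: "t n - t (Suc n) \<le> 4 * real k * (K * \<Delta> n) * (W (t n) - W (t (Suc n)))"
    if lt: "t' < t (Suc n)" "t (Suc n) < t n" "t n < \<beta>" and "\<Delta> n > 0" for n
  proof -
    \<comment> \<open>An arbitrary choice on each level; no regularity in \<open>s\<close> is
      required.\<close>
    define y where "y s = (SOME y. f y = s \<and> (\<forall>i\<in>I. \<bar>Df i y\<bar> \<le> K * \<Delta> n) \<and> (\<forall>i\<in>I. (s, y i) \<in> Z i) \<and> (\<forall>i\<in>I. \<bar>y i\<bar> \<le> R))" for s
    have y: "f (y s) = s \<and> (\<forall>i\<in>I. \<bar>Df i (y s)\<bar> \<le> K * \<Delta> n) \<and> (\<forall>i\<in>I. (s, y s i) \<in> Z i) \<and> (\<forall>i\<in>I. \<bar>y s i\<bar> \<le> R)"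
      if "t (Suc n) \<le> s" "s \<le> t n" for s
      unfolding y_def using low_point[OF that] by (rule someI_ex)
    have col: "col s (y s) < k" if "t (Suc n) \<le> s" "s \<le> t n" for s
      using bv(1) y[OF that] lt that by simp
    have "k > 0" using col[of "t n"] lt by simp
    have r: "K * \<Delta> n > 0" using K \<open>\<Delta> n > 0\<close> by simp
    show ?thesis
    proof (rule length_le_variation[OF lt(2) r L(1)])
      show "real k > 0" using \<open>k > 0\<close> by simp
      show "W u \<le> W v" if "t (Suc n) \<le> u" "u \<le> v" "v \<le> t n" for u v
        using bv(2) lt that by simp
      fix u v assume uv: "t (Suc n) \<le> u" "u < v" "v \<le> t n"
      \<comment> \<open>Two chosen points of equal colour are close in terms of \<open>W\<close>,
        while their levels differ by at least \<open>(v - u) / k\<close>.\<close>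
      have "\<exists>p p'. u \<le> p \<and> p < p' \<and> p' \<le> v \<and> col p (y p) = col p' (y p') \<and> (v - u) / k \<le> p' - p"
        by (rule pigeonhole_interval[OF uv(2)]) (use col uv in auto)
      then obtain p p' where p: "u \<le> p" "p < p'" "p' \<le> v" "col p (y p) = col p' (y p')" "(v - u) / k \<le> p' - p"
        by blast
      have yp: "f (y p) = p" "\<And>i. i \<in> I \<Longrightarrow> \<bar>Df i (y p)\<bar> \<le> K * \<Delta> n" "\<forall>i\<in>I. (p, y p i) \<in> Z i" "\<And>i. i \<in> I \<Longrightarrow> \<bar>y p i\<bar> \<le> R"
        using y[of p] p uv by auto
      have yp': "f (y p') = p'" "\<forall>i\<in>I. (p', y p' i) \<in> Z i" "\<And>i. i \<in> I \<Longrightarrow> \<bar>y p' i\<bar> \<le> R"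
        using y[of p'] p uv by auto
      let ?N = "\<Sum>i\<in>I. \<bar>y p' i - y p i\<bar>"
      have N0: "0 \<le> ?N" by (intro sum_nonneg) auto
      have "?N \<le> W p' - W p"
        using bv(4)[of p p' "y p" "y p'"] yp(3) yp'(2) p uv lt by simp
      moreover have "W u \<le> W p" "W p' \<le> W v" using bv(2) p uv lt by auto
      ultimately have N: "?N \<le> W v - W u" by linarith
      have "p' - p \<le> \<bar>f (y p') - f (y p)\<bar>" using yp(1) yp'(1) by simp
      also have "\<dots> \<le> (K * \<Delta> n + L * ?N) * ?N"
      proof (rule gradient_increment_bound[OF I Df(2) L(1), where R=R and x="y p" and y="y p'" and r="K * \<Delta> n"])
        show "\<bar>Df i v - Df i w\<bar> \<le> L * (\<Sum>i\<in>I. \<bar>v i - w i\<bar>)"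
          if "i \<in> I" "\<forall>i\<in>I. \<bar>v i\<bar> \<le> R \<and> \<bar>w i\<bar> \<le> R" for i v w using that by (rule L(2))
      qed (fact yp(4) yp'(3) yp(2))+
      also have "\<dots> \<le> (K * \<Delta> n + L * (W v - W u)) * (W v - W u)"
      proof (rule mult_mono)
        have "L * ?N \<le> L * (W v - W u)" using N L(1) by (rule mult_left_mono)
        then show "K * \<Delta> n + L * ?N \<le> K * \<Delta> n + L * (W v - W u)" by simp
        have "0 \<le> L * (W v - W u)" using N N0 L(1) by (intro mult_nonneg_nonneg) linarith+
        then show "0 \<le> K * \<Delta> n + L * (W v - W u)" using r by simp
      qed (use N N0 in auto)
      finally show "(v - u) / real k \<le> (K * \<Delta> n + L * (W v - W u)) * (W v - W u)" using p(5) by linarith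
    qed
  qed
  have t_eq: "\<Delta> n = 0" if "t n \<le> t (Suc n)" for n
  proof -
    have "a * (\<Delta> n)\<^sup>2 \<le> 0" using desc[of n] that by linarith
    then show ?thesis using \<open>a > 0\<close> by (simp add: mult_le_0_iff)
  qed
  show ?thesis
  \<comment> \<open>\<open>W\<close> is controlled only above the limit level; if that level is
    reached, all later increments vanish.\<close>
  proof (cases "\<exists>n. t n = t'")
    case True
    then obtain n where n: "t n = t'" ..
    have "\<Delta> m = 0" if "m \<ge> n" for m
    proof (rule t_eq)
      have "t m \<le> t n" using dec that by (simp add: decseq_def)
      then show "t m \<le> t (Suc m)" using t'(2)[of "Suc m"] n by linarith
    qed
    then have "summable (\<lambda>m. \<Delta> (m + n))" by simp
    then have "summable \<Delta>" by (simp only: summable_iff_shift[of \<Delta> n])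
    then show ?thesis unfolding \<Delta>_def[abs_def] .
  next
    case False
    then have gt: "t' < t n" for n using t'(2)[of n] by (metis order_le_less)
    have "\<forall>\<^sub>F n in sequentially. t n < \<beta>" using t'(1) \<open>\<beta> > t'\<close> by (rule order_tendstoD)
    then obtain n0 where n0: "\<And>n. n \<ge> n0 \<Longrightarrow> t n < \<beta>" by (auto simp: eventually_sequentially)
    define M where "M = 4 * real k * K / a"
    have bound: "\<Delta> n \<le> M * (W (t n) - W (t (Suc n)))" if "n \<ge> n0" for n
    proof (cases "\<Delta> n = 0")
      case True
      have "W (t (Suc n)) \<le> W (t n)" using bv(2) gt[of "Suc n"] n0[OF that] dec by (simp add: decseq_def)
      then show ?thesis using True K \<open>a > 0\<close> by (simp add: M_def)
    next
      case False
      then have pos: "\<Delta> n > 0" using \<Delta>[of n] by simp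
      then have "t (Suc n) < t n" using t_eq[of n] by linarith
      \<comment> \<open>One factor \<open>\<Delta> n\<close> cancels, leaving a bound by a
        telescoping difference of \<open>W\<close>.\<close>
      from step[OF gt this n0[OF that] pos] desc[of n]
      have "a * (\<Delta> n)\<^sup>2 \<le> 4 * real k * (K * \<Delta> n) * (W (t n) - W (t (Suc n)))" by linarith
      then have "\<Delta> n * (a * \<Delta> n) \<le> \<Delta> n * (4 * real k * K * (W (t n) - W (t (Suc n))))"
        by (simp add: power2_eq_square mult_ac)
      then have "a * \<Delta> n \<le> 4 * real k * K * (W (t n) - W (t (Suc n)))" using pos by simp
      then show ?thesis using \<open>a > 0\<close> by (simp add: M_def field_simps)
    qed
    have "summable (\<lambda>n. \<Delta> (n + n0))"
    proof (rule summableI_nonneg_bounded)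
      show "0 \<le> \<Delta> (n + n0)" for n by (rule \<Delta>)
      fix m
      have "(\<Sum>n<m. \<Delta> (n + n0)) \<le> (\<Sum>n<m. M * (W (t (n + n0)) - W (t (Suc n + n0))))"
        using bound by (intro sum_mono) simp
      also have "\<dots> = M * (W (t n0) - W (t (m + n0)))"
        unfolding sum_distrib_left[symmetric]
        using sum_lessThan_telescope'[of "\<lambda>n. W (t (n + n0))" m] by simp
      also have "\<dots> \<le> M * (2 * B)"
      proof (rule mult_left_mono)
        have "\<bar>W (t n0)\<bar> \<le> B" "\<bar>W (t (m + n0))\<bar> \<le> B" using bv(3) gt n0 by auto
        then show "W (t n0) - W (t (m + n0)) \<le> 2 * B" by linarith
        show "0 \<le> M" using K \<open>a > 0\<close> by (simp add: M_def)
      qed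
      finally show "(\<Sum>n<m. \<Delta> (n + n0)) \<le> M * (2 * B)" .
    qed
    then have "summable \<Delta>" by (simp only: summable_iff_shift[of \<Delta> n0])
    then show ?thesis unfolding \<Delta>_def[abs_def] .
  qed
qed

section \<open>Periodic grid functions\<close>

lemma tendsto_fun_iff:
  fixes f :: "'b \<Rightarrow> 'a \<Rightarrow> 'c::topological_space"
  shows "(f \<longlongrightarrow> l) F \<longleftrightarrow> (\<forall>x. ((\<lambda>n. f n x) \<longlongrightarrow> l x) F)"
proof -
  have "limitin euclidean f l F \<longleftrightarrow> (\<forall>x\<in>UNIV. limitin euclidean (\<lambda>n. f n x) (l x) F)"
    using limitin_componentwise[of "\<lambda>_. euclidean" UNIV f l F]
    unfolding euclidean_product_topology extensional_UNIV topspace_euclidean by (simp only: UNIV_I eventually_True simp_thms)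
  then show ?thesis by (simp only: limitin_canonical_iff ball_UNIV)
qed

lemma sum_int_shift:
  fixes f :: "int \<Rightarrow> real"
  assumes per: "\<And>k. f (k + int N) = f k"
  shows "(\<Sum>k=1..int N. f (k + c)) = (\<Sum>k=1..int N. f k)"
proof -
  have one: "(\<Sum>k=1..int N. g (k + 1)) = (\<Sum>k=1..int N. g k)" if "\<And>k. g (k + int N) = g k" for g :: "int \<Rightarrow> real"
  proof (cases "N = 0")
    case False
    have "(\<Sum>k=1..int N. g (k + 1)) = (\<Sum>k=2..int N + 1. g k)"
      by (rule sum.reindex_bij_witness[of _ "\<lambda>k. k - 1" "\<lambda>k. k + 1"]) auto
    also have "{2..int N + 1} = insert (int N + 1) {2..int N}" using False by auto
    also have "(\<Sum>k\<in>\<dots>. g k) = g (1 + int N) + (\<Sum>k=2..int N. g k)" by (simp add: add.commute)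
    also have "\<dots> = (\<Sum>k\<in>insert 1 {2..int N}. g k)" using that[of 1] by simp
    also have "insert 1 {2..int N} = {1..int N}" using False by auto
    finally show ?thesis .
  qed simp
  show ?thesis
  proof (induction c rule: int_induct[of _ 0])
    case (step1 i)
    have "(\<Sum>k=1..int N. f (k + (i + 1))) = (\<Sum>k=1..int N. f ((k + 1) + i))" by (simp add: add_ac)
    also have "\<dots> = (\<Sum>k=1..int N. f (k + i))"
    proof (rule one[of "\<lambda>k. f (k + i)"])
      show "f (k + int N + i) = f (k + i)" for k using per[of "k + i"] by (simp add: algebra_simps)
    qed
    finally show ?case using step1 by simp
  next
    case (step2 i)
    have "(\<Sum>k=1..int N. f (k + (i - 1))) = (\<Sum>k=1..int N. f ((k + 1) + (i - 1)))"
    proof (rule one[of "\<lambda>k. f (k + (i - 1))", symmetric])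
      show "f (k + int N + (i - 1)) = f (k + (i - 1))" for k
        using per[of "k + (i - 1)"] by (simp add: algebra_simps)
    qed
    then show ?case using step2 by simp
  qed simp
qed

lemma sum_int_reflect:
  fixes f :: "int \<Rightarrow> real"
  assumes per: "\<And>k. f (k + int N) = f k"
  shows "(\<Sum>k=1..int N. f (c - k)) = (\<Sum>k=1..int N. f k)"
proof -
  have "(\<Sum>k=1..int N. f (c - k)) = (\<Sum>k=1..int N. f (k + (c - int N - 1)))"
    by (rule sum.reindex_bij_witness[of _ "\<lambda>k. int N + 1 - k" "\<lambda>k. int N + 1 - k"]) (auto simp: algebra_simps)
  also have "\<dots> = (\<Sum>k=1..int N. f k)" by (rule sum_int_shift) (rule per)
  finally show ?thesis .
qed

text \<open>Summation by parts; periodicity removes the boundary terms.\<close>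

lemma sum_by_parts_periodic:
  fixes f :: "int \<Rightarrow> real"
  assumes per: "\<And>k. f (k + int N) = f k"
  shows "(\<Sum>k=1..int N. f k * (f (k + 1) + f (k - 1) - 2 * f k)) = - (\<Sum>k=1..int N. (f (k + 1) - f k)\<^sup>2)"
proof -
  let ?g = "\<lambda>k. f k * (f k - f (k - 1))"
  have "?g (k + int N) = ?g k" for k using per[of k] per[of "k - 1"] by (simp add: algebra_simps)
  from sum_int_shift[of ?g, OF this, of 1] have
    s: "(\<Sum>k=1..int N. f k * (f k - f (k - 1))) = (\<Sum>k=1..int N. f (k + 1) * (f (k + 1) - f k))" by simp
  have "(\<Sum>k=1..int N. f k * (f (k + 1) + f (k - 1) - 2 * f k))
      = (\<Sum>k=1..int N. f k * (f (k + 1) - f k)) - (\<Sum>k=1..int N. f k * (f k - f (k - 1)))"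
    by (simp add: sum_subtractf[symmetric] algebra_simps)
  also have "\<dots> = - (\<Sum>k=1..int N. (f (k + 1) - f k)\<^sup>2)"
    unfolding s by (simp add: sum_subtractf[symmetric] sum_negf[symmetric] power2_eq_square algebra_simps)
  finally show ?thesis .
qed

lemma abs_diff_le_sum_increments:
  fixes f :: "int \<Rightarrow> real"
  assumes "a \<in> {1..int N}" "b \<in> {1..int N}"
  shows "\<bar>f b - f a\<bar> \<le> (\<Sum>k=1..int N. \<bar>f (k + 1) - f k\<bar>)"
proof -
  have le: "\<bar>f b - f a\<bar> \<le> (\<Sum>k=a..<b. \<bar>f (k + 1) - f k\<bar>)" if "a \<le> b" for a b
    using that
  proof (induction b rule: int_ge_induct)
    case (step b)
    have "{a..<b + 1} = insert b {a..<b}" using step by auto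
    then show ?case using step by (simp add: abs_if split: if_splits)
  qed simp
  have sub: "(\<Sum>k=a..<b. \<bar>f (k + 1) - f k\<bar>) \<le> (\<Sum>k=1..int N. \<bar>f (k + 1) - f k\<bar>)"
    if "a \<in> {1..int N}" "b \<in> {1..int N}" for a b
    using that by (intro sum_mono2) auto
  show ?thesis
  proof (cases "a \<le> b")
    case True
    then show ?thesis using le[OF True] sub[OF assms] by linarith
  next
    case False
    then show ?thesis using le[of b a] sub[OF assms(2,1)] by (simp add: abs_minus_commute)
  qed
qed

section \<open>Summation by parts and a discrete Poincare inequality\<close>

definition grid_points :: "nat \<Rightarrow> (int \<times> int) set" where
  "grid_points N = {1..int N} \<times> {1..int N}"

lemma finite_grid_points [simp]: "finite (grid_points N)" by (simp add: grid_points_def)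

lemma sum_grid_points: "(\<Sum>p\<in>grid_points N. f p) = (\<Sum>i=1..int N. \<Sum>j=1..int N. f (i, j))"
  by (simp add: grid_points_def sum.cartesian_product)

lemma grid_space_periodic:
  assumes "\<phi> \<in> grid_space N"
  shows "\<phi> (i + int N) j = \<phi> i j" "\<phi> i (j + int N) = \<phi> i j"
  using assms by (auto simp: grid_space_def)

text \<open>Representatives run from 1 to \<open>N\<close>, hence the shifts by 1 around
  \<open>mod\<close>.\<close>

lemma grid_space_mod:
  assumes "\<phi> \<in> grid_space N"
  shows "\<phi> i j = \<phi> (1 + (i - 1) mod int N) (1 + (j - 1) mod int N)"
proof -
  have shift: "\<psi> (x + k * int N) = \<psi> x" if "\<And>x. \<psi> (x + int N) = \<psi> x" for \<psi> :: "int \<Rightarrow> real" and x k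
  proof (induction k rule: int_induct[of _ 0])
    case (step1 k)
    then show ?case using that[of "x + k * int N"] by (simp add: algebra_simps)
  next
    case (step2 k)
    then show ?case using that[of "x + (k - 1) * int N"] by (simp add: algebra_simps)
  qed simp
  have mod: "x = 1 + (x - 1) mod int N + ((x - 1) div int N) * int N" for x
    using div_mult_mod_eq[of "x - 1" "int N"] by simp
  have "\<phi> i j = \<phi> (1 + (i - 1) mod int N) j"
    by (subst mod[of i]) (rule shift[of "\<lambda>i. \<phi> i j"], rule grid_space_periodic(1)[OF assms])
  also have "\<dots> = \<phi> (1 + (i - 1) mod int N) (1 + (j - 1) mod int N)"
    by (subst mod[of j]) (rule shift, rule grid_space_periodic(2)[OF assms])
  finally show ?thesis .
qed

lemma mod_in_range:
  assumes "N \<ge> 1"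
  shows "1 + (i - 1) mod int N \<in> {1..int N}"
proof -
  have "0 < int N" using assms by simp
  from pos_mod_bound[OF this, of "i - 1"] pos_mod_sign[OF this, of "i - 1"]
  show ?thesis unfolding atLeastAtMost_iff by linarith
qed

text \<open>The Dirichlet energy without the factor 1 / (h * h); the differences at index
  \<open>N\<close> wrap around by periodicity.\<close>

definition edge_energy :: "nat \<Rightarrow> grid \<Rightarrow> real" where
  "edge_energy N \<phi> = (\<Sum>i=1..int N. \<Sum>j=1..int N. (\<phi> (i + 1) j - \<phi> i j)\<^sup>2 + (\<phi> i (j + 1) - \<phi> i j)\<^sup>2)"

definition edge_variation :: "nat \<Rightarrow> grid \<Rightarrow> real" where
  "edge_variation N \<phi> = (\<Sum>i=1..int N. \<Sum>j=1..int N. \<bar>\<phi> (i + 1) j - \<phi> i j\<bar> + \<bar>\<phi> i (j + 1) - \<phi> i j\<bar>)"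

lemma sum_lap_zero:
  assumes \<phi>: "\<phi> \<in> grid_space N"
  shows "(\<Sum>i=1..int N. \<Sum>j=1..int N. lap h \<phi> i j) = 0"
proof -
  have i: "(\<Sum>i=1..int N. \<phi> (i + c) j) = (\<Sum>i=1..int N. \<phi> i j)" for c j
    by (rule sum_int_shift) (rule grid_space_periodic(1)[OF \<phi>])
  have j: "(\<Sum>j=1..int N. \<phi> i (j + c)) = (\<Sum>j=1..int N. \<phi> i j)" for c i
    by (rule sum_int_shift) (rule grid_space_periodic(2)[OF \<phi>])
  have "(\<Sum>i=1..int N. \<Sum>j=1..int N. \<phi> (i + c) j) = (\<Sum>i=1..int N. \<Sum>j=1..int N. \<phi> i j)" for c
    by (subst (1 2) sum.swap) (simp add: i)
  from this[of 1] this[of "-1"] show ?thesis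
    using j[where c=1] j[where c="-1"]
    by (simp add: lap_def sum_divide_distrib[symmetric] sum.distrib sum_subtractf sum_distrib_left[symmetric])
qed

lemma inner_lap:
  assumes \<phi>: "\<phi> \<in> grid_space N"
  shows "(\<Sum>i=1..int N. \<Sum>j=1..int N. \<phi> i j * lap h \<phi> i j) = - edge_energy N \<phi> / h\<^sup>2"
proof -
  have i: "(\<Sum>i=1..int N. \<phi> i j * (\<phi> (i + 1) j + \<phi> (i - 1) j - 2 * \<phi> i j)) = - (\<Sum>i=1..int N. (\<phi> (i + 1) j - \<phi> i j)\<^sup>2)" for j
    by (rule sum_by_parts_periodic) (rule grid_space_periodic(1)[OF \<phi>])
  have j: "(\<Sum>j=1..int N. \<phi> i j * (\<phi> i (j + 1) + \<phi> i (j - 1) - 2 * \<phi> i j)) = - (\<Sum>j=1..int N. (\<phi> i (j + 1) - \<phi> i j)\<^sup>2)" for i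
    by (rule sum_by_parts_periodic) (rule grid_space_periodic(2)[OF \<phi>])
  have pt: "\<phi> i j * lap h \<phi> i j = (\<phi> i j * (\<phi> (i + 1) j + \<phi> (i - 1) j - 2 * \<phi> i j)
      + \<phi> i j * (\<phi> i (j + 1) + \<phi> i (j - 1) - 2 * \<phi> i j)) / h\<^sup>2" for i j
    by (simp add: lap_def algebra_simps)
  have "(\<Sum>i=1..int N. \<Sum>j=1..int N. \<phi> i j * lap h \<phi> i j)
    = ((\<Sum>i=1..int N. \<Sum>j=1..int N. \<phi> i j * (\<phi> (i + 1) j + \<phi> (i - 1) j - 2 * \<phi> i j))
     + (\<Sum>i=1..int N. \<Sum>j=1..int N. \<phi> i j * (\<phi> i (j + 1) + \<phi> i (j - 1) - 2 * \<phi> i j))) / h\<^sup>2"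
    by (simp only: pt sum_divide_distrib[symmetric] sum.distrib)
  also have "(\<Sum>i=1..int N. \<Sum>j=1..int N. \<phi> i j * (\<phi> (i + 1) j + \<phi> (i - 1) j - 2 * \<phi> i j))
     = - (\<Sum>i=1..int N. \<Sum>j=1..int N. (\<phi> (i + 1) j - \<phi> i j)\<^sup>2)"
    by (subst (1 2) sum.swap) (simp add: i sum_negf)
  also have "(\<Sum>i=1..int N. \<Sum>j=1..int N. \<phi> i j * (\<phi> i (j + 1) + \<phi> i (j - 1) - 2 * \<phi> i j))
     = - (\<Sum>i=1..int N. \<Sum>j=1..int N. (\<phi> i (j + 1) - \<phi> i j)\<^sup>2)"
    by (simp add: j sum_negf)
  finally show ?thesis by (simp add: edge_energy_def sum.distrib)
qed

text \<open>Two grid points are joined by a path along one line in each coordinate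
  direction.\<close>

lemma osc_le_edge_variation:
  assumes "p \<in> grid_points N" "q \<in> grid_points N"
  shows "\<bar>\<phi> (fst p) (snd p) - \<phi> (fst q) (snd q)\<bar> \<le> edge_variation N \<phi>"
proof -
  obtain i j where p: "p = (i, j)" "i \<in> {1..int N}" "j \<in> {1..int N}" using assms by (auto simp: grid_points_def)
  obtain i' j' where q: "q = (i', j')" "i' \<in> {1..int N}" "j' \<in> {1..int N}" using assms by (auto simp: grid_points_def)
  have "\<bar>\<phi> i j - \<phi> i' j\<bar> \<le> (\<Sum>k=1..int N. \<bar>\<phi> (k + 1) j - \<phi> k j\<bar>)"
    by (rule abs_diff_le_sum_increments[of _ N _ "\<lambda>i. \<phi> i j"]) (use p q in auto)
  also have "\<dots> \<le> (\<Sum>k=1..int N. \<Sum>j=1..int N. \<bar>\<phi> (k + 1) j - \<phi> k j\<bar>)"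
    using p by (intro sum_mono member_le_sum[of j _ "\<lambda>j. \<bar>\<phi> (_ + 1) j - \<phi> _ j\<bar>"]) auto
  finally have 1: "\<bar>\<phi> i j - \<phi> i' j\<bar> \<le> (\<Sum>k=1..int N. \<Sum>j=1..int N. \<bar>\<phi> (k + 1) j - \<phi> k j\<bar>)" .
  have "\<bar>\<phi> i' j - \<phi> i' j'\<bar> \<le> (\<Sum>k=1..int N. \<bar>\<phi> i' (k + 1) - \<phi> i' k\<bar>)"
    by (rule abs_diff_le_sum_increments) (use p q in auto)
  also have "\<dots> \<le> (\<Sum>i=1..int N. \<Sum>k=1..int N. \<bar>\<phi> i (k + 1) - \<phi> i k\<bar>)"
    using q by (intro member_le_sum[of i' _ "\<lambda>i. \<Sum>k=1..int N. \<bar>\<phi> i (k + 1) - \<phi> i k\<bar>"]) (auto intro: sum_nonneg)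
  finally show ?thesis using 1 by (simp add: p q edge_variation_def sum.distrib)
qed

lemma edge_variation_squared_le: "(edge_variation N \<phi>)\<^sup>2 \<le> 2 * card (grid_points N) * edge_energy N \<phi>"
proof -
  let ?a = "\<lambda>p. \<bar>\<phi> (fst p + 1) (snd p) - \<phi> (fst p) (snd p)\<bar>" and ?b = "\<lambda>p. \<bar>\<phi> (fst p) (snd p + 1) - \<phi> (fst p) (snd p)\<bar>"
  have "(edge_variation N \<phi>)\<^sup>2 = (\<Sum>p\<in>grid_points N. ?a p + ?b p)\<^sup>2"
    by (simp add: edge_variation_def sum_grid_points)
  also have "\<dots> \<le> (\<Sum>p\<in>grid_points N. (?a p + ?b p)\<^sup>2) * card (grid_points N)"
    by (rule sum_squared_le_sum_of_squares)
  also have "\<dots> \<le> (\<Sum>p\<in>grid_points N. 2 * ((?a p)\<^sup>2 + (?b p)\<^sup>2)) * card (grid_points N)"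
  proof (intro mult_right_mono sum_mono)
    fix p show "(?a p + ?b p)\<^sup>2 \<le> 2 * ((?a p)\<^sup>2 + (?b p)\<^sup>2)"
      using sum_squares_bound[of "?a p" "?b p"] by (simp add: power2_sum)
  qed simp
  also have "\<dots> = 2 * card (grid_points N) * edge_energy N \<phi>"
    unfolding edge_energy_def sum_grid_points
    by (simp only: sum_distrib_left[symmetric] mult_ac fst_conv snd_conv power2_abs)
  finally show ?thesis .
qed

text \<open>Cauchy-Schwarz bounds the square of the variation by the energy, and summation by parts
  bounds the energy by the variation times the Laplacian; one factor of the variation
  cancels.\<close>

lemma poincare_lap:
  fixes h :: real and \<delta> :: "int \<times> int \<Rightarrow> real"
  assumes \<phi>: "\<phi> \<in> grid_space N" and h: "h > 0" and N: "N \<ge> 1"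
    and \<delta>: "\<And>i j. lap h \<phi> i j = \<delta> (i, j)"
  shows "edge_variation N \<phi> \<le> 2 * card (grid_points N) * h\<^sup>2 * (\<Sum>p\<in>grid_points N. \<bar>\<delta> p\<bar>)"
proof -
  let ?I = "grid_points N" and ?V = "edge_variation N \<phi>" and ?\<phi> = "\<lambda>p. \<phi> (fst p) (snd p)"
  have V: "?V \<ge> 0" unfolding edge_variation_def by (intro sum_nonneg) auto
  have q: "(1, 1) \<in> ?I" using N by (simp add: grid_points_def)
  have zero: "(\<Sum>p\<in>?I. \<delta> p) = 0" using sum_lap_zero[OF \<phi>, of h] by (simp add: sum_grid_points \<delta>)
  have "edge_energy N \<phi> = - h\<^sup>2 * (\<Sum>p\<in>?I. ?\<phi> p * \<delta> p)"
    using inner_lap[OF \<phi>, of h] h by (simp add: sum_grid_points \<delta> field_simps)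
  \<comment> \<open>As \<delta> has sum zero, a constant may be subtracted from \<phi>, leaving only
    its oscillation.\<close>
  also have "(\<Sum>p\<in>?I. ?\<phi> p * \<delta> p) = (\<Sum>p\<in>?I. (?\<phi> p - \<phi> 1 1) * \<delta> p)"
    using zero by (simp add: left_diff_distrib sum_subtractf sum_distrib_left[symmetric])
  also have "- h\<^sup>2 * \<dots> \<le> h\<^sup>2 * (\<Sum>p\<in>?I. ?V * \<bar>\<delta> p\<bar>)"
  proof -
    have "- (\<Sum>p\<in>?I. (?\<phi> p - \<phi> 1 1) * \<delta> p) \<le> \<bar>\<Sum>p\<in>?I. (?\<phi> p - \<phi> 1 1) * \<delta> p\<bar>" by simp
    also have "\<dots> \<le> (\<Sum>p\<in>?I. ?V * \<bar>\<delta> p\<bar>)"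
      using osc_le_edge_variation[OF _ q, of _ \<phi>]
      by (intro order_trans[OF sum_abs] sum_mono) (auto simp: abs_mult intro!: mult_right_mono)
    finally have "h\<^sup>2 * - (\<Sum>p\<in>?I. (?\<phi> p - \<phi> 1 1) * \<delta> p) \<le> h\<^sup>2 * (\<Sum>p\<in>?I. ?V * \<bar>\<delta> p\<bar>)"
      by (rule mult_left_mono) simp
    then show ?thesis by simp
  qed
  finally have E: "edge_energy N \<phi> \<le> h\<^sup>2 * (?V * (\<Sum>p\<in>?I. \<bar>\<delta> p\<bar>))" by (simp add: sum_distrib_left)
  have "?V\<^sup>2 \<le> 2 * card ?I * edge_energy N \<phi>" by (rule edge_variation_squared_le)
  also have "\<dots> \<le> 2 * card ?I * (h\<^sup>2 * (?V * (\<Sum>p\<in>?I. \<bar>\<delta> p\<bar>)))" using E by (intro mult_left_mono) auto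
  finally have "?V * ?V \<le> ?V * (2 * card ?I * h\<^sup>2 * (\<Sum>p\<in>?I. \<bar>\<delta> p\<bar>))" by (simp add: power2_eq_square mult_ac)
  moreover have "0 \<le> 2 * card ?I * h\<^sup>2 * (\<Sum>p\<in>?I. \<bar>\<delta> p\<bar>)" by (intro mult_nonneg_nonneg sum_nonneg) auto
  ultimately show ?thesis using V by (cases "?V = 0") auto
qed

section \<open>The convex splitting scheme\<close>

locale convex_splitting_scheme =
  fixes L h \<epsilon> \<tau> :: real and N :: nat and J :: "real \<times> real \<Rightarrow> real" and u \<omega> :: "nat \<Rightarrow> grid"
  assumes L: "L > 0" and N: "N \<ge> 1" and h: "h = L / real N"
    and J_periodic: "\<And>x y. J (x + L, y) = J (x, y)" "\<And>x y. J (x, y + L) = J (x, y)"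
    and J_even: "\<And>x. J (- x) = J x"
    and gamma0: "\<epsilon>\<^sup>2 * conv_one h N J - 1 > 0"
    and splitting: "convex_splitting h N J \<epsilon>"
    and \<tau>: "\<tau> > 0"
    and u_grid: "\<And>n. u n \<in> grid_space N"
    and \<omega>_grid: "\<And>n. \<omega> n \<in> grid_space N"
    and scheme_u: "\<And>n i j. (u (Suc n) i j - u n i j) / \<tau> = lap h (\<omega> (Suc n)) i j"
    and scheme_\<omega>: "\<And>n i j. \<omega> (Suc n) i j =
          (u (Suc n) i j) ^ 3 + 2 * \<epsilon>\<^sup>2 * conv_one h N J * u (Suc n) i j
          - u n i j - \<epsilon>\<^sup>2 * conv_one h N J * u n i j - \<epsilon>\<^sup>2 * conv h N J (u n) i j"
begin

abbreviation "I \<equiv> grid_points N"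

section \<open>The scheme as a descent method on finitely many coordinates\<close>

definition "kern p q = h\<^sup>2 * J (of_int (fst p - fst q) * h, of_int (snd p - snd q) * h)"

definition "kern_op y p = (\<Sum>q\<in>I. kern p q * y q)"

definition "\<alpha> = \<epsilon>\<^sup>2 * conv_one h N J"

definition "flat \<phi> = (\<lambda>p. \<phi> (fst p) (snd p))" for \<phi> :: grid

text \<open>For periodic grid functions this is \<open>energy\<close> divided by h * h, without the
  additive constant \<open>card I / 4\<close>.\<close>

definition "flat_energy y = (\<Sum>p\<in>I. 1/4 * y p ^ 4 + (\<alpha> - 1) / 2 * (y p)\<^sup>2) - \<epsilon>\<^sup>2 / 2 * (\<Sum>p\<in>I. y p * kern_op y p)"

lemma h_pos: "h > 0" using L N h by simp

lemma Nh: "real N * h = L" using N h by simp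

lemma I_nonempty: "I \<noteq> {}" "card I > 0"
proof -
  have "(1, 1) \<in> I" using N by (simp add: grid_points_def)
  then show "I \<noteq> {}" by auto
  then show "card I > 0" by (simp add: card_gt_0_iff)
qed

lemma \<alpha>_gt_1: "\<alpha> > 1" using gamma0 by (simp add: \<alpha>_def)

lemma kern_sym: "kern p q = kern q p"
proof -
  have "(of_int (fst p - fst q) * h, of_int (snd p - snd q) * h) = - (of_int (fst q - fst p) * h, of_int (snd q - snd p) * h)"
    by (simp add: algebra_simps)
  then show ?thesis unfolding kern_def using J_even by metis
qed

text \<open>The summand is periodic in both indices, so reflecting them turns the convolution into a
  matrix acting on the values at the grid points.\<close>

lemma conv_eq_kern_op:
  assumes \<phi>: "\<phi> \<in> grid_space N"
  shows "conv h N J \<phi> i j = kern_op (flat \<phi>) (i, j)"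
proof -
  define F where "F a b = J (of_int a * h, of_int b * h) * \<phi> (i - a) (j - b)" for a b
  have F1: "F (a + int N) b = F a b" for a b
  proof -
    have "J (of_int (a + int N) * h, of_int b * h) = J (of_int a * h, of_int b * h)"
      using J_periodic(1)[of "of_int a * h" "of_int b * h"] Nh by (simp add: algebra_simps)
    moreover have "\<phi> (i - (a + int N)) (j - b) = \<phi> (i - a) (j - b)"
      using grid_space_periodic(1)[OF \<phi>, of "i - (a + int N)" "j - b"] by (simp add: algebra_simps)
    ultimately show ?thesis by (simp add: F_def)
  qed
  have F2: "F a (b + int N) = F a b" for a b
  proof -
    have "J (of_int a * h, of_int (b + int N) * h) = J (of_int a * h, of_int b * h)"
      using J_periodic(2)[of "of_int a * h" "of_int b * h"] Nh by (simp add: algebra_simps)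
    moreover have "\<phi> (i - a) (j - (b + int N)) = \<phi> (i - a) (j - b)"
      using grid_space_periodic(2)[OF \<phi>, of "i - a" "j - (b + int N)"] by (simp add: algebra_simps)
    ultimately show ?thesis by (simp add: F_def)
  qed
  have "conv h N J \<phi> i j = h\<^sup>2 * (\<Sum>k=1..int N. \<Sum>l=1..int N. F k l)" by (simp add: conv_def F_def)
  also have "(\<Sum>k=1..int N. \<Sum>l=1..int N. F k l) = (\<Sum>k=1..int N. \<Sum>l=1..int N. F (i - k) l)"
    by (rule sum_int_reflect[of "\<lambda>k. \<Sum>l=1..int N. F k l", symmetric]) (simp add: F1)
  also have "\<dots> = (\<Sum>k=1..int N. \<Sum>l=1..int N. F (i - k) (j - l))"
    by (intro sum.cong refl sum_int_reflect[symmetric] F2)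
  finally show ?thesis
    by (simp add: kern_op_def kern_def flat_def sum_grid_points F_def sum_distrib_left mult.assoc)
qed

lemma grid_inner_flat: "grid_inner N \<phi> \<psi> = (\<Sum>p\<in>I. flat \<phi> p * flat \<psi> p)"
  by (simp add: grid_inner_def sum_grid_points flat_def)

text \<open>\<open>energy_e\<close> is a quadratic form; its convexity between \<phi> and - \<phi>,
  whose midpoint is 0, gives nonnegativity. This is how the splitting hypothesis enters.\<close>

lemma explicit_part_nonneg:
  assumes \<phi>: "\<phi> \<in> grid_space N"
  shows "0 \<le> (1 + \<alpha>) * (\<Sum>p\<in>I. (flat \<phi> p)\<^sup>2) + \<epsilon>\<^sup>2 * (\<Sum>p\<in>I. flat \<phi> p * kern_op (flat \<phi>) p)"
proof -
  let ?m = "\<lambda>i j. - \<phi> i j" and ?z = "\<lambda>i j. 0 :: real"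
  have m: "?m \<in> grid_space N" using \<phi> by (simp add: grid_space_def)
  have conv: "grid_convex N (energy_e h N J \<epsilon>)" using splitting by (simp add: convex_splitting_def)
  have "energy_e h N J \<epsilon> (\<lambda>i j. (1 - 1/2) * \<phi> i j + 1/2 * ?m i j)
      \<le> (1 - 1/2) * energy_e h N J \<epsilon> \<phi> + 1/2 * energy_e h N J \<epsilon> ?m"
    using conv[unfolded grid_convex_def, rule_format, OF \<phi> m, of "1/2"] by simp
  moreover have "energy_e h N J \<epsilon> ?m = energy_e h N J \<epsilon> \<phi>"
    by (simp add: energy_e_def grid_inner_def conv_def sum_negf)
  moreover have "(\<lambda>i j. (1 - 1/2) * \<phi> i j + 1/2 * ?m i j) = ?z" by (simp add: fun_eq_iff)
  moreover have "energy_e h N J \<epsilon> ?z = 0" by (simp add: energy_e_def grid_inner_def conv_def)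
  ultimately have "0 \<le> energy_e h N J \<epsilon> \<phi>" by simp
  then have "0 \<le> (1 + \<epsilon>\<^sup>2 * conv_one h N J) / 2 * grid_inner N \<phi> \<phi> + \<epsilon>\<^sup>2 / 2 * grid_inner N \<phi> (conv h N J \<phi>)"
    using h_pos by (simp add: energy_e_def zero_le_mult_iff)
  also have "grid_inner N \<phi> \<phi> = (\<Sum>p\<in>I. (flat \<phi> p)\<^sup>2)" by (simp add: grid_inner_flat power2_eq_square)
  also have "grid_inner N \<phi> (conv h N J \<phi>) = (\<Sum>p\<in>I. flat \<phi> p * kern_op (flat \<phi>) p)"
    unfolding grid_inner_flat using conv_eq_kern_op[OF \<phi>] by (intro sum.cong) (auto simp: flat_def)
  finally have "0 \<le> (1 + \<alpha>) / 2 * (\<Sum>p\<in>I. (flat \<phi> p)\<^sup>2) + \<epsilon>\<^sup>2 / 2 * (\<Sum>p\<in>I. flat \<phi> p * kern_op (flat \<phi>) p)"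
    unfolding \<alpha>_def .
  moreover have "(1 + \<alpha>) * A + \<epsilon>\<^sup>2 * B = 2 * ((1 + \<alpha>) / 2 * A + \<epsilon>\<^sup>2 / 2 * B)" for A B
    by (simp add: field_simps)
  ultimately show ?thesis by simp
qed

lemma kern_op_add: "kern_op (\<lambda>q. x q + y q) p = kern_op x p + kern_op y p"
  by (simp add: kern_op_def distrib_left sum.distrib)

lemma kern_op_scale: "kern_op (\<lambda>q. c * y q) p = c * kern_op y p"
  by (simp add: kern_op_def sum_distrib_left mult_ac)

lemma kern_op_swap: "(\<Sum>p\<in>I. x p * kern_op y p) = (\<Sum>p\<in>I. y p * kern_op x p)"
proof -
  have "(\<Sum>p\<in>I. x p * kern_op y p) = (\<Sum>p\<in>I. \<Sum>q\<in>I. kern q p * x p * y q)"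
    by (intro sum.cong refl) (auto simp: kern_op_def sum_distrib_left kern_sym[of _ "fst _"] mult_ac intro!: sum.cong kern_sym)
  also have "\<dots> = (\<Sum>q\<in>I. \<Sum>p\<in>I. kern q p * x p * y q)" by (rule sum.swap)
  also have "\<dots> = (\<Sum>p\<in>I. y p * kern_op x p)"
    by (simp add: kern_op_def sum_distrib_left mult_ac)
  finally show ?thesis .
qed

definition "y n = flat (u n)"

definition "\<delta> n p = y (Suc n) p - y n p"

lemma scheme_lap: "lap h (\<omega> (Suc n)) i j = \<delta> n (i, j) / \<tau>"
  using scheme_u[of n i j] by (simp add: \<delta>_def y_def flat_def)

lemma scheme_potential:
  "flat (\<omega> (Suc n)) p = y (Suc n) p ^ 3 + 2 * \<alpha> * y (Suc n) p - (1 + \<alpha>) * y n p - \<epsilon>\<^sup>2 * kern_op (y n) p"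
  using scheme_\<omega>[of n "fst p" "snd p"] conv_eq_kern_op[OF u_grid, of n "fst p" "snd p"]
  by (simp add: \<alpha>_def y_def flat_def algebra_simps)

lemma sum_\<delta>: "(\<Sum>p\<in>I. \<delta> n p) = 0"
  using sum_lap_zero[OF \<omega>_grid[of "Suc n"], of h] \<tau>
  by (simp add: scheme_lap sum_grid_points sum_divide_distrib[symmetric])

lemma mass: "(\<Sum>p\<in>I. y n p) = (\<Sum>p\<in>I. y 0 p)"
proof (induction n)
  case (Suc n)
  then show ?case using sum_\<delta>[of n] by (simp add: \<delta>_def sum_subtractf)
qed simp

text \<open>The increment is \<tau> times the Laplacian of the new potential, and the Laplacian is
  negative semidefinite.\<close>

lemma potential_increment: "(\<Sum>p\<in>I. flat (\<omega> (Suc n)) p * \<delta> n p) \<le> 0"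
proof -
  have "(\<Sum>p\<in>I. flat (\<omega> (Suc n)) p * \<delta> n p) = \<tau> * (\<Sum>i=1..int N. \<Sum>j=1..int N. \<omega> (Suc n) i j * lap h (\<omega> (Suc n)) i j)"
    using \<tau> by (simp add: scheme_lap sum_grid_points flat_def sum_distrib_left)
  also have "\<dots> = \<tau> * (- edge_energy N (\<omega> (Suc n)) / h\<^sup>2)" by (simp add: inner_lap[OF \<omega>_grid])
  also have "\<dots> \<le> 0"
  proof -
    have "0 \<le> edge_energy N (\<omega> (Suc n))" unfolding edge_energy_def by (intro sum_nonneg) auto
    then show ?thesis using \<tau> by (simp add: mult_le_0_iff)
  qed
  finally show ?thesis .
qed

lemma quartic_convex: "b ^ 4 / 4 + b ^ 3 * (a - b) \<le> a ^ 4 / (4::real)"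
proof -
  have "a ^ 4 / 4 - (b ^ 4 / 4 + b ^ 3 * (a - b)) = (a - b)\<^sup>2 * ((a + b)\<^sup>2 + 2 * b\<^sup>2) / 4"
    by (simp add: power2_eq_square power3_eq_cube power4_eq_xxxx field_simps)
  moreover have "0 \<le> (a - b)\<^sup>2 * ((a + b)\<^sup>2 + 2 * b\<^sup>2) / 4" by simp
  ultimately show ?thesis by linarith
qed

text \<open>Convexity of the quartic handles the cubic term, and the quadratic terms are expanded
  exactly. Nonnegativity of the explicit part costs \<open>(1 + \<alpha>) / 2\<close> of the
  coefficient \<open>(3 * \<alpha> + 1) / 2\<close>; what remains is \<alpha> > 1.\<close>

lemma energy_descent: "(\<Sum>p\<in>I. (\<delta> n p)\<^sup>2) \<le> flat_energy (y n) - flat_energy (y (Suc n))"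
proof -
  let ?a = "y n" and ?b = "y (Suc n)" and ?d = "\<delta> n" and ?w = "flat (\<omega> (Suc n))"
  have b: "?b = (\<lambda>p. ?a p + ?d p)" by (simp add: \<delta>_def fun_eq_iff)
  define S where "S x z = (\<Sum>p\<in>I. x p * kern_op z p)" for x z
  have Sbb: "S ?b ?b = S ?a ?a + 2 * S ?d ?a + S ?d ?d"
  proof -
    have "S ?b ?b = S ?a ?a + S ?a ?d + S ?d ?a + S ?d ?d"
      unfolding S_def b kern_op_add by (simp add: algebra_simps sum.distrib)
    then show ?thesis using kern_op_swap[of ?a ?d] by (simp add: S_def)
  qed
  have w: "(\<Sum>p\<in>I. ?w p * ?d p) = (\<Sum>p\<in>I. (?b p ^ 3 + 2 * \<alpha> * ?b p - (1 + \<alpha>) * ?a p) * ?d p) - \<epsilon>\<^sup>2 * S ?d ?a"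
  proof -
    have "?w p * ?d p = (?b p ^ 3 + 2 * \<alpha> * ?b p - (1 + \<alpha>) * ?a p) * ?d p - \<epsilon>\<^sup>2 * (?d p * kern_op ?a p)" for p
      unfolding scheme_potential by (simp add: algebra_simps)
    then show ?thesis by (simp only: S_def sum_subtractf sum_distrib_left)
  qed
  have pointwise: "(3 * \<alpha> + 1) / 2 * (?d p)\<^sup>2 \<le> (1/4 * ?a p ^ 4 + (\<alpha> - 1) / 2 * (?a p)\<^sup>2) - (1/4 * ?b p ^ 4 + (\<alpha> - 1) / 2 * (?b p)\<^sup>2)
      + (?b p ^ 3 + 2 * \<alpha> * ?b p - (1 + \<alpha>) * ?a p) * ?d p" for p
  proof -
    have "(\<alpha> - 1) / 2 * (?a p)\<^sup>2 - (\<alpha> - 1) / 2 * (?b p)\<^sup>2 + (2 * \<alpha> * ?b p - (1 + \<alpha>) * ?a p) * ?d p = (3 * \<alpha> + 1) / 2 * (?d p)\<^sup>2"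
      by (simp add: \<delta>_def power2_eq_square field_simps)
    moreover have "?b p ^ 4 / 4 + ?b p ^ 3 * (?a p - ?b p) \<le> ?a p ^ 4 / 4" by (rule quartic_convex)
    moreover have "(?b p ^ 3 + 2 * \<alpha> * ?b p - (1 + \<alpha>) * ?a p) * ?d p
        = ?b p ^ 3 * ?d p + (2 * \<alpha> * ?b p - (1 + \<alpha>) * ?a p) * ?d p" by (simp add: algebra_simps)
    moreover have "?b p ^ 3 * (?a p - ?b p) = - (?b p ^ 3 * ?d p)" by (simp add: \<delta>_def algebra_simps)
    ultimately show ?thesis by linarith
  qed
  have "(\<Sum>p\<in>I. (3 * \<alpha> + 1) / 2 * (?d p)\<^sup>2) \<le> (\<Sum>p\<in>I. (1/4 * ?a p ^ 4 + (\<alpha> - 1) / 2 * (?a p)\<^sup>2) - (1/4 * ?b p ^ 4 + (\<alpha> - 1) / 2 * (?b p)\<^sup>2)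
      + (?b p ^ 3 + 2 * \<alpha> * ?b p - (1 + \<alpha>) * ?a p) * ?d p)"
    by (intro sum_mono pointwise)
  also have "\<dots> = (\<Sum>p\<in>I. 1/4 * ?a p ^ 4 + (\<alpha> - 1) / 2 * (?a p)\<^sup>2) - (\<Sum>p\<in>I. 1/4 * ?b p ^ 4 + (\<alpha> - 1) / 2 * (?b p)\<^sup>2)
      + (\<Sum>p\<in>I. (?b p ^ 3 + 2 * \<alpha> * ?b p - (1 + \<alpha>) * ?a p) * ?d p)"
    by (simp only: sum.distrib sum_subtractf)
  also have "\<dots> = flat_energy ?a - flat_energy ?b + (\<Sum>p\<in>I. ?w p * ?d p) - \<epsilon>\<^sup>2 / 2 * S ?d ?d"
    unfolding flat_energy_def w S_def[symmetric] Sbb by (simp add: field_simps)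
  also have "\<dots> \<le> flat_energy ?a - flat_energy ?b - \<epsilon>\<^sup>2 / 2 * S ?d ?d" using potential_increment[of n] by simp
  finally have 1: "(3 * \<alpha> + 1) / 2 * (\<Sum>p\<in>I. (?d p)\<^sup>2) + \<epsilon>\<^sup>2 / 2 * S ?d ?d \<le> flat_energy ?a - flat_energy ?b"
    by (simp add: sum_distrib_left)
  define D where "D = (\<lambda>i j. u (Suc n) i j - u n i j)"
  have "D \<in> grid_space N" using u_grid by (simp add: grid_space_def D_def)
  moreover have "flat D = ?d" by (simp add: fun_eq_iff flat_def \<delta>_def y_def D_def)
  ultimately have 2: "0 \<le> (1 + \<alpha>) * (\<Sum>p\<in>I. (?d p)\<^sup>2) + \<epsilon>\<^sup>2 * S ?d ?d"
    using explicit_part_nonneg[of D] by (simp add: S_def)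
  have 3: "1 * (\<Sum>p\<in>I. (?d p)\<^sup>2) \<le> \<alpha> * (\<Sum>p\<in>I. (?d p)\<^sup>2)"
    using \<alpha>_gt_1 by (intro mult_right_mono sum_nonneg) auto
  have "(3 * \<alpha> + 1) / 2 * (\<Sum>p\<in>I. (?d p)\<^sup>2) = \<alpha> * (\<Sum>p\<in>I. (?d p)\<^sup>2) + (1 + \<alpha>) * (\<Sum>p\<in>I. (?d p)\<^sup>2) / 2"
    by (simp add: field_simps)
  then show ?thesis using 1 2 3 by linarith
qed

section \<open>Removing the mass constraint\<close>

text \<open>The orthogonal projection onto the hyperplane of the initial mass.\<close>

definition "mean_shift x p = x p - 1 / card I * ((\<Sum>q\<in>I. x q) - (\<Sum>q\<in>I. y 0 q))"

text \<open>Outside the affine subspace of the correct mass, the energy is extended as a coercive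
  polynomial whose gradient on that subspace is the projected gradient.\<close>

definition "ext_energy x = flat_energy (mean_shift x) + ((\<Sum>q\<in>I. x q) - (\<Sum>q\<in>I. y 0 q))\<^sup>2"

lemma mean_shift_y: "mean_shift (y n) = y n"
  by (simp add: mean_shift_def mass[of n] fun_eq_iff)

lemma ext_energy_y: "ext_energy (y n) = flat_energy (y n)"
  by (simp add: ext_energy_def mean_shift_y mass[of n])

lemma polyfun_ext_energy: "polyfun I ext_energy"
proof -
  have 1: "polyfun I (\<lambda>x. mean_shift x p)" if "p \<in> I" for p
    unfolding mean_shift_def using that by (intro polyfun_intros)
  have "polyfun I (\<lambda>x. (\<Sum>p\<in>I. 1/4 * mean_shift x p ^ 4 + (\<alpha> - 1) / 2 * (mean_shift x p)\<^sup>2)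
      - \<epsilon>\<^sup>2 / 2 * (\<Sum>p\<in>I. mean_shift x p * (\<Sum>q\<in>I. kern p q * mean_shift x q)) + ((\<Sum>q\<in>I. x q) - (\<Sum>q\<in>I. y 0 q))\<^sup>2)"
    by (intro polyfun_intros 1)
  then show ?thesis by (simp add: ext_energy_def[abs_def] flat_energy_def kern_op_def)
qed

definition "kern_bound = (\<Sum>p\<in>I. \<Sum>q\<in>I. \<bar>kern p q\<bar>)"

lemma kern_le_bound: "p \<in> I \<Longrightarrow> q \<in> I \<Longrightarrow> \<bar>kern p q\<bar> \<le> kern_bound"
proof -
  assume p: "p \<in> I" and q: "q \<in> I"
  have "\<bar>kern p q\<bar> \<le> (\<Sum>q\<in>I. \<bar>kern p q\<bar>)" using q by (intro member_le_sum) auto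
  also have "\<dots> \<le> kern_bound" unfolding kern_bound_def
    using p by (intro member_le_sum[of p I "\<lambda>p. \<Sum>q\<in>I. \<bar>kern p q\<bar>"]) (auto intro: sum_nonneg)
  finally show ?thesis .
qed

lemma kern_bound_nonneg: "0 \<le> kern_bound"
  unfolding kern_bound_def by (intro sum_nonneg) auto

lemma abs_kern_op_le: "p \<in> I \<Longrightarrow> \<bar>kern_op x p\<bar> \<le> kern_bound * (\<Sum>q\<in>I. \<bar>x q\<bar>)"
  unfolding kern_op_def sum_distrib_left
  by (rule order_trans[OF sum_abs], rule sum_mono) (auto simp: abs_mult intro: mult_right_mono kern_le_bound)

text \<open>The quartic term dominates the nonlocal quadratic form, whatever the sign of the
  kernel.\<close>

lemma flat_energy_coercive:
  "(\<Sum>p\<in>I. (x p)\<^sup>2) - card I * (\<epsilon>\<^sup>2 / 2 * (kern_bound * card I) + 1)\<^sup>2 \<le> flat_energy x"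
proof -
  define M where "M = \<epsilon>\<^sup>2 / 2 * (kern_bound * card I)"
  have "(\<Sum>p\<in>I. x p * kern_op x p) \<le> (\<Sum>p\<in>I. \<bar>x p\<bar> * (kern_bound * (\<Sum>q\<in>I. \<bar>x q\<bar>)))"
  proof (rule sum_mono)
    fix p assume "p \<in> I"
    then have "\<bar>x p * kern_op x p\<bar> \<le> \<bar>x p\<bar> * (kern_bound * (\<Sum>q\<in>I. \<bar>x q\<bar>))"
      unfolding abs_mult by (intro mult_left_mono abs_kern_op_le) auto
    then show "x p * kern_op x p \<le> \<bar>x p\<bar> * (kern_bound * (\<Sum>q\<in>I. \<bar>x q\<bar>))" by linarith
  qed
  also have "\<dots> = kern_bound * (\<Sum>q\<in>I. \<bar>x q\<bar>)\<^sup>2"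
    by (simp add: sum_distrib_right[symmetric] power2_eq_square mult_ac)
  also have "\<dots> \<le> kern_bound * ((\<Sum>q\<in>I. \<bar>x q\<bar>\<^sup>2) * card I)"
    by (intro mult_left_mono sum_squared_le_sum_of_squares kern_bound_nonneg)
  finally have "\<epsilon>\<^sup>2 / 2 * (\<Sum>p\<in>I. x p * kern_op x p) \<le> \<epsilon>\<^sup>2 / 2 * (kern_bound * ((\<Sum>q\<in>I. \<bar>x q\<bar>\<^sup>2) * card I))"
    by (intro mult_left_mono) auto
  then have 1: "\<epsilon>\<^sup>2 / 2 * (\<Sum>p\<in>I. x p * kern_op x p) \<le> M * (\<Sum>q\<in>I. (x q)\<^sup>2)"
    by (simp add: M_def mult_ac)
  have "(\<Sum>p\<in>I. (x p)\<^sup>2 + M * (x p)\<^sup>2 - (M + 1)\<^sup>2) \<le> (\<Sum>p\<in>I. 1/4 * x p ^ 4 + (\<alpha> - 1) / 2 * (x p)\<^sup>2)"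
  proof (rule sum_mono)
    fix p
    \<comment> \<open>Completing the square gives the quadratic lower bound of the quartic with
      slope \<open>M + 1\<close>: \<open>M\<close> compensates the nonlocal term and 1
      remains.\<close>
    have "0 \<le> ((x p)\<^sup>2 / 2 - (M + 1))\<^sup>2" by simp
    then have "(x p)\<^sup>2 + M * (x p)\<^sup>2 - (M + 1)\<^sup>2 \<le> 1/4 * x p ^ 4"
      by (simp add: power2_eq_square power4_eq_xxxx field_simps)
    moreover have "0 \<le> (\<alpha> - 1) / 2 * (x p)\<^sup>2" using \<alpha>_gt_1 by simp
    ultimately show "(x p)\<^sup>2 + M * (x p)\<^sup>2 - (M + 1)\<^sup>2 \<le> 1/4 * x p ^ 4 + (\<alpha> - 1) / 2 * (x p)\<^sup>2" by linarith
  qed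
  then have "(\<Sum>p\<in>I. (x p)\<^sup>2) + M * (\<Sum>p\<in>I. (x p)\<^sup>2) - card I * (M + 1)\<^sup>2
      \<le> (\<Sum>p\<in>I. 1/4 * x p ^ 4 + (\<alpha> - 1) / 2 * (x p)\<^sup>2)"
    by (simp add: sum_subtractf sum.distrib sum_distrib_left)
  then show ?thesis using 1 unfolding flat_energy_def M_def[symmetric] by linarith
qed

text \<open>The squared mass defect controls the component lost by the projection.\<close>

lemma ext_energy_coercive:
  "1/2 * (\<Sum>p\<in>I. (x p)\<^sup>2) - card I * (\<epsilon>\<^sup>2 / 2 * (kern_bound * card I) + 1)\<^sup>2 \<le> ext_energy x"
proof -
  define s where "s = (\<Sum>q\<in>I. x q) - (\<Sum>q\<in>I. y 0 q)"
  have "(\<Sum>p\<in>I. (x p)\<^sup>2) \<le> (\<Sum>p\<in>I. 2 * (mean_shift x p)\<^sup>2 + 2 * (1 / card I * s)\<^sup>2)"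
  proof (rule sum_mono)
    fix p
    have "x p = mean_shift x p + 1 / card I * s" by (simp add: mean_shift_def s_def)
    then show "(x p)\<^sup>2 \<le> 2 * (mean_shift x p)\<^sup>2 + 2 * (1 / card I * s)\<^sup>2"
      using sum_squares_bound[of "mean_shift x p" "1 / card I * s"] by (simp add: power2_sum)
  qed
  also have "\<dots> = 2 * (\<Sum>p\<in>I. (mean_shift x p)\<^sup>2) + 2 * (s\<^sup>2 / card I)"
    using I_nonempty(2) by (simp add: sum.distrib sum_distrib_left power2_eq_square)
  also have "s\<^sup>2 / card I \<le> s\<^sup>2" using I_nonempty(2) by (simp add: divide_le_eq mult_le_cancel_left1)
  finally show ?thesis
    using flat_energy_coercive[of "mean_shift x"] unfolding ext_energy_def s_def[symmetric] by simp
qed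

lemma flat_energy_line_derivative:
  "((\<lambda>s. flat_energy (\<lambda>q. x q + s * w q)) has_real_derivative
     (\<Sum>q\<in>I. (x q ^ 3 + (\<alpha> - 1) * x q - \<epsilon>\<^sup>2 * kern_op x q) * w q)) (at 0)"
proof -
  define S where "S x z = (\<Sum>p\<in>I. x p * kern_op z p)" for x z
  have quad: "S (\<lambda>q. x q + s * w q) (\<lambda>q. x q + s * w q) = S x x + s * (2 * S w x) + s\<^sup>2 * S w w" for s
  proof -
    have "S (\<lambda>q. x q + s * w q) (\<lambda>q. x q + s * w q) = S x x + s * S x w + s * S w x + s\<^sup>2 * S w w"
      unfolding S_def kern_op_add kern_op_scale
      by (simp add: algebra_simps sum.distrib sum_distrib_left power2_eq_square)
    then show ?thesis using kern_op_swap[of x w] by (simp add: S_def)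
  qed
  have "((\<lambda>s. (\<Sum>p\<in>I. 1/4 * (x p + s * w p) ^ 4 + (\<alpha> - 1) / 2 * (x p + s * w p)\<^sup>2)
      - \<epsilon>\<^sup>2 / 2 * (S x x + s * (2 * S w x) + s\<^sup>2 * S w w)) has_real_derivative
      (\<Sum>p\<in>I. x p ^ 3 * w p + (\<alpha> - 1) * x p * w p) - \<epsilon>\<^sup>2 / 2 * (2 * S w x)) (at 0)"
    by (auto intro!: derivative_eq_intros sum.cong simp: field_simps)
  moreover have "(\<Sum>p\<in>I. x p ^ 3 * w p + (\<alpha> - 1) * x p * w p) - \<epsilon>\<^sup>2 / 2 * (2 * S w x)
      = (\<Sum>q\<in>I. (x q ^ 3 + (\<alpha> - 1) * x q - \<epsilon>\<^sup>2 * kern_op x q) * w q)"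
    by (simp add: S_def algebra_simps sum.distrib sum_subtractf sum_distrib_left)
  ultimately show ?thesis unfolding flat_energy_def S_def[symmetric] quad by simp
qed

text \<open>Moving one coordinate by \<open>s\<close> changes the mass by \<open>s\<close>; the
  projection spreads \<open>- s\<close> evenly, and the squared defect has derivative 0 at
  \<open>s = 0\<close>.\<close>

lemma ext_energy_partial:
  assumes D: "has_gradient I ext_energy D" and p: "p \<in> I"
  shows "D p (y n) = (\<Sum>q\<in>I. (y n q ^ 3 + (\<alpha> - 1) * y n q - \<epsilon>\<^sup>2 * kern_op (y n) q) * ((if q = p then 1 else 0) - 1 / card I))"
proof -
  let ?w = "\<lambda>q. (if q = p then 1 else 0) - 1 / real (card I)"
  have sum: "(\<Sum>q\<in>I. y n q + s * (if q = p then 1 else 0)) = (\<Sum>q\<in>I. y 0 q) + s" for s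
    using p by (simp add: sum.distrib mass[of n] if_distrib[of "\<lambda>c. _ * c"] cong: if_cong)
  have shift: "mean_shift (\<lambda>q. y n q + s * (if q = p then 1 else 0)) = (\<lambda>q. y n q + s * ?w q)" for s
    unfolding mean_shift_def sum by (simp add: fun_eq_iff algebra_simps)
  have "((\<lambda>s. flat_energy (\<lambda>q. y n q + s * ?w q) + s\<^sup>2) has_real_derivative
     (\<Sum>q\<in>I. (y n q ^ 3 + (\<alpha> - 1) * y n q - \<epsilon>\<^sup>2 * kern_op (y n) q) * ?w q) + 0) (at 0)"
    by (intro DERIV_add flat_energy_line_derivative) (auto intro!: derivative_eq_intros)
  then have "((\<lambda>s. ext_energy (\<lambda>q. y n q + s * (if q = p then 1 else 0))) has_real_derivative
     (\<Sum>q\<in>I. (y n q ^ 3 + (\<alpha> - 1) * y n q - \<epsilon>\<^sup>2 * kern_op (y n) q) * ?w q)) (at 0)"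
    unfolding ext_energy_def shift sum by simp
  from DERIV_unique[OF has_gradient_partial[OF finite_grid_points D p] this] show ?thesis .
qed

text \<open>On the iterates the gradient of the energy is the new potential up to terms linear in
  the increment. The weights sum to zero, so only the oscillation of the potential counts, and the
  Poincare inequality bounds it by its Laplacian, the increment over \<tau>.\<close>

lemma gradient_bound:
  assumes D: "has_gradient I ext_energy D" and p: "p \<in> I"
  shows "\<bar>D p (y (Suc n))\<bar> \<le> card I * (2 * card I * h\<^sup>2 / \<tau> + (1 + \<alpha>) + \<epsilon>\<^sup>2 * kern_bound) * (\<Sum>q\<in>I. \<bar>\<delta> n q\<bar>)"
proof -
  let ?w = "\<lambda>q. (if q = p then 1 else 0) - 1 / real (card I)" and ?\<omega> = "flat (\<omega> (Suc n))" and ?N = "\<Sum>q\<in>I. \<bar>\<delta> n q\<bar>"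
  let ?v = "\<lambda>q. (1 + \<alpha>) * \<delta> n q + \<epsilon>\<^sup>2 * kern_op (\<delta> n) q"
  have "y (Suc n) q ^ 3 + (\<alpha> - 1) * y (Suc n) q - \<epsilon>\<^sup>2 * kern_op (y (Suc n)) q = ?\<omega> q - ?v q" for q
  proof -
    have "y (Suc n) = (\<lambda>q. y n q + \<delta> n q)" by (simp add: \<delta>_def fun_eq_iff)
    then have "kern_op (y (Suc n)) q = kern_op (y n) q + kern_op (\<delta> n) q" using kern_op_add by metis
    then show ?thesis unfolding scheme_potential by (simp add: \<delta>_def algebra_simps)
  qed
  then have Dp: "D p (y (Suc n)) = (\<Sum>q\<in>I. (?\<omega> q - ?v q) * ?w q)"
    using ext_energy_partial[OF D p, of "Suc n"] by simp
  have w0: "(\<Sum>q\<in>I. ?w q) = 0" using p I_nonempty by (simp add: sum_subtractf)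
  have w1: "\<bar>?w q\<bar> \<le> 1" for q
  proof -
    have "0 \<le> 1 / real (card I)" "1 / real (card I) \<le> 1" using I_nonempty(2) by (simp_all add: divide_le_eq)
    then show ?thesis by (auto simp: abs_if)
  qed
  have "(\<Sum>q\<in>I. ?\<omega> q * ?w q) = (\<Sum>q\<in>I. (?\<omega> q - ?\<omega> p) * ?w q)"
    using w0 by (simp add: left_diff_distrib sum_subtractf sum_distrib_left[symmetric])
  then have eq: "D p (y (Suc n)) = (\<Sum>q\<in>I. ((?\<omega> q - ?\<omega> p) - ?v q) * ?w q)"
    unfolding Dp by (simp add: left_diff_distrib sum_subtractf)
  have "\<bar>\<Sum>q\<in>I. ((?\<omega> q - ?\<omega> p) - ?v q) * ?w q\<bar> \<le> (\<Sum>q\<in>I. (2 * card I * h\<^sup>2 / \<tau> + (1 + \<alpha>) + \<epsilon>\<^sup>2 * kern_bound) * ?N)"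
  proof (rule order_trans[OF sum_abs], rule sum_mono)
    fix q assume q: "q \<in> I"
    have "\<bar>?\<omega> q - ?\<omega> p\<bar> \<le> edge_variation N (\<omega> (Suc n))"
      unfolding flat_def using q p by (rule osc_le_edge_variation)
    also have "\<dots> \<le> 2 * card I * h\<^sup>2 * (\<Sum>q\<in>I. \<bar>\<delta> n q / \<tau>\<bar>)"
      by (rule poincare_lap[OF \<omega>_grid h_pos N]) (rule scheme_lap)
    also have "\<dots> = 2 * card I * h\<^sup>2 / \<tau> * ?N"
      using \<tau> by (simp add: abs_divide sum_divide_distrib[symmetric])
    finally have 1: "\<bar>?\<omega> q - ?\<omega> p\<bar> \<le> 2 * card I * h\<^sup>2 / \<tau> * ?N" .
    have "\<bar>\<delta> n q\<bar> \<le> ?N" using q by (intro member_le_sum[of q I "\<lambda>q. \<bar>\<delta> n q\<bar>"]) auto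
    then have 2: "\<bar>(1 + \<alpha>) * \<delta> n q\<bar> \<le> (1 + \<alpha>) * ?N"
      unfolding abs_mult using \<alpha>_gt_1 by (intro mult_mono) auto
    have 3: "\<bar>\<epsilon>\<^sup>2 * kern_op (\<delta> n) q\<bar> \<le> \<epsilon>\<^sup>2 * (kern_bound * ?N)"
      unfolding abs_mult using abs_kern_op_le[OF q, of "\<delta> n"] by (simp add: mult_left_mono)
    have "\<bar>((?\<omega> q - ?\<omega> p) - ?v q) * ?w q\<bar> \<le> \<bar>(?\<omega> q - ?\<omega> p) - ?v q\<bar> * 1"
      unfolding abs_mult using w1[of q] by (intro mult_left_mono) auto
    also have "\<dots> \<le> 2 * card I * h\<^sup>2 / \<tau> * ?N + (1 + \<alpha>) * ?N + \<epsilon>\<^sup>2 * (kern_bound * ?N)"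
    proof -
      have "\<bar>A - (B + C)\<bar> * 1 \<le> a + b + c" if "\<bar>A\<bar> \<le> a" "\<bar>B\<bar> \<le> b" "\<bar>C\<bar> \<le> c" for A B C a b c :: real
        using that unfolding abs_le_iff mult_1_right by linarith
      from this[OF 1 2 3] show ?thesis .
    qed
    finally show "\<bar>((?\<omega> q - ?\<omega> p) - ?v q) * ?w q\<bar> \<le> (2 * card I * h\<^sup>2 / \<tau> + (1 + \<alpha>) + \<epsilon>\<^sup>2 * kern_bound) * ?N"
      by (simp add: distrib_right mult.assoc)
  qed
  then show ?thesis unfolding eq by (simp only: sum_constant mult.assoc)
qed

section \<open>Convergence of the scheme\<close>

theorem increments_summable: "summable (\<lambda>n. \<Sum>p\<in>I. \<bar>y (Suc n) p - y n p\<bar>)"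
proof -
  from polyfun_gradient_exists[OF finite_grid_points polyfun_ext_energy] obtain D where
    D: "\<forall>p. polyfun I (D p)" "has_gradient I ext_energy D" by blast
  show ?thesis
  proof (rule gradient_like_descent_summable[OF finite_grid_points polyfun_ext_energy _ ext_energy_coercive _ D(2)])
    show "polyfun I (D p)" for p using D(1) by blast
    show "1 / real (card I) * (\<Sum>p\<in>I. \<bar>y (Suc n) p - y n p\<bar>)\<^sup>2 \<le> ext_energy (y n) - ext_energy (y (Suc n))" for n
    \<comment> \<open>The factor \<open>1 / card I\<close> comes from Cauchy-Schwarz, since the
      abstract theorem measures steps in the sum norm.\<close>
    proof -
      have "(\<Sum>p\<in>I. \<bar>\<delta> n p\<bar>)\<^sup>2 \<le> (\<Sum>p\<in>I. \<bar>\<delta> n p\<bar>\<^sup>2) * card I" by (rule sum_squared_le_sum_of_squares)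
      then have "1 / real (card I) * (\<Sum>p\<in>I. \<bar>\<delta> n p\<bar>)\<^sup>2 \<le> (\<Sum>p\<in>I. (\<delta> n p)\<^sup>2)"
        using I_nonempty(2) by (simp add: divide_le_eq)
      then show ?thesis using energy_descent[of n] unfolding ext_energy_y by (simp add: \<delta>_def)
    qed
    show "\<bar>D p (y (Suc n))\<bar> \<le> card I * (2 * card I * h\<^sup>2 / \<tau> + (1 + \<alpha>) + \<epsilon>\<^sup>2 * kern_bound) * (\<Sum>p\<in>I. \<bar>y (Suc n) p - y n p\<bar>)"
      if "p \<in> I" for p n
      using gradient_bound[OF D(2) that, of n] by (simp add: \<delta>_def)
    show "0 \<le> card I * (2 * card I * h\<^sup>2 / \<tau> + (1 + \<alpha>) + \<epsilon>\<^sup>2 * kern_bound)"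
      using \<tau> \<alpha>_gt_1 kern_bound_nonneg by (intro mult_nonneg_nonneg add_nonneg_nonneg) auto
  qed (use I_nonempty in auto)
qed

text \<open>Summable increments make each value the limit of a telescoping series; periodicity
  reaches the indices outside the grid.\<close>

lemma u_convergent: "\<exists>l. (\<lambda>n. u n i j) \<longlonglongrightarrow> l"
proof -
  define p where "p = (1 + (i - 1) mod int N, 1 + (j - 1) mod int N)"
  have p: "p \<in> I" using mod_in_range[OF N] by (simp add: p_def grid_points_def)
  have "summable (\<lambda>n. y (Suc n) p - y n p)"
  proof (rule summable_comparison_test[OF _ increments_summable])
    show "\<exists>K. \<forall>n\<ge>K. norm (y (Suc n) p - y n p) \<le> (\<Sum>p\<in>I. \<bar>y (Suc n) p - y n p\<bar>)"
      using p by (auto intro!: member_le_sum[of p I "\<lambda>p. \<bar>y (Suc _) p - y _ p\<bar>"])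
  qed
  then have "(\<lambda>n. \<Sum>k<n. y (Suc k) p - y k p) \<longlonglongrightarrow> (\<Sum>k. y (Suc k) p - y k p)" by (rule summable_LIMSEQ)
  then have "(\<lambda>n. (y n p - y 0 p) + y 0 p) \<longlonglongrightarrow> (\<Sum>k. y (Suc k) p - y k p) + y 0 p"
    unfolding sum_lessThan_telescope[of "\<lambda>n. y n p"] by (intro tendsto_intros)
  moreover have "y n p = u n i j" for n
    using grid_space_mod[OF u_grid, of n i j] by (simp add: y_def flat_def p_def)
  ultimately show ?thesis by auto
qed

theorem converges_to_steady_state:
  "\<exists>u_inf \<omega>_inf. (\<lambda>n. (u n, \<omega> n)) \<longlonglongrightarrow> (u_inf, \<omega>_inf) \<and>
     steady_state h N J \<epsilon> u_inf \<omega>_inf \<and> grid_inner N u_inf grid_one = grid_inner N (u 0) grid_one"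
proof -
  have "\<forall>i. \<forall>j. \<exists>l. (\<lambda>n. u n i j) \<longlonglongrightarrow> l" using u_convergent by blast
  then obtain l where l: "\<And>i j. (\<lambda>n. u n i j) \<longlonglongrightarrow> l i j" by metis
  have lS: "(\<lambda>n. u (Suc n) i j) \<longlonglongrightarrow> l i j" for i j using l by (rule LIMSEQ_Suc)
  have conv_lim: "(\<lambda>n. conv h N J (u n) i j) \<longlonglongrightarrow> conv h N J l i j" for i j
    unfolding conv_def by (intro tendsto_intros l)
  \<comment> \<open>The limit of the scheme's formula: with old and new iterate merged,
    \<open>2 * \<alpha> - 1 - \<alpha>\<close> collapses to \<open>\<alpha> - 1\<close>, the linear
    coefficient of the steady-state potential.\<close>
  define w where "w i j = l i j ^ 3 + 2 * \<epsilon>\<^sup>2 * conv_one h N J * l i j - l i j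
    - \<epsilon>\<^sup>2 * conv_one h N J * l i j - \<epsilon>\<^sup>2 * conv h N J l i j" for i j
  have "(\<lambda>n. \<omega> (Suc n) i j) \<longlonglongrightarrow> w i j" for i j
    unfolding scheme_\<omega> w_def by (intro tendsto_intros l lS conv_lim)
  \<comment> \<open>The scheme determines the potentials from index 1 on; the initial one does not
    affect the limit.\<close>
  then have w: "(\<lambda>n. \<omega> n i j) \<longlonglongrightarrow> w i j" for i j by (rule LIMSEQ_imp_Suc)
  have grid: "g \<in> grid_space N" if "\<And>i j. (\<lambda>n. f n i j) \<longlonglongrightarrow> g i j" "\<And>n. f n \<in> grid_space N"
    for f :: "nat \<Rightarrow> grid" and g
    unfolding grid_space_def
  proof (intro CollectI allI conjI)
    fix i j
    show "g (i + int N) j = g i j"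
      using LIMSEQ_unique[OF that(1)[of "i + int N" j]] that(1)[of i j] grid_space_periodic(1)[OF that(2)] by simp
    show "g i (j + int N) = g i j"
      using LIMSEQ_unique[OF that(1)[of i "j + int N"]] that(1)[of i j] grid_space_periodic(2)[OF that(2)] by simp
  qed
  have lap: "lap h w i j = 0" for i j
  proof -
    have "(\<lambda>n. lap h (\<omega> n) i j) \<longlonglongrightarrow> lap h w i j" unfolding lap_def using h_pos by (intro tendsto_intros w) auto
    then have "(\<lambda>n. lap h (\<omega> (Suc n)) i j) \<longlonglongrightarrow> lap h w i j" by (rule LIMSEQ_Suc)
    moreover have "(\<lambda>n. (u (Suc n) i j - u n i j) / \<tau>) \<longlonglongrightarrow> (l i j - l i j) / \<tau>"
      using \<tau> by (intro tendsto_intros l lS) auto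
    ultimately show ?thesis using LIMSEQ_unique unfolding scheme_u by fastforce
  qed
  have steady: "steady_state h N J \<epsilon> l w"
    unfolding steady_state_def
  proof (intro conjI allI)
    show "l \<in> grid_space N" "w \<in> grid_space N" using grid[OF l u_grid] grid[OF w \<omega>_grid] .
    show "lap h w i j = 0" for i j by (rule lap)
    show "w i j = deriv pot (l i j) + \<epsilon>\<^sup>2 * conv_one h N J * l i j - \<epsilon>\<^sup>2 * conv h N J l i j" for i j
      by (simp add: deriv_pot w_def)
  qed
  have lim: "(\<lambda>n. grid_inner N (u n) grid_one) \<longlonglongrightarrow> grid_inner N l grid_one"
    unfolding grid_inner_def by (intro tendsto_intros l)
  have "(\<lambda>n. grid_inner N (u n) grid_one) = (\<lambda>n. grid_inner N (u 0) grid_one)"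
    by (rule ext) (use mass in \<open>simp add: grid_inner_flat y_def grid_one_def flat_def\<close>)
  then have "(\<lambda>n. grid_inner N (u n) grid_one) \<longlonglongrightarrow> grid_inner N (u 0) grid_one"
    by (metis tendsto_const)
  with lim have "grid_inner N l grid_one = grid_inner N (u 0) grid_one" by (rule LIMSEQ_unique)
  moreover have "(\<lambda>n. (u n, \<omega> n)) \<longlonglongrightarrow> (l, w)"
    by (intro tendsto_Pair) (simp_all add: tendsto_fun_iff l w)
  ultimately show ?thesis using steady by blast
qed

end

theorem theorem3p6:
  fixes L h \<epsilon> \<tau> :: real and N m :: nat
    and J :: "real \<times> real \<Rightarrow> real"
    and u \<omega> :: "nat \<Rightarrow> grid"
  assumes "L > 0" and "N \<ge> 1" and h: "h = L / real N" and "\<epsilon> > 0"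
    and J_integrable: "set_integrable lborel ({0<..<L} \<times> {0<..<L}) J"
    and J_smooth: "C_diff m J"
    and J_periodic: "\<And>x y. J (x + L, y) = J (x, y)" "\<And>x y. J (x, y + L) = J (x, y)"
    and J_even: "\<And>x. J (- x) = J x"
    and J_mass: "kernel_mass L J > 0"
    and gamma: "\<epsilon>\<^sup>2 * kernel_mass L J - 1 > 0"
    and gamma0: "\<epsilon>\<^sup>2 * conv_one h N J - 1 > 0"
    and splitting: "convex_splitting h N J \<epsilon>"
    and "\<tau> > 0"
    and u_grid: "\<And>n. u n \<in> grid_space N"
    and \<omega>_grid: "\<And>n. \<omega> n \<in> grid_space N"
    and scheme_u: "\<And>n i j. (u (Suc n) i j - u n i j) / \<tau> = lap h (\<omega> (Suc n)) i j"
    and scheme_\<omega>: "\<And>n i j. \<omega> (Suc n) i j =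
          (u (Suc n) i j) ^ 3 + 2 * \<epsilon>\<^sup>2 * conv_one h N J * u (Suc n) i j
          - u n i j - \<epsilon>\<^sup>2 * conv_one h N J * u n i j - \<epsilon>\<^sup>2 * conv h N J (u n) i j"
  shows "\<exists>u_inf \<omega>_inf.
           (\<lambda>n. (u n, \<omega> n)) \<longlonglongrightarrow> (u_inf, \<omega>_inf) \<and>
           steady_state h N J \<epsilon> u_inf \<omega>_inf \<and>
           grid_inner N u_inf grid_one = grid_inner N (u 0) grid_one"
proof -
  interpret convex_splitting_scheme L h \<epsilon> \<tau> N J u \<omega>
    by unfold_locales (fact assms)+
  show ?thesis by (rule converges_to_steady_state)
qed

end
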